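(* Let $\beta>0$ and let $\Lambda\subset\mathbb Z^d$ be a finite box. Then the periodic Gibbs measures satisfy $$\nu^{\rm per}_{\beta,\Lambda}\;\Rightarrow\;\nu^{\rm qcp}_{\beta,\Lambda}\qquad\text{as } m\to+\infty,$$ where $\nu^{\rm per}_{\beta,\Lambda}$ depends on the reduced mass $m>0$ through its Gaussian reference measure, and $\Rightarrow$ denotes weak convergence of probability measures on $\Omega_{\beta,\Lambda}$ (convergence of integrals of all bounded continuous functions $\Omega_{\beta,\Lambda}\to\mathbb R$).
   Context: Standing assumptions (translation-invariant model). $d\ge1$; $J:[0,\infty)\to\mathbb R$ vanishes when its argument exceeds some $r>0$; $c:=\sum_{k\in\mathbb Z^d}|J(|j-k|)|<\infty$ (independent of $j$; $|\cdot|$ Euclidean distance). $U:\mathbb R\to\mathbb R$ is continuous and there are $b\in\mathbb R$ and $\tilde c>\max\{c-1,0\}$ with $U(x)\ge\frac12\tilde cx^2+b$ for all $x\in\mathbb R$. Box and periodic metric. $\Lambda=\{k\in\mathbb Z^d: k^{(0)}_l\le k_l\le k^{(1)}_l,\ l=1,\dots,d\}$ with integers $k^{(0)}_l<k^{(1)}_l$. For $j,k\in\Lambda$, $|j_l-k_l|_\Lambda=\min\{|j_l-k_l|;\ k^{(1)}_l-k^{(0)}_l+1-|j_l-k_l|\}$ and $|j-k|_\Lambda^2=\sum_{l=1}^d|j_l-k_l|_\Lambda^2$. Loop spaces. $C_\beta=\{\omega\in C([0,\beta],\mathbb R):\omega(0)=\omega(\beta)\}$ with the sup norm; $\Omega_{\beta,\Lambda}=(C_\beta)^\Lambda$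 with the product topology. Reference measures. For $m>0$, $\gamma^{(m)}_\beta$ is the centered Gaussian measure on $L^2([0,\beta])$ with covariance operator $(-m\Delta_\beta+1)^{-1}$, where $\Delta_\beta$ is the Laplacian on $[0,\beta]$ with periodic boundary conditions (covariance eigenvalues $(mq^2+1)^{-1}$, $q\in\frac{2\pi}{\beta}\mathbb Z$, on the trigonometric orthonormal basis $\beta^{-1/2}$, $\sqrt{2/\beta}\cos q\tau$ for $q>0$, $\sqrt{2/\beta}\sin q\tau$ for $q<0$). It satisfies $\gamma_\beta^{(m)}(C_\beta)=1$ and is regarded as a measure on $C_\beta$; $\gamma^{(m)}_{\beta,\Lambda}=\prod_{j\in\Lambda}\gamma^{(m)}_\beta$ on $\Omega_{\beta,\Lambda}$. Further, $\chi_{\beta,\Lambda}(dx_\Lambda)=\prod_{j\in\Lambda}\sqrt{\beta/2\pi}\,e^{-\beta x_j^2/2}dx_j$ on $\mathbb R^\Lambda$, and $\gamma^{\rm qc}_{\beta,\Lambda}$ is the image of $\chi_{\beta,\Lambda}$ under the map sending $x_\Lambda$ to the configuration of constant loops $\omega_j(\tau)\equiv x_j$. Periodic Gibbs measures. With $$E^{\rm per}_{\beta,\Lambda}(\omega_\Lambda)=\sum_{j\in\Lambda}\int_0^\beta U(\omega_j(\tau))d\tau+\tfrac12\sum_{j,k\in\Lambda}J(|j-k|_\Lambda)\int_0^\beta\omega_j(\tau)\omega_k(\tau)d\tau,$$ $\nu^{\rm per}_{\beta,\Lambda}(d\omega_\Lambda)=\frac{1}{Z^{\rm per}}e^{-E^{\rm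 per}_{\beta,\Lambda}(\omega_\Lambda)}\gamma^{(m)}_{\beta,\Lambda}(d\omega_\Lambda)$ and $\nu^{\rm qcp}_{\beta,\Lambda}(d\omega_\Lambda)=\frac{1}{Z^{\rm qcp}}e^{-E^{\rm per}_{\beta,\Lambda}(\omega_\Lambda)}\gamma^{\rm qc}_{\beta,\Lambda}(d\omega_\Lambda)$, with $Z^{\rm per},Z^{\rm qcp}$ the normalizing constants. *)

theory Defs
  imports "HOL-Probability.Probability"
begin

definition borel_of :: "'a topology \<Rightarrow> 'a measure" where
  "borel_of X = sigma (topspace X) {A. openin X A}"

definition weakly_converges ::
    "'a topology \<Rightarrow> ('i \<Rightarrow> 'a measure) \<Rightarrow> 'a measure \<Rightarrow> 'i filter \<Rightarrow> bool" where
  "weakly_converges X N M F \<longleftrightarrow>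
     (\<forall>\<^sub>F i in F. prob_space (N i) \<and> sets (N i) = sets (borel_of X)) \<and>
     prob_space M \<and> sets M = sets (borel_of X) \<and>
     (\<forall>f. continuous_map X euclideanreal f \<and> bounded (f ` topspace X) \<longrightarrow>
        ((\<lambda>i. \<integral>\<omega>. f \<omega> \<partial>N i) \<longlongrightarrow> (\<integral>\<omega>. f \<omega> \<partial>M)) F)"


section \<open>Boxes in the integer lattice\<close>

definition box_of :: "int ^ 'd \<Rightarrow> int ^ 'd \<Rightarrow> (int ^ 'd) set" where
  "box_of k0 k1 = {k. \<forall>l. k0 $ l \<le> k $ l \<and> k $ l \<le> k1 $ l}"

definition lattice_dist :: "int ^ 'd \<Rightarrow> int ^ 'd \<Rightarrow> real" where
  "lattice_dist j k = sqrt (\<Sum>l\<in>UNIV. real_of_int (j $ l - k $ l) ^ 2)"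

definition per_dist :: "int ^ 'd \<Rightarrow> int ^ 'd \<Rightarrow> int ^ 'd \<Rightarrow> int ^ 'd \<Rightarrow> real" where
  "per_dist k0 k1 j k =
     sqrt (\<Sum>l\<in>UNIV. real_of_int
       (min \<bar>j $ l - k $ l\<bar> (k1 $ l - k0 $ l + 1 - \<bar>j $ l - k $ l\<bar>)) ^ 2)"


section \<open>Loop spaces\<close>

text \<open>A loop is an extensional function: \<^term>\<open>undefined\<close> outside the interval, so that equality of
  functions is equality on the interval. The metric of \<^const>\<open>cfunspace\<close> is the sup distance.\<close>

definition loop_metric :: "real \<Rightarrow> (real \<Rightarrow> real) metric" where
  "loop_metric \<beta> =
     submetric (cfunspace (top_of_set {0..\<beta>}) euclidean_metric) {\<omega>. \<omega> 0 = \<omega> \<beta>}"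

definition loop_top :: "real \<Rightarrow> (real \<Rightarrow> real) topology" where
  "loop_top \<beta> = mtopology_of (loop_metric \<beta>)"

definition config_top :: "real \<Rightarrow> 'k set \<Rightarrow> ('k \<Rightarrow> real \<Rightarrow> real) topology" where
  "config_top \<beta> \<Lambda> = product_topology (\<lambda>_. loop_top \<beta>) \<Lambda>"


section \<open>Gaussian measures on \<open>L\<^sup>2([0,\<beta>])\<close>\<close>

text \<open>Elements of \<open>L\<^sup>2([0,\<beta>])\<close> are represented by square-integrable functions, not by classes modulo
  null sets. The open sets below are those of the seminorm, hence saturated under a.e. equality, and
  they generate the same \<open>\<sigma>\<close>-algebra as on the quotient.\<close>

definition L2 :: "real \<Rightarrow> (real \<Rightarrow> real) set" where
  "L2 \<beta> = {h. set_borel_measurable lborel {0..\<beta>} h \<and>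
               set_integrable lborel {0..\<beta>} (\<lambda>\<tau>. (h \<tau>)\<^sup>2)}"

definition L2_inner :: "real \<Rightarrow> (real \<Rightarrow> real) \<Rightarrow> (real \<Rightarrow> real) \<Rightarrow> real" where
  "L2_inner \<beta> g h = (LINT \<tau>:{0..\<beta>}|lborel. g \<tau> * h \<tau>)"

definition L2_dist :: "real \<Rightarrow> (real \<Rightarrow> real) \<Rightarrow> (real \<Rightarrow> real) \<Rightarrow> real" where
  "L2_dist \<beta> g h = sqrt (L2_inner \<beta> (\<lambda>\<tau>. g \<tau> - h \<tau>) (\<lambda>\<tau>. g \<tau> - h \<tau>))"

definition L2_borel :: "real \<Rightarrow> (real \<Rightarrow> real) measure" where
  "L2_borel \<beta> = sigma (L2 \<beta>)
     {A. A \<subseteq> L2 \<beta> \<and> (\<forall>g\<in>A. \<exists>e>0. \<forall>h\<in>L2 \<beta>. L2_dist \<beta> g h < e \<longrightarrow> h \<in> A)}"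

text \<open>The centered Gaussian measure with covariance operator \<open>K\<close>, through its characteristic
  functional \<open>h \<mapsto> exp (- \<langle>h, K h\<rangle> / 2)\<close>.\<close>

definition centered_gaussian_L2 ::
    "real \<Rightarrow> ((real \<Rightarrow> real) \<Rightarrow> (real \<Rightarrow> real)) \<Rightarrow> (real \<Rightarrow> real) measure \<Rightarrow> bool" where
  "centered_gaussian_L2 \<beta> K \<Gamma> \<longleftrightarrow>
     prob_space \<Gamma> \<and> sets \<Gamma> = sets (L2_borel \<beta>) \<and>
     (\<forall>h\<in>L2 \<beta>. (CLINT \<omega>|\<Gamma>. iexp (L2_inner \<beta> h \<omega>))
                 = complex_of_real (exp (- L2_inner \<beta> h (K h) / 2)))"

text \<open>The integer \<open>n\<close> indexes the frequency \<open>q = 2 \<pi> n / \<beta>\<close>.\<close>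

definition freq :: "real \<Rightarrow> int \<Rightarrow> real" where
  "freq \<beta> n = 2 * pi * of_int n / \<beta>"

definition trig_basis :: "real \<Rightarrow> int \<Rightarrow> real \<Rightarrow> real" where
  "trig_basis \<beta> n \<tau> =
     (if n = 0 then 1 / sqrt \<beta>
      else if n > 0 then sqrt (2 / \<beta>) * cos (freq \<beta> n * \<tau>)
      else sqrt (2 / \<beta>) * sin (freq \<beta> n * \<tau>))"

text \<open>The operator \<open>(- m \<Delta>\<^sub>\<beta> + 1)\<^sup>-\<^sup>1\<close> with periodic boundary conditions, in its spectral form.
  The series converges absolutely for every \<open>\<tau>\<close>, since the eigenvalues are summable.\<close>

definition loop_covariance :: "real \<Rightarrow> real \<Rightarrow> (real \<Rightarrow> real) \<Rightarrow> real \<Rightarrow> real" where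
  "loop_covariance \<beta> m h \<tau> =
     (\<Sum>\<^sub>\<infinity>n\<in>UNIV. inverse (m * (freq \<beta> n)\<^sup>2 + 1) * L2_inner \<beta> (trig_basis \<beta> n) h * trig_basis \<beta> n \<tau>)"

text \<open>\<open>\<gamma>\<close> is the Gaussian measure regarded as a measure on the loop space: its image under the
  inclusion of the loop space into \<open>L\<^sup>2([0,\<beta>])\<close> is that Gaussian measure. This determines \<open>\<gamma>\<close>
  uniquely.\<close>

definition loop_gaussian :: "real \<Rightarrow> real \<Rightarrow> (real \<Rightarrow> real) measure \<Rightarrow> bool" where
  "loop_gaussian \<beta> m \<gamma> \<longleftrightarrow>
     sets \<gamma> = sets (borel_of (loop_top \<beta>)) \<and>
     centered_gaussian_L2 \<beta> (loop_covariance \<beta> m) (distr \<gamma> (L2_borel \<beta>) (\<lambda>\<omega>. \<omega>))"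


section \<open>Reference measures and periodic Gibbs measures\<close>

definition chi_measure :: "real \<Rightarrow> 'k set \<Rightarrow> ('k \<Rightarrow> real) measure" where
  "chi_measure \<beta> \<Lambda> =
     (\<Pi>\<^sub>M j\<in>\<Lambda>. density lborel (\<lambda>x. ennreal (sqrt (\<beta> / (2 * pi)) * exp (- \<beta> * x\<^sup>2 / 2))))"

definition qc_reference :: "real \<Rightarrow> 'k set \<Rightarrow> ('k \<Rightarrow> real \<Rightarrow> real) measure" where
  "qc_reference \<beta> \<Lambda> =
     distr (chi_measure \<beta> \<Lambda>) (\<Pi>\<^sub>M j\<in>\<Lambda>. borel_of (loop_top \<beta>)) (\<lambda>x. \<lambda>j\<in>\<Lambda>. \<lambda>\<tau>\<in>{0..\<beta>}. x j)"

definition per_energy ::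
    "(real \<Rightarrow> real) \<Rightarrow> (real \<Rightarrow> real) \<Rightarrow> real \<Rightarrow> int ^ 'd \<Rightarrow> int ^ 'd \<Rightarrow>
     (int ^ 'd \<Rightarrow> real \<Rightarrow> real) \<Rightarrow> real" where
  "per_energy U J \<beta> k0 k1 \<omega> =
     (\<Sum>j\<in>box_of k0 k1. LINT \<tau>:{0..\<beta>}|lborel. U (\<omega> j \<tau>)) +
     1 / 2 * (\<Sum>j\<in>box_of k0 k1. \<Sum>k\<in>box_of k0 k1.
       J (per_dist k0 k1 j k) * (LINT \<tau>:{0..\<beta>}|lborel. \<omega> j \<tau> * \<omega> k \<tau>))"

definition gibbs :: "('a \<Rightarrow> real) \<Rightarrow> 'a measure \<Rightarrow> 'a measure" where
  "gibbs E M =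
     density M (\<lambda>\<omega>. ennreal (exp (- E \<omega>)) / (\<integral>\<^sup>+\<omega>'. ennreal (exp (- E \<omega>')) \<partial>M))"

definition nu_per ::
    "(real \<Rightarrow> real) \<Rightarrow> (real \<Rightarrow> real) \<Rightarrow> real \<Rightarrow> int ^ 'd \<Rightarrow> int ^ 'd \<Rightarrow>
     (real \<Rightarrow> real) measure \<Rightarrow> (int ^ 'd \<Rightarrow> real \<Rightarrow> real) measure" where
  "nu_per U J \<beta> k0 k1 \<gamma> = gibbs (per_energy U J \<beta> k0 k1) (\<Pi>\<^sub>M j\<in>box_of k0 k1. \<gamma>)"

definition nu_qcp ::
    "(real \<Rightarrow> real) \<Rightarrow> (real \<Rightarrow> real) \<Rightarrow> real \<Rightarrow> int ^ 'd \<Rightarrow> int ^ 'd \<Rightarrow>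
     (int ^ 'd \<Rightarrow> real \<Rightarrow> real) measure" where
  "nu_qcp U J \<beta> k0 k1 = gibbs (per_energy U J \<beta> k0 k1) (qc_reference \<beta> (box_of k0 k1))"

end

theory Submission
  imports Defs
begin

text \<open>For every mass the average of a loop over \<open>[0,\<beta>]\<close> has the same law, the normal law of
  variance \<open>1/\<beta>\<close>, because the constant function is an eigenvector of the covariance with eigenvalue 1.
  Replacing each loop by its average therefore maps the Gaussian reference measure of any mass exactly
  to the quasi-classical one, and it remains to show that the replacement costs nothing in the limit.
  The increment of a loop between times \<open>s\<close> and \<open>t\<close> is Gaussian with variance at most of order
  \<open>sqrt \<bar>t - s\<bar> / m\<close>, so dyadic chaining gives that the loops are uniformly close to their averages with
  probability tending to 1. Since \<open>c - c' < 1\<close>, the weight \<open>exp (- E)\<close> is dominated by an exponential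
  quadratic moment that the average, of variance exactly \<open>1/\<beta>\<close>, can afford with some room to spare
  (the fluctuation, of small variance, is harmless): this yields uniform integrability.\<close>

section \<open>Loop spaces\<close>

text \<open>Point evaluation is not a functional on \<open>L2\<close>, so the law of an increment
  cannot be read off the characteristic functional. It is reached through pairings with differences
  of short averages: their exponential moments are bounded uniformly in the averaging length, and
  Fatou's lemma passes the bound to the increment. The square root in the variance bound is a
  deliberate loss. The full Lipschitz estimate for the basis functions would cancel the decay of the
  eigenvalues and leave a divergent series; the power 1/2 leaves a convergent one, and a fourth
  power in the tail estimate makes up for it in the chaining. A continuous function on the loop
  space need not be uniformly continuous on bounded sets. A uniform modulus exists near the constant
  configurations with values in \<open>[-R, R]\<close>, which form a compact set; hence the averages
  must be kept bounded besides the fluctuations being small. The parameters are therefore chosen in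
  this order: truncation level \<open>\<mu>\<close> of the weight, bound \<open>R\<close>, modulus
  \<open>d\<close>, and last the mass.\<close>

lemma abs_set_integral_le:
  fixes f :: "real \<Rightarrow> real"
  assumes "a \<le> b" "set_integrable lborel {a..b} f" "\<And>x. x \<in> {a..b} \<Longrightarrow> \<bar>f x\<bar> \<le> B"
  shows "\<bar>LINT x:{a..b}|lborel. f x\<bar> \<le> B * (b - a)"
proof -
  have c: "set_integrable lborel {a..b} (\<lambda>_. B)"
    by (intro borel_integrable_atLeastAtMost') auto
  have "\<bar>LINT x:{a..b}|lborel. f x\<bar> \<le> (LINT x:{a..b}|lborel. B)"
    unfolding set_lebesgue_integral_def
  proof (intro Bochner_Integration.integral_abs_bound_integral)
    show "\<bar>indicat_real {a..b} x *\<^sub>R f x\<bar> \<le> indicat_real {a..b} x *\<^sub>R B" for x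
      using assms(3)[of x] by (auto simp: indicator_def)
  qed (use assms(2) c in \<open>simp_all only: set_integrable_def\<close>)
  also have "\<dots> = B * (b - a)" using assms(1) by (simp add: set_lebesgue_integral_def)
  finally show ?thesis .
qed

abbreviation loops :: "real \<Rightarrow> (real \<Rightarrow> real) set" where
  "loops \<beta> \<equiv> topspace (loop_top \<beta>)"

abbreviation loop_dist :: "real \<Rightarrow> (real \<Rightarrow> real) \<Rightarrow> (real \<Rightarrow> real) \<Rightarrow> real" where
  "loop_dist \<beta> \<equiv> mdist (loop_metric \<beta>)"

text \<open>Boundedness, which \<open>cfunspace\<close> demands of its elements, is automatic on a
  compact interval and drops out.\<close>

lemma topspace_loop_top:
  "loops \<beta> =
     {\<omega>. continuous_on {0..\<beta>} \<omega> \<and> \<omega> \<in> extensional {0..\<beta>} \<and> \<omega> 0 = \<omega> \<beta>}"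
proof -
  have "bounded (f ` {0..\<beta>})" if "continuous_on {0..\<beta>} f" for f :: "real \<Rightarrow> real"
    using that compact_continuous_image compact_imp_bounded by blast
  then show ?thesis
    by (auto simp: loop_top_def loop_metric_def Met_TC.mbounded_def  extensional_def
      bounded_def dist_commute subset_iff continuous_map_iff_continuous2)
qed

lemma mspace_loop_metric: "mspace (loop_metric \<beta>) = loops \<beta>"
  by (simp add: loop_top_def)

text \<open>With \<open>\<beta> \<ge> 0\<close> the interval is nonempty, so the supremum in the
  metric is a genuine one. Pointwise estimates turn into estimates of \<open>loop_dist\<close>
  through this equivalence.\<close>

lemma loop_dist_le_iff:
  assumes "\<beta> \<ge> 0" "f \<in> loops \<beta>" "g \<in> loops \<beta>"
  shows "loop_dist \<beta> f g \<le> a \<longleftrightarrow> (\<forall>x\<in>{0..\<beta>}. \<bar>f x - g x\<bar> \<le> a)"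
proof -
  have "f \<in> mspace (funspace {0..\<beta>} euclidean_metric)" "g \<in> mspace (funspace {0..\<beta>} euclidean_metric)"
    using assms(2,3) unfolding mspace_loop_metric[symmetric] loop_metric_def
    by (auto simp: cfunspace_def)
  then have "mdist (funspace {0..\<beta>} euclidean_metric) f g \<le> a \<longleftrightarrow> (\<forall>x\<in>{0..\<beta>}. mdist euclidean_metric (f x) (g x) \<le> a)"
    using assms(1) by (intro funspace_mdist_le) auto
  then show ?thesis
    by (simp add: loop_metric_def mdist_cfunspace_eq_mdist_funspace dist_real_def)
qed

lemma loop_dist_bound:
  assumes "f \<in> loops \<beta>" "g \<in> loops \<beta>" "x \<in> {0..\<beta>}"
  shows "\<bar>f x - g x\<bar> \<le> loop_dist \<beta> f g"
proof -
  have "\<beta> \<ge> 0" using assms(3) by auto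
  then show ?thesis using loop_dist_le_iff[of \<beta> f g "loop_dist \<beta> f g"] assms by blast
qed

lemma openin_loop_top_iff:
  "openin (loop_top \<beta>) W \<longleftrightarrow> W \<subseteq> loops \<beta> \<and>
     (\<forall>f\<in>W. \<exists>e>0. \<forall>g\<in>loops \<beta>. loop_dist \<beta> f g < e \<longrightarrow> g \<in> W)"
proof -
  interpret Metric_space "mspace (loop_metric \<beta>)" "loop_dist \<beta>"
    by (rule Metric_space_mspace_mdist)
  have "openin (loop_top \<beta>) W = openin mtopology W"
    by (simp add: loop_top_def mtopology_of_def)
  moreover have "mball f r \<subseteq> W \<longleftrightarrow> (\<forall>g\<in>mspace (loop_metric \<beta>). loop_dist \<beta> f g < r \<longrightarrow> g \<in> W)"
    if "W \<subseteq> mspace (loop_metric \<beta>)" "f \<in> W" for f r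
    using that by (auto simp: mball_def)
  ultimately show ?thesis
    unfolding openin_mtopology mspace_loop_metric[symmetric] by (metis (no_types, lifting))
qed

lemma openin_loop_ball:
  assumes "f \<in> loops \<beta>"
  shows "openin (loop_top \<beta>) {g \<in> loops \<beta>. loop_dist \<beta> f g < e}"
proof -
  interpret Metric_space "mspace (loop_metric \<beta>)" "loop_dist \<beta>"
    by (rule Metric_space_mspace_mdist)
  have "openin (mtopology_of (loop_metric \<beta>)) (mball f e)"
    by (simp add: mtopology_of_def)
  moreover have "mball f e = {g \<in> loops \<beta>. loop_dist \<beta> f g < e}"
    using assms unfolding mspace_loop_metric[symmetric] by (auto simp: mball_def)
  ultimately show ?thesis by (simp add: loop_top_def)
qed

lemma const_loop_in_loop_top: "\<beta> \<ge> 0 \<Longrightarrow> restrict (\<lambda>_. x) {0..\<beta>} \<in> loops \<beta>"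
proof -
  have "continuous_on {0..\<beta>} (restrict (\<lambda>_. x) {0..\<beta>}) \<longleftrightarrow> continuous_on {0..\<beta>} (\<lambda>_. x)"
    by (rule continuous_on_cong) auto
  then show "\<beta> \<ge> 0 \<Longrightarrow> ?thesis" by (auto simp: topspace_loop_top)
qed

lemma continuous_map_const_loop:
  assumes "\<beta> \<ge> 0"
  shows "continuous_map euclideanreal (loop_top \<beta>) (\<lambda>x. restrict (\<lambda>_. x) {0..\<beta>})"
proof -
  have "loop_dist \<beta> (restrict (\<lambda>_. x) {0..\<beta>}) (restrict (\<lambda>_. y) {0..\<beta>}) \<le> 1 * dist x y" for x y
    using const_loop_in_loop_top[OF assms] assms by (subst loop_dist_le_iff) (auto simp: dist_real_def)
  then have "Lipschitz_continuous_map euclidean_metric (loop_metric \<beta>) (\<lambda>x. restrict (\<lambda>_. x) {0..\<beta>})"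
    using const_loop_in_loop_top[OF assms]
    unfolding Lipschitz_continuous_map_def mspace_loop_metric by (auto intro!: exI[of _ 1])
  from Lipschitz_continuous_imp_continuous_map[OF this] show ?thesis by (simp add: loop_top_def)
qed

lemma loop_dist_commute: "loop_dist \<beta> f g = loop_dist \<beta> g f"
  using Metric_space.commute[OF Metric_space_mspace_mdist] .

lemma loop_dist_self: "f \<in> loops \<beta> \<Longrightarrow> loop_dist \<beta> f f = 0"
  using Metric_space.mdist_zero[OF Metric_space_mspace_mdist, of f "loop_metric \<beta>"]
  by (simp add: mspace_loop_metric)

lemma loop_dist_triangle:
  assumes "f \<in> loops \<beta>" "g \<in> loops \<beta>" "h \<in> loops \<beta>"
  shows "loop_dist \<beta> f h \<le> loop_dist \<beta> f g + loop_dist \<beta> g h"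
  using Metric_space.triangle[OF Metric_space_mspace_mdist, of f "loop_metric \<beta>" g h] assms
  by (simp add: mspace_loop_metric)

lemma continuous_map_loop_eval:
  assumes "t \<in> {0..\<beta>}"
  shows "continuous_map (loop_top \<beta>) euclideanreal (\<lambda>\<omega>. \<omega> t)"
proof -
  have "Lipschitz_continuous_map (loop_metric \<beta>) euclidean_metric (\<lambda>\<omega>. \<omega> t)"
    using loop_dist_bound[OF _ _ assms]
    unfolding Lipschitz_continuous_map_def mspace_loop_metric by (auto simp: dist_real_def intro!: exI[of _ 1])
  from Lipschitz_continuous_imp_continuous_map[OF this] show ?thesis by (simp add: loop_top_def)
qed

lemma loop_pair_ball:
  assumes "f1 \<in> loops \<beta>" "f2 \<in> loops \<beta>"
  shows "openin (prod_topology (loop_top \<beta>) (loop_top \<beta>))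
    ({g \<in> loops \<beta>. loop_dist \<beta> f1 g < e} \<times>
     {g \<in> loops \<beta>. loop_dist \<beta> f2 g < e})"
  using assms by (auto simp: openin_prod_Times_iff openin_loop_ball)

lemma loop_bounded:
  assumes "f \<in> loops \<beta>"
  obtains R where "R > 0" "\<And>t. t \<in> {0..\<beta>} \<Longrightarrow> \<bar>f t\<bar> \<le> R"
proof -
  have "bounded (f ` {0..\<beta>})"
    using assms compact_continuous_image[of "{0..\<beta>}" f] compact_imp_bounded
    by (auto simp: topspace_loop_top)
  then obtain R where "R > 0" "\<forall>x\<in>f ` {0..\<beta>}. norm x \<le> R" unfolding bounded_pos by blast
  then show ?thesis using that by auto
qed

lemma set_integrable_loop:
  fixes \<Phi> :: "real \<Rightarrow> real \<Rightarrow> real"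
  assumes "continuous_on UNIV (\<lambda>(x, y). \<Phi> x y)"
    and "f1 \<in> loops \<beta>" "f2 \<in> loops \<beta>"
  shows "set_integrable lborel {0..\<beta>} (\<lambda>\<tau>. \<Phi> (f1 \<tau>) (f2 \<tau>))"
proof -
  have "continuous_on {0..\<beta>} (\<lambda>\<tau>. (f1 \<tau>, f2 \<tau>))"
    using assms by (auto simp: topspace_loop_top intro!: continuous_intros)
  from continuous_on_compose2[OF assms(1) this]
  have "continuous_on {0..\<beta>} (\<lambda>\<tau>. \<Phi> (f1 \<tau>) (f2 \<tau>))" by simp
  then show ?thesis by (rule borel_integrable_atLeastAtMost')
qed

text \<open>A loop is bounded, so the values of all nearby pairs stay in one compact rectangle,
  where \<open>\<Phi>\<close> is uniformly continuous. Two loops are allowed so that the potential,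
  the square and the interaction \<open>x * y\<close> are instances of the same statement.\<close>

lemma continuous_map_loop_integral:
  fixes \<Phi> :: "real \<Rightarrow> real \<Rightarrow> real"
  assumes \<Phi>: "continuous_on UNIV (\<lambda>(x, y). \<Phi> x y)" and "\<beta> > 0"
  shows "continuous_map (prod_topology (loop_top \<beta>) (loop_top \<beta>)) euclideanreal
    (\<lambda>(\<omega>, \<eta>). LINT \<tau>:{0..\<beta>}|lborel. \<Phi> (\<omega> \<tau>) (\<eta> \<tau>))"
proof -
  let ?X = "loops \<beta>" and ?d = "loop_dist \<beta>"
  let ?F = "\<lambda>(\<omega>, \<eta>). LINT \<tau>:{0..\<beta>}|lborel. \<Phi> (\<omega> \<tau>) (\<eta> \<tau>)"
  have local: "\<exists>d>0. \<forall>g1\<in>?X. \<forall>g2\<in>?X. ?d f1 g1 < d \<longrightarrow> ?d f2 g2 < d \<longrightarrow> \<bar>?F (g1, g2) - ?F (f1, f2)\<bar> < e"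
    if f: "f1 \<in> ?X" "f2 \<in> ?X" and "e > 0" for f1 f2 e
  proof -
    obtain R1 where R1: "R1 > 0" "\<And>t. t \<in> {0..\<beta>} \<Longrightarrow> \<bar>f1 t\<bar> \<le> R1" using loop_bounded[OF f(1)] by blast
    obtain R2 where R2: "R2 > 0" "\<And>t. t \<in> {0..\<beta>} \<Longrightarrow> \<bar>f2 t\<bar> \<le> R2" using loop_bounded[OF f(2)] by blast
    \<comment> \<open>The margin 1 leaves room for loops at distance less than 1, which is why the
      radius below is \<open>min 1 (d / 2)\<close>.\<close>
    let ?K = "{- R1 - 1..R1 + 1} \<times> {- R2 - 1..R2 + 1}"
    have "uniformly_continuous_on ?K (\<lambda>(x, y). \<Phi> x y)"
      by (intro compact_uniformly_continuous continuous_on_subset[OF \<Phi>] compact_Times) auto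
    moreover have "e / (2 * \<beta>) > 0" using assms \<open>e > 0\<close> by simp
    ultimately obtain d where d: "d > 0" "\<And>p q. p \<in> ?K \<Longrightarrow> q \<in> ?K \<Longrightarrow> dist q p < d \<Longrightarrow>
        dist (case q of (x, y) \<Rightarrow> \<Phi> x y) (case p of (x, y) \<Rightarrow> \<Phi> x y) < e / (2 * \<beta>)"
      unfolding uniformly_continuous_on_def by metis
    have "\<bar>?F (g1, g2) - ?F (f1, f2)\<bar> < e"
      if g: "g1 \<in> ?X" "g2 \<in> ?X" and gd: "?d f1 g1 < min 1 (d / 2)" "?d f2 g2 < min 1 (d / 2)" for g1 g2
    proof -
      have pt: "\<bar>\<Phi> (g1 \<tau>) (g2 \<tau>) - \<Phi> (f1 \<tau>) (f2 \<tau>)\<bar> \<le> e / (2 * \<beta>)" if "\<tau> \<in> {0..\<beta>}" for \<tau>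
      proof -
        have b: "\<bar>f1 \<tau> - g1 \<tau>\<bar> < min 1 (d / 2)" "\<bar>f2 \<tau> - g2 \<tau>\<bar> < min 1 (d / 2)"
          using loop_dist_bound[OF f(1) g(1) that] loop_dist_bound[OF f(2) g(2) that] gd by linarith+
        have "dist (g1 \<tau>, g2 \<tau>) (f1 \<tau>, f2 \<tau>) \<le> \<bar>g1 \<tau> - f1 \<tau>\<bar> + \<bar>g2 \<tau> - f2 \<tau>\<bar>"
          unfolding dist_prod_def dist_real_def fst_conv snd_conv by (metis real_sqrt_sum_squares_triangle_ineq power2_abs sqrt_sum_squares_le_sum abs_ge_zero)
        also have "\<dots> < d" using b by linarith
        finally show ?thesis
          using d(2)[of "(f1 \<tau>, f2 \<tau>)" "(g1 \<tau>, g2 \<tau>)"] b R1(2)[OF that] R2(2)[OF that]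
          by (auto simp: dist_real_def abs_less_iff abs_le_iff)
      qed
      have "\<bar>?F (g1, g2) - ?F (f1, f2)\<bar> = \<bar>LINT \<tau>:{0..\<beta>}|lborel. \<Phi> (g1 \<tau>) (g2 \<tau>) - \<Phi> (f1 \<tau>) (f2 \<tau>)\<bar>"
        using set_integrable_loop[OF \<Phi> g] set_integrable_loop[OF \<Phi> f] by simp
      also have "\<dots> \<le> e / (2 * \<beta>) * (\<beta> - 0)"
        using set_integrable_loop[OF \<Phi> g] set_integrable_loop[OF \<Phi> f] pt assms(2)
        by (intro abs_set_integral_le) auto
      also have "\<dots> = e / 2" using assms(2) by simp
      finally show ?thesis using \<open>e > 0\<close> by simp
    qed
    then show ?thesis using \<open>d > 0\<close> by (intro exI[of _ "min 1 (d / 2)"]) auto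
  qed
  show ?thesis
    unfolding continuous_map_def
  proof (intro conjI allI impI)
    fix V :: "real set" assume "openin euclidean V"
    then have V: "open V" by simp
    let ?S = "{p \<in> topspace (prod_topology (loop_top \<beta>) (loop_top \<beta>)). ?F p \<in> V}"
    show "openin (prod_topology (loop_top \<beta>) (loop_top \<beta>)) ?S"
    proof (subst openin_subopen, intro ballI)
      fix p assume "p \<in> ?S"
      then obtain f1 f2 where p: "p = (f1, f2)" "f1 \<in> ?X" "f2 \<in> ?X" "?F (f1, f2) \<in> V" by auto
      obtain e where e: "e > 0" "\<And>y. \<bar>y - ?F (f1, f2)\<bar> < e \<Longrightarrow> y \<in> V"
        using V p(4) unfolding open_dist dist_real_def by blast
      obtain d where d: "d > 0" "\<forall>g1\<in>?X. \<forall>g2\<in>?X. ?d f1 g1 < d \<longrightarrow> ?d f2 g2 < d \<longrightarrow> \<bar>?F (g1, g2) - ?F (f1, f2)\<bar> < e"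
        using local[OF p(2,3) e(1)] by blast
      let ?T = "{g \<in> ?X. ?d f1 g < d} \<times> {g \<in> ?X. ?d f2 g < d}"
      have "p \<in> ?T" using p d by (simp add: loop_dist_self)
      moreover have "?T \<subseteq> ?S" using d(2) e(2) by auto
      ultimately show "\<exists>T. openin (prod_topology (loop_top \<beta>) (loop_top \<beta>)) T \<and> p \<in> T \<and> T \<subseteq> ?S"
        using loop_pair_ball[OF p(2,3)] by blast
    qed
  qed auto
qed

text \<open>Separability by coding. A code consists of a mesh \<open>1 / Suc n\<close>, a tolerance
  \<open>1 / Suc N\<close> and a list of rational values near the grid points. There are countably
  many codes, and two loops sharing a code fine enough are uniformly within
  \<open>2 / Suc N\<close>; hence one chosen loop per realizable code gives a dense set. Second
  countability is what identifies the Borel sets of the product topology with the product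
  sigma-algebra.\<close>

lemma second_countable_loop_top: "second_countable (loop_top \<beta>)"
proof -
  let ?X = "loops \<beta>" and ?d = "loop_dist \<beta>"
  define close where "close = (\<lambda>(n::nat, N::nat, l :: rat list) (f :: real \<Rightarrow> real).
    f \<in> ?X \<and> (\<forall>k<length l. \<forall>\<tau>\<in>{0..\<beta>}. \<bar>\<tau> - real k / Suc n\<bar> \<le> 1 / Suc n \<longrightarrow> \<bar>f \<tau> - of_rat (l ! k)\<bar> < 1 / Suc N))"
  define D where "D = (\<lambda>c. SOME f. close c f) ` {c. \<exists>f. close c f}"
  have "countable D" unfolding D_def by blast
  have "D \<subseteq> ?X"
  proof
    fix g assume "g \<in> D"
    then have "\<exists>c. close c g" unfolding D_def by (metis (mono_tags, lifting) imageE mem_Collect_eq someI_ex)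
    then obtain c where "close c g" by blast
    then show "g \<in> ?X" by (auto simp: close_def split: prod.splits)
  qed
  have dense: "\<exists>g\<in>D. ?d g f < e" if f: "f \<in> ?X" and "e > 0" for f e
  proof (cases "\<beta> \<ge> 0")
    case True
    obtain N where N: "1 / Suc N < e / 4" using \<open>e > 0\<close> nat_approx_posE[of "e / 4"] by auto
    have "uniformly_continuous_on {0..\<beta>} f"
      using f by (intro compact_uniformly_continuous) (auto simp: topspace_loop_top)
    moreover have N0: "1 / (2 * real (Suc N)) > 0" by simp
    ultimately obtain d where d: "d > 0" "\<And>s t. s \<in> {0..\<beta>} \<Longrightarrow> t \<in> {0..\<beta>} \<Longrightarrow> \<bar>t - s\<bar> < d \<Longrightarrow> \<bar>f t - f s\<bar> < 1 / (2 * real (Suc N))"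
      unfolding uniformly_continuous_on_def dist_real_def
      by meson
    obtain n where n: "1 / Suc n < d" using \<open>d > 0\<close> nat_approx_posE by auto
    define r where "r k = min \<beta> (real k / Suc n)" for k
    have r: "r k \<in> {0..\<beta>}" for k using True by (auto simp: r_def)
    have "\<exists>q. \<bar>f (r k) - of_rat q\<bar> < 1 / (2 * real (Suc N))" for k
    proof -
      obtain q where "of_rat q \<in> {f (r k) - 1 / (2 * real (Suc N))<..<f (r k) + 1 / (2 * real (Suc N))}"
        using of_rat_dense[of "f (r k) - 1 / (2 * real (Suc N))" "f (r k) + 1 / (2 * real (Suc N))"] by fastforce
      then show ?thesis by (intro exI[of _ q]) (auto simp: abs_less_iff)
    qed
    then obtain q where q: "\<And>k. \<bar>f (r k) - of_rat (q k)\<bar> < 1 / (2 * real (Suc N))" by metis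
    \<comment> \<open>The largest index \<open>nat \<lfloor>\<tau> * Suc n\<rfloor>\<close> that
      occurs for \<open>\<tau> \<le> \<beta>\<close> must be a valid position of the list, hence the
      \<open>Suc\<close>.\<close>
    define L where "L = Suc (nat \<lfloor>\<beta> * Suc n\<rfloor>)"
    let ?c = "(n, N, map q [0..<L])"
    have "close ?c f"
      unfolding close_def split_conv
    proof (intro conjI f allI impI ballI)
      fix k \<tau> assume k: "k < length (map q [0..<L])" and \<tau>: "\<tau> \<in> {0..\<beta>}" and *: "\<bar>\<tau> - real k / Suc n\<bar> \<le> 1 / Suc n"
      have "\<bar>\<tau> - r k\<bar> \<le> \<bar>\<tau> - real k / Suc n\<bar>" using \<tau> by (auto simp: r_def)
      then have "\<bar>\<tau> - r k\<bar> < d" using * n by linarith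
      then have "\<bar>f \<tau> - f (r k)\<bar> < 1 / (2 * real (Suc N))" using d(2) \<tau> r by blast
      then have "\<bar>f \<tau> - of_rat (q k)\<bar> < 1 / (2 * real (Suc N)) + 1 / (2 * real (Suc N))" using q[of k] by linarith
      also have "\<dots> = 1 / Suc N" by (simp add: field_simps)
      finally show "\<bar>f \<tau> - of_rat (map q [0..<L] ! k)\<bar> < 1 / Suc N" using k by simp
    qed
    define g where "g = (SOME f. close ?c f)"
    have g: "close ?c g" unfolding g_def by (rule someI[of _ f]) fact
    have "g \<in> D" unfolding D_def g_def using \<open>close ?c f\<close> by blast
    have "g \<in> ?X" using g by (simp add: close_def)
    have "\<bar>g \<tau> - f \<tau>\<bar> \<le> e / 2" if \<tau>: "\<tau> \<in> {0..\<beta>}" for \<tau>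
    proof -
      define k where "k = nat \<lfloor>\<tau> * Suc n\<rfloor>"
      have "real k \<le> \<tau> * Suc n" "\<tau> * Suc n < real k + 1" using \<tau> by (auto simp: k_def)
      then have "real k / Suc n \<le> \<tau>" "\<tau> \<le> (real k + 1) / Suc n"
        by (simp_all add: divide_le_eq le_divide_eq)
      then have *: "\<bar>\<tau> - real k / Suc n\<bar> \<le> 1 / Suc n" by (simp add: add_divide_distrib)
      have "\<lfloor>\<tau> * Suc n\<rfloor> \<le> \<lfloor>\<beta> * Suc n\<rfloor>" using \<tau> by (intro floor_mono mult_right_mono) auto
      then have kL: "k < length (map q [0..<L])" by (simp add: k_def L_def)
      have "\<bar>f \<tau> - of_rat (map q [0..<L] ! k)\<bar> < 1 / Suc N" "\<bar>g \<tau> - of_rat (map q [0..<L] ! k)\<bar> < 1 / Suc N"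
        using \<open>close ?c f\<close> g * kL \<tau> unfolding close_def split_conv by blast+
      then show ?thesis using N by linarith
    qed
    then have "?d g f \<le> e / 2" using loop_dist_le_iff[OF True \<open>g \<in> ?X\<close> f] by blast
    then show ?thesis using \<open>g \<in> D\<close> \<open>e > 0\<close> by (intro bexI[of _ g]) auto
  next
    \<comment> \<open>The interval is empty here, and extensionality leaves a single loop.\<close>
    case False
    then have "close (0, 0, []) f" using f by (auto simp: close_def)
    then have "(SOME f. close (0, 0, []) f) \<in> D" unfolding D_def by blast
    moreover have "h = f" if "h \<in> ?X" for h
      using False that f by (auto simp: topspace_loop_top)
    ultimately have "f \<in> D" using \<open>D \<subseteq> ?X\<close> by (metis subsetD)
    then show ?thesis using f \<open>e > 0\<close> by (intro bexI[of _ f]) (simp_all add: loop_dist_self)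
  qed
  define B where "B = (\<lambda>(g, n). {f \<in> ?X. ?d g f < 1 / real (Suc n)}) ` (D \<times> UNIV)"
  have "countable B" unfolding B_def using \<open>countable D\<close> by blast
  moreover have B_open: "openin (loop_top \<beta>) V" if "V \<in> B" for V
    using that \<open>D \<subseteq> ?X\<close> openin_loop_ball unfolding B_def by fastforce
  moreover have B_base: "\<exists>V\<in>B. f \<in> V \<and> V \<subseteq> W" if W: "openin (loop_top \<beta>) W" "f \<in> W" for W f
  proof -
    obtain e where e: "e > 0" "\<And>g. g \<in> ?X \<Longrightarrow> ?d f g < e \<Longrightarrow> g \<in> W"
      using W unfolding openin_loop_top_iff by blast
    have f: "f \<in> ?X" using W openin_subset by blast
    obtain n where n: "1 / Suc n < e / 2" using e(1) nat_approx_posE[of "e / 2"] by auto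
    obtain g where g: "g \<in> D" "?d g f < 1 / Suc n" using dense[OF f, of "1 / Suc n"] by auto
    have gX: "g \<in> ?X" using g \<open>D \<subseteq> ?X\<close> by blast
    let ?V = "{f \<in> ?X. ?d g f < 1 / real (Suc n)}"
    have "?V \<in> B" unfolding B_def using g(1) by force
    moreover have "?V \<subseteq> W"
    proof
      fix h assume h: "h \<in> ?V"
      then have "?d f h \<le> ?d f g + ?d g h" using f gX by (intro loop_dist_triangle) auto
      also have "\<dots> < e" using h g(2) n loop_dist_commute[of \<beta> f g] by simp
      finally show "h \<in> W" using e(2) h by blast
    qed
    moreover have "f \<in> ?V" using f g(2) by simp
    ultimately show ?thesis by (intro bexI[of _ ?V] conjI)
  qed
  ultimately show ?thesis
    unfolding second_countable_def
    by (intro exI[of _ B] conjI ballI allI impI) (assumption, erule B_open, elim conjE, rule B_base)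
qed

section \<open>Borel sets of a topology and of finite products\<close>

lemma space_borel_of [simp]: "space (borel_of X) = topspace X"
  by (simp add: borel_of_def space_measure_of_conv)

lemma sets_borel_of: "sets (borel_of X) = sigma_sets (topspace X) {A. openin X A}"
  unfolding borel_of_def by (rule sets_measure_of) (auto dest: openin_subset)

lemma openin_imp_borel_of: "openin X A \<Longrightarrow> A \<in> sets (borel_of X)"
  by (simp add: sets_borel_of)

lemma continuous_map_imp_measurable_borel_of:
  assumes "continuous_map X Y f"
  shows "f \<in> measurable (borel_of X) (borel_of Y)"
proof -
  have "f \<in> measurable (borel_of X) (sigma (topspace Y) {A. openin Y A})"
  proof (rule measurable_measure_of)
    show "{A. openin Y A} \<subseteq> Pow (topspace Y)" by (auto dest: openin_subset)
    show "f \<in> space (borel_of X) \<rightarrow> topspace Y" using assms by (auto simp: continuous_map_def)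
    fix A assume "A \<in> {A. openin Y A}"
    then have "openin X {x \<in> topspace X. f x \<in> A}" using assms by (auto simp: continuous_map_def)
    moreover have "f -` A \<inter> space (borel_of X) = {x \<in> topspace X. f x \<in> A}" by auto
    ultimately show "f -` A \<inter> space (borel_of X) \<in> sets (borel_of X)"
      by (simp add: openin_imp_borel_of)
  qed
  then show ?thesis by (simp add: borel_of_def)
qed

lemma borel_of_euclidean: "borel_of euclidean = (borel :: 'a::topological_space measure)"
  by (simp add: borel_of_def borel_def)

lemma continuous_map_imp_borel_measurable:
  fixes f :: "'a \<Rightarrow> 'b::topological_space"
  assumes "continuous_map X euclidean f"
  shows "f \<in> borel_measurable (borel_of X)"
  using continuous_map_imp_measurable_borel_of[OF assms] by (simp add: borel_of_euclidean)

text \<open>An open set of the product is the union of the boxes with basis sides that it contains.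
  Finiteness of \<open>I\<close> and countability of the basis make this union countable and each
  box measurable. The converse inclusion is continuity of the projections.\<close>

lemma sets_borel_of_product_topology:
  assumes "finite I" "second_countable X"
  shows "sets (borel_of (product_topology (\<lambda>_. X) I)) = sets (\<Pi>\<^sub>M i\<in>I. borel_of X)"
proof
  let ?P = "product_topology (\<lambda>_. X) I"
  obtain B where B: "countable B" "\<And>V. V \<in> B \<Longrightarrow> openin X V"
    "\<And>U x. openin X U \<Longrightarrow> x \<in> U \<Longrightarrow> \<exists>V\<in>B. x \<in> V \<and> V \<subseteq> U"
    using assms(2) unfolding second_countable_def by auto
  have "U \<in> sets (\<Pi>\<^sub>M i\<in>I. borel_of X)" if U: "openin ?P U" for U
  proof -
    let ?F = "{V \<in> I \<rightarrow>\<^sub>E B. Pi\<^sub>E I V \<subseteq> U}"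
    have "\<exists>V\<in>?F. x \<in> Pi\<^sub>E I V" if x: "x \<in> U" for x
    proof -
      obtain W where W: "\<And>i. i \<in> I \<Longrightarrow> openin X (W i)" "x \<in> Pi\<^sub>E I W" "Pi\<^sub>E I W \<subseteq> U"
        using U x unfolding openin_product_topology_alt by metis
      have "\<exists>V\<in>B. x i \<in> V \<and> V \<subseteq> W i" if "i \<in> I" for i
        using B(3)[OF W(1)[OF that]] W(2) that by blast
      then obtain V where V: "\<And>i. i \<in> I \<Longrightarrow> V i \<in> B \<and> x i \<in> V i \<and> V i \<subseteq> W i" by metis
      let ?V = "restrict V I"
      have "Pi\<^sub>E I ?V \<subseteq> Pi\<^sub>E I W" using V by (intro PiE_mono) auto
      then have "?V \<in> ?F" using V W(3) by auto
      moreover have "x \<in> Pi\<^sub>E I ?V" using V W(2) by (auto simp: PiE_iff)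
      ultimately show ?thesis by blast
    qed
    then have "U \<subseteq> (\<Union>V\<in>?F. Pi\<^sub>E I V)" unfolding UN_iff subset_iff by blast
    moreover have "(\<Union>V\<in>?F. Pi\<^sub>E I V) \<subseteq> U" by (rule UN_least) simp
    ultimately have "U = (\<Union>V\<in>?F. Pi\<^sub>E I V)" by (rule equalityI)
    moreover have "countable ?F"
      by (rule countable_subset[of _ "I \<rightarrow>\<^sub>E B"], blast, intro countable_PiE assms(1) B(1))
    moreover have "Pi\<^sub>E I V \<in> sets (\<Pi>\<^sub>M i\<in>I. borel_of X)" if "V \<in> ?F" for V
      using that B(2) by (intro sets_PiM_I_finite assms openin_imp_borel_of) auto
    ultimately show ?thesis using sets.countable_UN''[of ?F "Pi\<^sub>E I" "\<Pi>\<^sub>M i\<in>I. borel_of X"] by simp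
  qed
  then have "sigma_sets (space (\<Pi>\<^sub>M i\<in>I. borel_of X)) {A. openin ?P A} \<subseteq> sets (\<Pi>\<^sub>M i\<in>I. borel_of X)"
    by (metis (no_types, lifting) mem_Collect_eq sets.sigma_sets_subset subsetI)
  moreover have "topspace ?P = space (\<Pi>\<^sub>M i\<in>I. borel_of X)"
    by (simp only: space_PiM topspace_product_topology space_borel_of)
  ultimately show "sets (borel_of ?P) \<subseteq> sets (\<Pi>\<^sub>M i\<in>I. borel_of X)"
    by (simp only: sets_borel_of)
  show "sets (\<Pi>\<^sub>M i\<in>I. borel_of X) \<subseteq> sets (borel_of ?P)"
  proof (rule sets_PiM_in_sets)
    fix i A assume "i \<in> I" and A: "A \<in> sets (borel_of X)"
    have "(\<lambda>x. x i) \<in> measurable (borel_of ?P) (borel_of X)"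
      using \<open>i \<in> I\<close> by (intro continuous_map_imp_measurable_borel_of continuous_map_product_projection)
    from measurable_sets[OF this A]
    show "{x \<in> space (borel_of ?P). x i \<in> A} \<in> sets (borel_of ?P)"
      by (simp add: vimage_def Int_def conj_commute)
  qed simp
qed

section \<open>The Hilbert space and its Gaussian measures\<close>

lemma set_borel_measurable_add:
  fixes f g :: "real \<Rightarrow> real"
  assumes "set_borel_measurable M A f" "set_borel_measurable M A g"
  shows "set_borel_measurable M A (\<lambda>x. f x + g x)"
proof -
  have "(\<lambda>x. indicat_real A x *\<^sub>R f x + indicat_real A x *\<^sub>R g x) \<in> borel_measurable M"
    using assms unfolding set_borel_measurable_def by (rule borel_measurable_add)
  then show ?thesis by (simp add: set_borel_measurable_def algebra_simps)
qed

lemma set_borel_measurable_times: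
  fixes f g :: "real \<Rightarrow> real"
  assumes "set_borel_measurable M A f" "set_borel_measurable M A g"
  shows "set_borel_measurable M A (\<lambda>x. f x * g x)"
proof -
  have "(\<lambda>x. (indicat_real A x *\<^sub>R f x) * (indicat_real A x *\<^sub>R g x)) \<in> borel_measurable M"
    using assms unfolding set_borel_measurable_def by (rule borel_measurable_times)
  moreover have "(indicat_real A x *\<^sub>R f x) * (indicat_real A x *\<^sub>R g x) = indicat_real A x *\<^sub>R (f x * g x)" for x
    by (auto simp: indicator_def)
  ultimately show ?thesis unfolding set_borel_measurable_def by (simp only:)
qed

lemma set_integrable_L2_mult:
  assumes "g \<in> L2 \<beta>" "h \<in> L2 \<beta>"
  shows "set_integrable lborel {0..\<beta>} (\<lambda>\<tau>. g \<tau> * h \<tau>)"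
proof (rule set_integrable_bound)
  show "set_integrable lborel {0..\<beta>} (\<lambda>\<tau>. (g \<tau>)\<^sup>2 + (h \<tau>)\<^sup>2)"
    using assms by (intro set_integral_add) (auto simp: L2_def)
  show "set_borel_measurable lborel {0..\<beta>} (\<lambda>\<tau>. g \<tau> * h \<tau>)"
    using assms by (intro set_borel_measurable_times) (auto simp: L2_def)
  have "\<bar>x * y\<bar> \<le> \<bar>x\<^sup>2 + y\<^sup>2\<bar>" for x y :: real
  proof -
    have "2 * (\<bar>x\<bar> * \<bar>y\<bar>) \<le> x\<^sup>2 + y\<^sup>2" using sum_squares_bound[of "\<bar>x\<bar>" "\<bar>y\<bar>"] by simp
    moreover have "0 \<le> \<bar>x\<bar> * \<bar>y\<bar>" by simp
    ultimately show ?thesis unfolding abs_mult by linarith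
  qed
  then show "AE \<tau> in lborel. \<tau> \<in> {0..\<beta>} \<longrightarrow> norm (g \<tau> * h \<tau>) \<le> norm ((g \<tau>)\<^sup>2 + (h \<tau>)\<^sup>2)"
    by simp
qed

lemma L2_cmult: "g \<in> L2 \<beta> \<Longrightarrow> (\<lambda>\<tau>. c * g \<tau>) \<in> L2 \<beta>"
proof -
  assume g: "g \<in> L2 \<beta>"
  have "(\<lambda>x. c * (indicat_real {0..\<beta>} x *\<^sub>R g x)) \<in> borel_measurable lborel"
    using g unfolding L2_def set_borel_measurable_def by (intro borel_measurable_times) auto
  then have "set_borel_measurable lborel {0..\<beta>} (\<lambda>\<tau>. c * g \<tau>)"
    by (simp add: set_borel_measurable_def mult.left_commute)
  moreover have "set_integrable lborel {0..\<beta>} (\<lambda>\<tau>. c\<^sup>2 * (g \<tau>)\<^sup>2)"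
    using g by (intro set_integrable_mult_right) (simp add: L2_def)
  ultimately show ?thesis by (simp add: L2_def power_mult_distrib)
qed

lemma L2_add:
  assumes g: "g \<in> L2 \<beta>" and h: "h \<in> L2 \<beta>"
  shows "(\<lambda>\<tau>. g \<tau> + h \<tau>) \<in> L2 \<beta>"
proof -
  have "set_integrable lborel {0..\<beta>} (\<lambda>\<tau>. (g \<tau>)\<^sup>2 + (h \<tau>)\<^sup>2 + 2 * (g \<tau> * h \<tau>))"
    using g h by (intro set_integral_add set_integrable_mult_right set_integrable_L2_mult) (auto simp: L2_def)
  moreover have "(g \<tau>)\<^sup>2 + (h \<tau>)\<^sup>2 + 2 * (g \<tau> * h \<tau>) = (g \<tau> + h \<tau>)\<^sup>2" for \<tau>
    by (simp add: power2_sum)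
  moreover have "set_borel_measurable lborel {0..\<beta>} (\<lambda>\<tau>. g \<tau> + h \<tau>)"
    using g h by (intro set_borel_measurable_add) (auto simp: L2_def)
  ultimately show ?thesis by (simp add: L2_def)
qed

lemma L2_diff: "g \<in> L2 \<beta> \<Longrightarrow> h \<in> L2 \<beta> \<Longrightarrow> (\<lambda>\<tau>. g \<tau> - h \<tau>) \<in> L2 \<beta>"
  using L2_add[of g \<beta> "\<lambda>\<tau>. -1 * h \<tau>"] L2_cmult[of h \<beta> "-1"] by simp

lemma continuous_imp_L2:
  assumes "continuous_on {0..\<beta>} f" shows "f \<in> L2 \<beta>"
proof -
  have "set_integrable lborel {0..\<beta>} f" "set_integrable lborel {0..\<beta>} (\<lambda>\<tau>. (f \<tau>)\<^sup>2)"
    using assms by (auto intro!: borel_integrable_atLeastAtMost' continuous_intros)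
  then show ?thesis
    unfolding L2_def set_borel_measurable_def set_integrable_def by (simp add: borel_measurable_integrable)
qed

lemma loop_in_L2: "f \<in> loops \<beta> \<Longrightarrow> f \<in> L2 \<beta>"
  by (intro continuous_imp_L2) (simp add: topspace_loop_top)

lemma L2_inner_cmult_left: "L2_inner \<beta> (\<lambda>\<tau>. c * g \<tau>) h = c * L2_inner \<beta> g h"
  by (simp add: L2_inner_def mult.assoc)

lemma L2_inner_cmult_right: "L2_inner \<beta> g (\<lambda>\<tau>. c * h \<tau>) = c * L2_inner \<beta> g h"
  by (simp add: L2_inner_def mult.left_commute)

lemma L2_inner_diff_left:
  assumes "g \<in> L2 \<beta>" "g' \<in> L2 \<beta>" "h \<in> L2 \<beta>"
  shows "L2_inner \<beta> (\<lambda>\<tau>. g \<tau> - g' \<tau>) h = L2_inner \<beta> g h - L2_inner \<beta> g' h"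
  unfolding L2_inner_def left_diff_distrib
  by (intro set_integral_diff(2) set_integrable_L2_mult assms)

lemma L2_inner_diff_right:
  assumes "g \<in> L2 \<beta>" "h \<in> L2 \<beta>" "h' \<in> L2 \<beta>"
  shows "L2_inner \<beta> g (\<lambda>\<tau>. h \<tau> - h' \<tau>) = L2_inner \<beta> g h - L2_inner \<beta> g h'"
  unfolding L2_inner_def right_diff_distrib
  by (intro set_integral_diff(2) set_integrable_L2_mult assms)

lemma L2_inner_self_nonneg: "L2_inner \<beta> g g \<ge> 0"
  by (simp add: L2_inner_def set_lebesgue_integral_def)

text \<open>Young's inequality with a free weight \<open>e\<close>, integrated. It does the work of
  Cauchy-Schwarz while staying linear in the squared norms.\<close>

lemma abs_L2_inner_le:
  assumes "g \<in> L2 \<beta>" "h \<in> L2 \<beta>" "e > 0"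
  shows "\<bar>L2_inner \<beta> g h\<bar> \<le> e / 2 * L2_inner \<beta> g g + 1 / (2 * e) * L2_inner \<beta> h h"
proof -
  have i: "set_integrable lborel {0..\<beta>} (\<lambda>\<tau>. e / 2 * (g \<tau> * g \<tau>))"
     "set_integrable lborel {0..\<beta>} (\<lambda>\<tau>. 1 / (2 * e) * (h \<tau> * h \<tau>))"
    using assms by (auto intro!: set_integrable_mult_right set_integrable_L2_mult)
  have pt: "\<bar>x * y\<bar> \<le> e / 2 * (x * x) + 1 / (2 * e) * (y * y)" for x y :: real
  proof -
    have "0 \<le> (e * \<bar>x\<bar> - \<bar>y\<bar>)\<^sup>2 / (2 * e)" using assms by simp
    also have "\<dots> = e / 2 * (x * x) + 1 / (2 * e) * (y * y) - \<bar>x * y\<bar>"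
      using assms(3) by (simp add: power2_eq_square abs_mult field_simps)
    finally show ?thesis by simp
  qed
  have "\<bar>L2_inner \<beta> g h\<bar> \<le> (LINT \<tau>:{0..\<beta>}|lborel. e / 2 * (g \<tau> * g \<tau>) + 1 / (2 * e) * (h \<tau> * h \<tau>))"
    unfolding L2_inner_def set_lebesgue_integral_def
  proof (intro Bochner_Integration.integral_abs_bound_integral)
    show "integrable lborel (\<lambda>\<tau>. indicat_real {0..\<beta>} \<tau> *\<^sub>R (g \<tau> * h \<tau>))"
      using set_integrable_L2_mult[OF assms(1,2)] by (simp only: set_integrable_def)
    show "integrable lborel (\<lambda>\<tau>. indicat_real {0..\<beta>} \<tau> *\<^sub>R (e / 2 * (g \<tau> * g \<tau>) + 1 / (2 * e) * (h \<tau> * h \<tau>)))"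
      using set_integral_add(1)[OF i] by (simp only: set_integrable_def)
    show "\<bar>indicat_real {0..\<beta>} \<tau> *\<^sub>R (g \<tau> * h \<tau>)\<bar>
       \<le> indicat_real {0..\<beta>} \<tau> *\<^sub>R (e / 2 * (g \<tau> * g \<tau>) + 1 / (2 * e) * (h \<tau> * h \<tau>))" for \<tau>
      using pt[of "g \<tau>" "h \<tau>"] by (auto simp: indicator_def)
  qed
  also have "\<dots> = e / 2 * L2_inner \<beta> g g + 1 / (2 * e) * L2_inner \<beta> h h"
    using set_integral_add(2)[OF i] by (simp only: L2_inner_def set_integral_mult_right)
  finally show ?thesis .
qed

lemma space_L2_borel: "space (L2_borel \<beta>) = L2 \<beta>"
  by (simp add: L2_borel_def space_measure_of_conv)

lemma sets_L2_borel_I: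
  assumes "A \<subseteq> L2 \<beta>" "\<And>g. g \<in> A \<Longrightarrow> \<exists>e>0. \<forall>h\<in>L2 \<beta>. L2_dist \<beta> g h < e \<longrightarrow> h \<in> A"
  shows "A \<in> sets (L2_borel \<beta>)"
proof -
  have "sets (L2_borel \<beta>) = sigma_sets (L2 \<beta>)
     {A. A \<subseteq> L2 \<beta> \<and> (\<forall>g\<in>A. \<exists>e>0. \<forall>h\<in>L2 \<beta>. L2_dist \<beta> g h < e \<longrightarrow> h \<in> A)}"
    unfolding L2_borel_def by (rule sets_measure_of) auto
  then show ?thesis using assms by (auto intro!: sigma_sets.Basic)
qed

lemma L2_inner_measurable:
  assumes h: "h \<in> L2 \<beta>"
  shows "L2_inner \<beta> h \<in> borel_measurable (L2_borel \<beta>)"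
proof (rule borel_measurableI)
  fix V :: "real set" assume V: "open V"
  show "L2_inner \<beta> h -` V \<inter> space (L2_borel \<beta>) \<in> sets (L2_borel \<beta>)"
  proof (rule sets_L2_borel_I)
    fix g assume "g \<in> L2_inner \<beta> h -` V \<inter> space (L2_borel \<beta>)"
    then have g: "g \<in> L2 \<beta>" "L2_inner \<beta> h g \<in> V" by (auto simp: space_L2_borel)
    obtain e where e: "e > 0" "\<And>y. \<bar>y - L2_inner \<beta> h g\<bar> < e \<Longrightarrow> y \<in> V"
      using V g(2) unfolding open_dist dist_real_def by blast
    \<comment> \<open>As weight in Young's inequality, \<open>a\<close> makes the term of
      \<open>h\<close> at most \<open>e / 2\<close>; the radius \<open>sqrt (e * a)\<close> then
      makes the term of the difference less than \<open>e / 2\<close>. The 1 guards against a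
      vanishing \<open>h\<close>.\<close>
    define a where "a = e / (L2_inner \<beta> h h + 1)"
    have "a > 0" using e(1) L2_inner_self_nonneg[of \<beta> h] by (simp add: a_def)
    have "L2_inner \<beta> h k \<in> V" if k: "k \<in> L2 \<beta>" "L2_dist \<beta> g k < sqrt (e * a)" for k
    proof -
      let ?d = "\<lambda>\<tau>. g \<tau> - k \<tau>"
      have "L2_inner \<beta> ?d ?d < e * a" using k(2) by (simp add: L2_dist_def)
      then have 1: "1 / (2 * a) * L2_inner \<beta> ?d ?d < e / 2" using \<open>a > 0\<close> by (simp add: field_simps)
      have 2: "a / 2 * L2_inner \<beta> h h \<le> e / 2"
        using e(1) L2_inner_self_nonneg[of \<beta> h] by (simp add: a_def field_simps)
      have "\<bar>L2_inner \<beta> h ?d\<bar> < e"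
        using abs_L2_inner_le[OF h L2_diff[OF g(1) k(1)] \<open>a > 0\<close>] 1 2 by linarith
      then show ?thesis
        using e(2)[of "L2_inner \<beta> h k"] L2_inner_diff_right[OF h g(1) k(1)] by (simp add: abs_minus_commute)
    qed
    moreover have "sqrt (e * a) > 0" using e(1) \<open>a > 0\<close> by simp
    ultimately show "\<exists>e>0. \<forall>k\<in>L2 \<beta>. L2_dist \<beta> g k < e \<longrightarrow> k \<in> L2_inner \<beta> h -` V \<inter> space (L2_borel \<beta>)"
      by (intro exI[of _ "sqrt (e * a)"]) (auto simp: space_L2_borel)
  qed (auto simp: space_L2_borel)
qed

lemma L2_dist_le_loop_dist:
  assumes f: "f \<in> loops \<beta>" and g: "g \<in> loops \<beta>" and "\<beta> \<ge> 0"
  shows "L2_dist \<beta> f g \<le> sqrt \<beta> * loop_dist \<beta> f g"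
proof -
  let ?d = "loop_dist \<beta> f g"
  have "set_integrable lborel {0..\<beta>} (\<lambda>\<tau>. (f \<tau> - g \<tau>) * (f \<tau> - g \<tau>))"
    using f g by (intro set_integrable_L2_mult L2_diff loop_in_L2)
  moreover have d: "\<bar>f x - g x\<bar> \<le> ?d" if "x \<in> {0..\<beta>}" for x by (rule loop_dist_bound[OF f g that])
  then have "\<bar>(f x - g x) * (f x - g x)\<bar> \<le> ?d * ?d" if "x \<in> {0..\<beta>}" for x
    using d[OF that] unfolding abs_mult by (intro mult_mono) auto
  ultimately have "\<bar>L2_inner \<beta> (\<lambda>\<tau>. f \<tau> - g \<tau>) (\<lambda>\<tau>. f \<tau> - g \<tau>)\<bar> \<le> ?d * ?d * (\<beta> - 0)"
    unfolding L2_inner_def using assms(3) by (intro abs_set_integral_le) auto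
  then have "L2_dist \<beta> f g \<le> sqrt (?d\<^sup>2 * \<beta>)"
    unfolding L2_dist_def by (simp add: power2_eq_square)
  also have "\<dots> = sqrt \<beta> * ?d"
    using Metric_space.nonneg[OF Metric_space_mspace_mdist] by (simp add: real_sqrt_mult)
  finally show ?thesis .
qed

text \<open>The sup distance dominates the \<open>L2\<close> distance up to
  \<open>sqrt \<beta>\<close>, so an \<open>L2\<close>-open set meets the loop space in an open set.
  This gives the image measure in \<open>loop_gaussian\<close> its intended meaning.\<close>

lemma loop_inclusion_measurable:
  assumes "\<beta> \<ge> 0"
  shows "(\<lambda>\<omega>. \<omega>) \<in> measurable (borel_of (loop_top \<beta>)) (L2_borel \<beta>)"
  unfolding L2_borel_def
proof (rule measurable_measure_of)
  show "(\<lambda>\<omega>. \<omega>) \<in> space (borel_of (loop_top \<beta>)) \<rightarrow> L2 \<beta>"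
    by (rule funcsetI) (simp add: loop_in_L2)
  fix A assume A: "A \<in> {A. A \<subseteq> L2 \<beta> \<and> (\<forall>g\<in>A. \<exists>e>0. \<forall>h\<in>L2 \<beta>. L2_dist \<beta> g h < e \<longrightarrow> h \<in> A)}"
  have "openin (loop_top \<beta>) (A \<inter> loops \<beta>)"
    unfolding openin_loop_top_iff
  proof (intro conjI ballI)
    fix f assume f: "f \<in> A \<inter> loops \<beta>"
    then obtain e where e: "e > 0" "\<forall>h\<in>L2 \<beta>. L2_dist \<beta> f h < e \<longrightarrow> h \<in> A" using A by blast
    have "h \<in> A" if h: "h \<in> loops \<beta>" "loop_dist \<beta> f h < e / (sqrt \<beta> + 1)" for h
    proof -
      have s: "sqrt \<beta> + 1 > 0" using assms by (smt (verit) real_sqrt_ge_zero)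
      have nn: "0 \<le> loop_dist \<beta> f h"
        using Metric_space.nonneg[OF Metric_space_mspace_mdist] .
      have "L2_dist \<beta> f h \<le> sqrt \<beta> * loop_dist \<beta> f h"
        using L2_dist_le_loop_dist f h(1) assms by blast
      also have "\<dots> \<le> (sqrt \<beta> + 1) * loop_dist \<beta> f h" using nn by (simp add: algebra_simps)
      also have "\<dots> < e" using h(2) s by (simp add: pos_less_divide_eq mult.commute)
      finally show ?thesis using e(2) loop_in_L2[OF h(1)] by blast
    qed
    moreover have "e / (sqrt \<beta> + 1) > 0" using e(1) assms by (smt (verit) divide_pos_pos real_sqrt_ge_zero)
    ultimately show "\<exists>e>0. \<forall>g\<in>loops \<beta>. loop_dist \<beta> f g < e \<longrightarrow> g \<in> A \<inter> loops \<beta>"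
      by blast
  qed auto
  then show "(\<lambda>\<omega>. \<omega>) -` A \<inter> space (borel_of (loop_top \<beta>)) \<in> sets (borel_of (loop_top \<beta>))"
    by (simp add: openin_imp_borel_of)
qed auto

text \<open>The tilted density is \<open>\<sigma>\<close> times the normal density of variance
  \<open>1 / (1 - a)\<close>. The restriction \<open>a < 1\<close> is the source of the requirement
  that \<open>c - c'\<close> stay below 1.\<close>

lemma nn_integral_exp_square_std_normal:
  assumes "a < 1"
  shows "(\<integral>\<^sup>+x. ennreal (exp (a * x\<^sup>2 / 2)) \<partial>std_normal_distribution) = ennreal (1 / sqrt (1 - a))"
proof -
  define \<sigma> where "\<sigma> = 1 / sqrt (1 - a)"
  have "\<sigma> > 0" using assms by (simp add: \<sigma>_def)
  have sq: "\<sigma>\<^sup>2 = 1 / (1 - a)" using assms by (simp add: \<sigma>_def power_divide)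
  have eq: "std_normal_density x * exp (a * x\<^sup>2 / 2) = \<sigma> * normal_density 0 \<sigma> x" for x
  proof -
    have "sqrt (2 * pi * \<sigma>\<^sup>2) = sqrt (2 * pi) * \<sigma>" using \<open>\<sigma> > 0\<close> by (simp add: real_sqrt_mult)
    moreover have "exp (- (x - 0)\<^sup>2 / (2 * \<sigma>\<^sup>2)) = exp (- x\<^sup>2 / 2) * exp (a * x\<^sup>2 / 2)"
      unfolding sq exp_add[symmetric] using assms by (simp add: field_simps)
    ultimately show ?thesis
      using \<open>\<sigma> > 0\<close> by (simp add: std_normal_density_def normal_density_def[of 0 \<sigma>])
  qed
  have "(\<integral>\<^sup>+x. ennreal (exp (a * x\<^sup>2 / 2)) \<partial>std_normal_distribution) =
    (\<integral>\<^sup>+x. ennreal (std_normal_density x) * ennreal (exp (a * x\<^sup>2 / 2)) \<partial>lborel)"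
    by (rule nn_integral_density) auto
  also have "\<dots> = (\<integral>\<^sup>+x. ennreal (\<sigma> * normal_density 0 \<sigma> x) \<partial>lborel)"
    by (intro nn_integral_cong) (simp only: ennreal_mult'[symmetric] normal_density_nonneg exp_ge_zero eq)
  also have "\<dots> = ennreal (\<integral>x. \<sigma> * normal_density 0 \<sigma> x \<partial>lborel)"
    using \<open>\<sigma> > 0\<close> by (intro nn_integral_eq_integral) auto
  also have "\<dots> = ennreal \<sigma>" using \<open>\<sigma> > 0\<close> by simp
  finally show ?thesis by (simp add: \<sigma>_def)
qed

section \<open>The periodic covariance\<close>

text \<open>\<open>int_decode\<close> runs through 0, -1, 1, -2, 2, and so on. Along it, sums over
  all frequencies become ordinary series, and this bound compares the frequency with the
  index.\<close>

lemma abs_int_decode_ge: "real k / 2 \<le> \<bar>of_int (int_decode k)\<bar>"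
proof -
  have "k \<le> 2 * nat \<bar>int_decode k\<bar>"
    by (auto simp: int_decode_def sum_decode_def)
  then have "real k \<le> 2 * real (nat \<bar>int_decode k\<bar>)" by linarith
  then show ?thesis by simp
qed

lemma abs_freq_int_decode_ge:
  assumes "\<beta> > 0" shows "pi * real k / \<beta> \<le> \<bar>freq \<beta> (int_decode k)\<bar>"
proof -
  have "2 * pi / \<beta> * (real k / 2) \<le> 2 * pi / \<beta> * \<bar>of_int (int_decode k)\<bar>"
    using assms by (intro mult_left_mono abs_int_decode_ge) auto
  also have "\<dots> = \<bar>freq \<beta> (int_decode k)\<bar>"
    using assms by (simp add: freq_def abs_mult)
  finally show ?thesis by (simp add: field_simps)
qed

lemma int_decode_0 [simp]: "int_decode 0 = 0"
  by (simp add: int_decode_def sum_decode_def)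

lemma summable_covariance_eigenvalues:
  assumes "\<beta> > 0" "m > 0"
  shows "summable (\<lambda>k. inverse (m * (freq \<beta> (int_decode k))\<^sup>2 + 1))"
proof (rule summable_comparison_test')
  show "summable (\<lambda>k. \<beta>\<^sup>2 / (m * pi\<^sup>2) * inverse (real k ^ 2))"
    by (intro summable_mult inverse_power_summable) simp
  fix k :: nat assume "k \<ge> 1"
  let ?q = "freq \<beta> (int_decode k)"
  have "(pi * real k / \<beta>)\<^sup>2 \<le> \<bar>?q\<bar>\<^sup>2"
    using abs_freq_int_decode_ge[OF assms(1)] assms(1) by (intro power_mono) auto
  then have "m * (pi * real k / \<beta>)\<^sup>2 \<le> m * ?q\<^sup>2 + 1" using assms(2) by (simp add: add.commute add_increasing)
  moreover have "0 < m * (pi * real k / \<beta>)\<^sup>2" using assms \<open>k \<ge> 1\<close> by simp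
  ultimately have "inverse (m * ?q\<^sup>2 + 1) \<le> inverse (m * (pi * real k / \<beta>)\<^sup>2)" by (rule le_imp_inverse_le)
  also have "\<dots> = \<beta>\<^sup>2 / (m * pi\<^sup>2) * inverse (real k ^ 2)"
    using assms by (simp add: field_simps)
  finally show "norm (inverse (m * ?q\<^sup>2 + 1)) \<le> \<beta>\<^sup>2 / (m * pi\<^sup>2) * inverse (real k ^ 2)"
    using assms(2) by (simp add: add_nonneg_pos less_imp_le)
qed

lemma infsum_int_decode:
  fixes f :: "int \<Rightarrow> real"
  assumes "summable (\<lambda>k. \<bar>f (int_decode k)\<bar>)"
  shows "infsum f UNIV = (\<Sum>k. f (int_decode k))"
proof -
  have "(\<lambda>k. f (int_decode k)) summable_on UNIV"
    using assms by (intro norm_summable_imp_summable_on) simp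
  then have "((\<lambda>k. f (int_decode k)) has_sum infsum (\<lambda>k. f (int_decode k)) UNIV) UNIV"
    by simp
  then have "(\<lambda>k. f (int_decode k)) sums infsum (\<lambda>k. f (int_decode k)) UNIV"
    by (rule has_sum_imp_sums)
  moreover have "infsum (\<lambda>k. f (int_decode k)) UNIV = infsum f UNIV"
    by (rule infsum_reindex_bij_betw[OF bij_int_decode])
  ultimately show ?thesis by (simp add: sums_iff)
qed

lemma trig_basis_continuous: "continuous_on A (trig_basis \<beta> n)"
proof -
  have "trig_basis \<beta> n = (if n = 0 then (\<lambda>_. 1 / sqrt \<beta>) else if n > 0 then (\<lambda>\<tau>. sqrt (2 / \<beta>) * cos (freq \<beta> n * \<tau>))
     else (\<lambda>\<tau>. sqrt (2 / \<beta>) * sin (freq \<beta> n * \<tau>)))"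
    by (auto simp: trig_basis_def)
  then show ?thesis by (auto intro!: continuous_intros)
qed

lemma trig_basis_L2: "trig_basis \<beta> n \<in> L2 \<beta>"
  by (intro continuous_imp_L2 trig_basis_continuous)

lemma abs_trig_basis_le:
  assumes "\<beta> > 0" shows "\<bar>trig_basis \<beta> n \<tau>\<bar> \<le> sqrt (2 / \<beta>)"
proof -
  have s: "sqrt (2 / \<beta>) \<ge> 0" using assms by simp
  have "1 / sqrt \<beta> \<le> sqrt (2 / \<beta>)" using assms by (simp add: real_sqrt_divide divide_right_mono)
  moreover have "\<bar>sqrt (2 / \<beta>) * cos x\<bar> \<le> sqrt (2 / \<beta>)" "\<bar>sqrt (2 / \<beta>) * sin x\<bar> \<le> sqrt (2 / \<beta>)" for x
    unfolding abs_mult using s by (simp_all add: mult_left_le)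
  ultimately show ?thesis using assms unfolding trig_basis_def by (auto simp del: abs_mult)
qed

text \<open>With \<open>y\<close> the phase difference, the difference of two sines or cosines is at
  most \<open>min 2 y\<close>, whose square is at most \<open>4 * sqrt y\<close>. The power of the
  frequency kept here must be below 1, because after multiplication with eigenvalues of order
  \<open>1 / q^2\<close> the sum over frequencies has to converge.\<close>

lemma trig_basis_diff_sq_le:
  assumes "\<beta> > 0"
  shows "(trig_basis \<beta> n s - trig_basis \<beta> n t)\<^sup>2 \<le> 8 / \<beta> * sqrt (\<bar>freq \<beta> n\<bar> * \<bar>s - t\<bar>)"
proof -
  let ?q = "freq \<beta> n"
  define y where "y = \<bar>?q\<bar> * \<bar>s - t\<bar>"
  have "y \<ge> 0" by (simp add: y_def)
  have d: "\<bar>sin a - sin b\<bar> \<le> \<bar>a - b\<bar>" for a b :: real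
  proof -
    have "\<bar>sin a - sin b\<bar> = 2 * \<bar>sin ((a - b) / 2)\<bar> * \<bar>cos ((a + b) / 2)\<bar>"
      by (simp add: sin_diff_sin abs_mult)
    also have "\<dots> \<le> 2 * \<bar>(a - b) / 2\<bar> * 1"
      by (intro mult_mono abs_cos_le_one abs_sin_x_le_abs_x) auto
    finally show ?thesis by simp
  qed
  have c: "\<bar>cos a - cos b\<bar> \<le> \<bar>a - b\<bar>" for a b :: real
    using d[of "pi / 2 - a" "pi / 2 - b"] by (simp add: cos_sin_eq)
  have y: "\<bar>?q * s - ?q * t\<bar> = y" by (simp add: y_def abs_mult right_diff_distrib[symmetric])
  have bd: "\<bar>u - v\<bar> \<le> 2" if "\<bar>u\<bar> \<le> 1" "\<bar>v\<bar> \<le> 1" for u v :: real using that by linarith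
  have "\<exists>u. \<bar>u\<bar> \<le> min 2 y \<and> trig_basis \<beta> n s - trig_basis \<beta> n t = sqrt (2 / \<beta>) * u"
    using c[of "?q * s" "?q * t"] d[of "?q * s" "?q * t"] \<open>y \<ge> 0\<close>
      bd[OF abs_cos_le_one abs_cos_le_one, of "?q * s" "?q * t"]
      bd[OF abs_sin_le_one abs_sin_le_one, of "?q * s" "?q * t"]
    unfolding trig_basis_def y
    by (intro exI[of _ "if n = 0 then 0 else if n > 0 then cos (?q * s) - cos (?q * t) else sin (?q * s) - sin (?q * t)"])
       (auto simp: algebra_simps)
  then obtain u where u: "\<bar>u\<bar> \<le> min 2 y" "trig_basis \<beta> n s - trig_basis \<beta> n t = sqrt (2 / \<beta>) * u" by blast
  have "u\<^sup>2 \<le> 4 * sqrt y"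
  proof (cases "y \<le> 1")
    case True
    have "u\<^sup>2 \<le> y\<^sup>2" using u(1) \<open>y \<ge> 0\<close> by (simp add: abs_le_square_iff[symmetric])
    also have "\<dots> \<le> y" using True \<open>y \<ge> 0\<close> by (simp add: power2_eq_square mult_left_le)
    also have "\<dots> \<le> sqrt y" using True \<open>y \<ge> 0\<close> by (intro real_le_rsqrt) (simp add: power2_eq_square mult_left_le)
    finally show ?thesis using \<open>y \<ge> 0\<close> by (smt (verit) real_sqrt_ge_zero)
  next
    case False
    have "u\<^sup>2 \<le> 2\<^sup>2" using u(1) by (subst abs_le_square_iff[symmetric]) simp
    also have "\<dots> \<le> 4 * sqrt y" using False by simp
    finally show ?thesis .
  qed
  then have "2 / \<beta> * u\<^sup>2 \<le> 2 / \<beta> * (4 * sqrt y)" using assms by (intro mult_left_mono) auto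
  then show ?thesis using assms by (simp add: u(2) power_mult_distrib y_def)
qed

text \<open>Orthogonality of the other modes to the constants: it leaves only the mode of frequency
  0 in the variance of the loop average, and thereby removes the mass from it.\<close>

lemma trig_basis_integral_eq_0:
  assumes "\<beta> > 0" "n \<noteq> 0"
  shows "L2_inner \<beta> (trig_basis \<beta> n) (\<lambda>_. 1) = 0"
proof -
  let ?q = "freq \<beta> n"
  have q: "?q \<noteq> 0" "?q * \<beta> = of_int n * (2 * pi)" using assms by (auto simp: freq_def)
  have "(trig_basis \<beta> n has_integral 0) {0..\<beta>}"
  proof (cases "n > 0")
    case True
    have "((\<lambda>\<tau>. sqrt (2 / \<beta>) * cos (?q * \<tau>)) has_integral
        sqrt (2 / \<beta>) * sin (?q * \<beta>) / ?q - sqrt (2 / \<beta>) * sin (?q * 0) / ?q) {0..\<beta>}"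
      using assms q by (intro fundamental_theorem_of_calculus)
        (auto intro!: derivative_eq_intros simp: has_real_derivative_iff_has_vector_derivative[symmetric])
    moreover have "sin (?q * \<beta>) = 0" unfolding q(2) using sin_int_2pin[of n] by (simp add: mult.commute mult.left_commute)
    ultimately show ?thesis using True by (simp add: trig_basis_def[abs_def])
  next
    case False
    have "((\<lambda>\<tau>. sqrt (2 / \<beta>) * sin (?q * \<tau>)) has_integral
        - sqrt (2 / \<beta>) * cos (?q * \<beta>) / ?q - - sqrt (2 / \<beta>) * cos (?q * 0) / ?q) {0..\<beta>}"
      using assms q by (intro fundamental_theorem_of_calculus)
        (auto intro!: derivative_eq_intros simp: has_real_derivative_iff_has_vector_derivative[symmetric])
    moreover have "cos (?q * \<beta>) = 1" unfolding q(2) using cos_int_2pin[of n] by (simp add: mult.commute mult.left_commute)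
    ultimately show ?thesis using False assms by (simp add: trig_basis_def[abs_def])
  qed
  moreover have "set_integrable lborel {0..\<beta>} (trig_basis \<beta> n)"
    by (intro borel_integrable_atLeastAtMost' trig_basis_continuous)
  ultimately show ?thesis
    by (simp add: L2_inner_def set_borel_integral_eq_integral(2) integral_unique)
qed

text \<open>Diagonalization of the covariance. Integral and series may be exchanged because the
  eigenvalues are summable while the coefficients \<open>a k\<close> and the basis functions are
  bounded uniformly in \<open>k\<close>.\<close>

lemma covariance_quadratic_form:
  assumes "\<beta> > 0" "m > 0" and h: "h \<in> L2 \<beta>"
  defines "a \<equiv> \<lambda>k. L2_inner \<beta> (trig_basis \<beta> (int_decode k)) h"
  defines "w \<equiv> \<lambda>k. inverse (m * (freq \<beta> (int_decode k))\<^sup>2 + 1)"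
  shows "summable (\<lambda>k. w k * (a k)\<^sup>2)"
    and "L2_inner \<beta> h (loop_covariance \<beta> m h) = (\<Sum>k. w k * (a k)\<^sup>2)"
proof -
  let ?e = "\<lambda>k. trig_basis \<beta> (int_decode k)"
  have w_nn: "w k \<ge> 0" for k using assms(2) by (simp add: w_def)
  have sumw: "summable (\<lambda>k. w k)"
    unfolding w_def by (rule summable_covariance_eigenvalues[OF assms(1,2)])
  \<comment> \<open>Young's inequality with weight 1 bounds each coefficient by half the squared
    norm of the basis function, at most 2, plus half that of \<open>h\<close>.\<close>
  define A where "A = 1 + 1 / 2 * L2_inner \<beta> h h"
  have a_le: "\<bar>a k\<bar> \<le> A" for k
  proof -
    let ?n = "int_decode k"
    have "\<bar>L2_inner \<beta> (trig_basis \<beta> ?n) (trig_basis \<beta> ?n)\<bar> \<le> 2 / \<beta> * (\<beta> - 0)"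
      unfolding L2_inner_def
    proof (intro abs_set_integral_le set_integrable_L2_mult trig_basis_L2)
      fix x
      have "\<bar>trig_basis \<beta> ?n x * trig_basis \<beta> ?n x\<bar> \<le> sqrt (2 / \<beta>) * sqrt (2 / \<beta>)"
        unfolding abs_mult using assms(1) by (intro mult_mono abs_trig_basis_le) auto
      then show "\<bar>trig_basis \<beta> ?n x * trig_basis \<beta> ?n x\<bar> \<le> 2 / \<beta>" using assms(1) by simp
    qed (use assms in auto)
    then show ?thesis
      using abs_L2_inner_le[OF trig_basis_L2[of \<beta> ?n] h, of 1] assms(1) by (simp add: a_def A_def)
  qed
  have "A \<ge> 0" using a_le[of 0] by linarith
  have sumwa: "summable (\<lambda>k. \<bar>w k * a k\<bar> * B)" for B
  proof (rule summable_mult2, rule summable_comparison_test')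
    show "summable (\<lambda>k. w k * A)" by (intro summable_mult2 sumw)
    show "norm \<bar>w k * a k\<bar> \<le> w k * A" if "k \<ge> 0" for k
      using w_nn[of k] a_le[of k] by (simp add: abs_mult mult_left_mono)
  qed
  have sum_pt: "summable (\<lambda>k. \<bar>w k * a k * ?e k \<tau>\<bar>)" for \<tau>
    unfolding abs_mult[of _ "trig_basis _ _ _"]
    by (rule summable_comparison_test'[OF sumwa[of "sqrt (2 / \<beta>)"], of 0])
      (use abs_trig_basis_le[OF assms(1)] in \<open>auto simp: abs_mult intro!: mult_left_mono\<close>)
  have K: "loop_covariance \<beta> m h \<tau> = (\<Sum>k. w k * a k * ?e k \<tau>)" for \<tau>
    unfolding loop_covariance_def
    by (subst infsum_int_decode) (use sum_pt[of \<tau>] in \<open>simp_all add: w_def a_def\<close>)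
  have hi: "set_integrable lborel {0..\<beta>} h"
    using set_integrable_L2_mult[OF h continuous_imp_L2[of \<beta> "\<lambda>_. 1"]] by simp
  define F where "F k \<tau> = indicat_real {0..\<beta>} \<tau> *\<^sub>R (h \<tau> * (w k * a k * ?e k \<tau>))" for k \<tau>
  have Fint: "integrable lborel (F k)" for k
  proof -
    have "set_integrable lborel {0..\<beta>} (\<lambda>\<tau>. w k * a k * (h \<tau> * ?e k \<tau>))"
      by (intro set_integrable_mult_right set_integrable_L2_mult h trig_basis_L2)
    then show ?thesis unfolding F_def set_integrable_def by (simp add: mult_ac)
  qed
  have FI: "(\<integral>\<tau>. F k \<tau> \<partial>lborel) = w k * (a k)\<^sup>2" for k
  proof -
    have "(\<integral>\<tau>. F k \<tau> \<partial>lborel) = (LINT \<tau>:{0..\<beta>}|lborel. w k * a k * (?e k \<tau> * h \<tau>))"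
      unfolding F_def set_lebesgue_integral_def by (simp add: mult_ac)
    also have "\<dots> = w k * a k * a k"
      by (simp add: a_def L2_inner_def)
    finally show ?thesis by (simp add: power2_eq_square mult.assoc)
  qed
  have ae: "AE \<tau> in lborel. summable (\<lambda>k. norm (F k \<tau>))"
  proof (rule AE_I2)
    fix \<tau>
    have "summable (\<lambda>k. \<bar>indicat_real {0..\<beta>} \<tau> * h \<tau>\<bar> * \<bar>w k * a k * ?e k \<tau>\<bar>)"
      by (intro summable_mult sum_pt)
    then show "summable (\<lambda>k. norm (F k \<tau>))" by (simp add: F_def abs_mult mult_ac)
  qed
  have nF: "summable (\<lambda>k. \<integral>\<tau>. norm (F k \<tau>) \<partial>lborel)"
  proof (rule summable_comparison_test')
    let ?H = "\<integral>\<tau>. \<bar>indicat_real {0..\<beta>} \<tau> *\<^sub>R h \<tau>\<bar> \<partial>lborel"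
    show "summable (\<lambda>k. \<bar>w k * a k\<bar> * (sqrt (2 / \<beta>) * ?H))" by (rule sumwa)
    fix k :: nat assume "k \<ge> 0"
    have "(\<integral>\<tau>. norm (F k \<tau>) \<partial>lborel) \<le>
      (\<integral>\<tau>. \<bar>w k * a k\<bar> * sqrt (2 / \<beta>) * \<bar>indicat_real {0..\<beta>} \<tau> *\<^sub>R h \<tau>\<bar> \<partial>lborel)"
    proof (rule integral_mono)
      show "integrable lborel (\<lambda>\<tau>. norm (F k \<tau>))" using Fint by (rule integrable_norm)
      show "integrable lborel (\<lambda>\<tau>. \<bar>w k * a k\<bar> * sqrt (2 / \<beta>) * \<bar>indicat_real {0..\<beta>} \<tau> *\<^sub>R h \<tau>\<bar>)"
        using hi unfolding set_integrable_def by (intro integrable_mult_right integrable_abs)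
      fix \<tau>
      have "norm (F k \<tau>) = \<bar>w k * a k\<bar> * \<bar>?e k \<tau>\<bar> * \<bar>indicat_real {0..\<beta>} \<tau> *\<^sub>R h \<tau>\<bar>"
        by (simp add: F_def abs_mult mult_ac)
      also have "\<dots> \<le> \<bar>w k * a k\<bar> * sqrt (2 / \<beta>) * \<bar>indicat_real {0..\<beta>} \<tau> *\<^sub>R h \<tau>\<bar>"
        by (intro mult_right_mono mult_left_mono abs_trig_basis_le assms) auto
      finally show "norm (F k \<tau>) \<le> \<dots>" .
    qed
    also have "\<dots> = \<bar>w k * a k\<bar> * (sqrt (2 / \<beta>) * ?H)" by simp
    finally show "norm (\<integral>\<tau>. norm (F k \<tau>) \<partial>lborel) \<le> \<dots>" by simp
  qed
  have "summable (\<lambda>k. \<integral>\<tau>. F k \<tau> \<partial>lborel)" using summable_integral[OF Fint ae nF] .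
  then show "summable (\<lambda>k. w k * (a k)\<^sup>2)" by (simp add: FI)
  have "L2_inner \<beta> h (loop_covariance \<beta> m h) = (\<integral>\<tau>. (\<Sum>k. F k \<tau>) \<partial>lborel)"
    unfolding L2_inner_def set_lebesgue_integral_def
  proof (rule Bochner_Integration.integral_cong[OF refl])
    fix \<tau>
    have s: "summable (\<lambda>k. w k * a k * ?e k \<tau>)"
      using sum_pt[of \<tau>] by (rule summable_rabs_cancel)
    show "indicat_real {0..\<beta>} \<tau> *\<^sub>R (h \<tau> * loop_covariance \<beta> m h \<tau>) = (\<Sum>k. F k \<tau>)"
      unfolding F_def K using suminf_mult[OF s, of "indicat_real {0..\<beta>} \<tau> * h \<tau>"] by (simp add: mult.assoc)
  qed
  also have "\<dots> = (\<Sum>k. \<integral>\<tau>. F k \<tau> \<partial>lborel)" by (rule integral_suminf[OF Fint ae nF])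
  finally show "L2_inner \<beta> h (loop_covariance \<beta> m h) = (\<Sum>k. w k * (a k)\<^sup>2)"
    by (simp add: FI)
qed

section \<open>Increments as limits of \<open>L2\<close> pairings, and their variance\<close>

lemma indicator_L2: "indicat_real {a..b} \<in> L2 \<beta>"
proof -
  have "set_integrable lborel {0..\<beta>} (indicat_real {a..b})"
    unfolding set_integrable_def real_scaleR_def indicator_inter_arith[symmetric] Int_atLeastAtMost
    using emeasure_lborel_Icc_eq by (intro integrable_real_indicator) auto
  moreover have "(indicat_real {a..b} x)\<^sup>2 = indicat_real {a..b} x" for x by (simp add: indicator_def)
  ultimately show ?thesis
    using borel_measurable_integrable unfolding L2_def set_borel_measurable_def set_integrable_def by simp
qed

lemma L2_inner_indicator:
  assumes "{a..b} \<subseteq> {0..\<beta>}"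
  shows "L2_inner \<beta> (indicat_real {a..b}) f = (LINT \<tau>:{a..b}|lborel. f \<tau>)"
  unfolding L2_inner_def set_lebesgue_integral_def
  by (rule Bochner_Integration.integral_cong) (use assms in \<open>auto simp: indicator_def\<close>)

lemma set_integral_shift:
  fixes f :: "real \<Rightarrow> real"
  shows "(LINT x:{a..a + d}|lborel. f x) = (LINT x:{0..d}|lborel. f (a + x))"
proof -
  have "indicat_real {a..a + d} (a + x) = indicat_real {0..d} x" for x by (auto simp: indicator_def)
  then show ?thesis
    unfolding set_lebesgue_integral_def
    by (subst lborel_integral_real_affine[where c = 1 and t = a]) simp_all
qed

text \<open>Only right averages are used; \<open>t < \<beta>\<close> keeps them inside the interval
  once \<open>N\<close> is large.\<close>

lemma right_average_tendsto:
  fixes f :: "real \<Rightarrow> real"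
  assumes f: "continuous_on {0..\<beta>} f" and t: "0 \<le> t" "t < \<beta>"
  shows "(\<lambda>N. real N * (LINT \<tau>:{t..t + 1 / N}|lborel. f \<tau>)) \<longlonglongrightarrow> f t"
proof (rule LIMSEQ_I)
  fix e :: real assume "e > 0"
  have "continuous (at t within {0..\<beta>}) f" using f t by (auto simp: continuous_on_eq_continuous_within)
  then obtain d where d: "d > 0" "\<And>x. x \<in> {0..\<beta>} \<Longrightarrow> \<bar>x - t\<bar> < d \<Longrightarrow> \<bar>f x - f t\<bar> < e / 2"
    using \<open>e > 0\<close> unfolding continuous_within_eps_delta dist_real_def by (metis half_gt_zero)
  obtain M :: nat where M: "M > 0" "1 / M < min d (\<beta> - t)"
    using nat_approx_posE[of "min d (\<beta> - t)"] d(1) t(2) by (metis diff_gt_0_iff_gt min_less_iff_conj zero_less_Suc)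
  have "norm (real N * (LINT \<tau>:{t..t + 1 / N}|lborel. f \<tau>) - f t) < e" if "N \<ge> M" for N
  proof -
    have "N > 0" using that M(1) by simp
    have N: "1 / N < min d (\<beta> - t)" "0 < 1 / real N"
    proof -
      have "1 / real N \<le> 1 / real M" using that M(1) by (intro divide_left_mono) auto
      then show "1 / N < min d (\<beta> - t)" using M(2) by linarith
      show "0 < 1 / real N" using \<open>N > 0\<close> by simp
    qed
    have i: "set_integrable lborel {t..t + 1 / N} f"
      by (intro borel_integrable_atLeastAtMost' continuous_on_subset[OF f]) (use N t in auto)
    have c: "set_integrable lborel {t..t + 1 / N} (\<lambda>_. f t)"
      by (intro borel_integrable_atLeastAtMost') auto
    have "\<bar>LINT \<tau>:{t..t + 1 / N}|lborel. f \<tau> - f t\<bar> \<le> e / 2 * (t + 1 / N - t)"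
    proof (rule abs_set_integral_le)
      fix x assume "x \<in> {t..t + 1 / N}"
      then show "\<bar>f x - f t\<bar> \<le> e / 2" using d(2)[of x] N t by auto
    qed (use i c N in \<open>auto intro: set_integral_diff\<close>)
    moreover have "(LINT \<tau>:{t..t + 1 / N}|lborel. f \<tau> - f t) = (LINT \<tau>:{t..t + 1 / N}|lborel. f \<tau>) - 1 / N * f t"
      using set_integral_diff(2)[OF i c] N(2) by (simp add: set_lebesgue_integral_def)
    ultimately have "\<bar>real N * ((LINT \<tau>:{t..t + 1 / N}|lborel. f \<tau>) - 1 / N * f t)\<bar> \<le> real N * (e / 2 * (1 / N))"
      unfolding abs_mult by (intro mult_mono) auto
    then show ?thesis using \<open>N > 0\<close> \<open>e > 0\<close> by (simp add: right_diff_distrib)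
  qed
  then show "\<exists>M. \<forall>N\<ge>M. norm (real N * (LINT \<tau>:{t..t + 1 / N}|lborel. f \<tau>) - f t) < e" by blast
qed

text \<open>A difference of two approximate delta functions. Pairing with it is an \<open>L2\<close>
  functional to which the Gaussian hypothesis applies, and it tends to the increment between
  \<open>s\<close> and \<open>t\<close>.\<close>

definition increment_kernel :: "real \<Rightarrow> real \<Rightarrow> nat \<Rightarrow> real \<Rightarrow> real" where
  "increment_kernel t s N \<tau> = real N * indicat_real {t..t + 1 / N} \<tau> - real N * indicat_real {s..s + 1 / N} \<tau>"

lemma increment_kernel_L2: "increment_kernel t s N \<in> L2 \<beta>"
  unfolding increment_kernel_def[abs_def] by (intro L2_diff L2_cmult indicator_L2)

lemma L2_inner_increment_kernel:
  assumes "{t..t + 1 / N} \<subseteq> {0..\<beta>}" "{s..s + 1 / N} \<subseteq> {0..\<beta>}" "f \<in> L2 \<beta>"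
  shows "L2_inner \<beta> (increment_kernel t s N) f =
    real N * (LINT \<tau>:{t..t + 1 / N}|lborel. f \<tau>) - real N * (LINT \<tau>:{s..s + 1 / N}|lborel. f \<tau>)"
  unfolding increment_kernel_def[abs_def]
  by (simp add: L2_inner_diff_left L2_cmult indicator_L2 assms L2_inner_cmult_left L2_inner_indicator[OF assms(1)] L2_inner_indicator[OF assms(2)])

lemma eventually_subinterval:
  assumes "0 \<le> t" "t < \<beta>"
  shows "eventually (\<lambda>N. {t..t + 1 / real N} \<subseteq> {0..\<beta>}) sequentially"
proof -
  have "(\<lambda>N. 1 / real N) \<longlonglongrightarrow> 0" by (rule lim_1_over_n)
  then have "eventually (\<lambda>N. 1 / real N < \<beta> - t) sequentially"
    using assms by (intro order_tendstoD) auto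
  then show ?thesis by eventually_elim (use assms in auto)
qed

lemma L2_inner_increment_kernel_tendsto:
  assumes "f \<in> loops \<beta>" "0 \<le> t" "t < \<beta>" "0 \<le> s" "s < \<beta>"
  shows "(\<lambda>N. L2_inner \<beta> (increment_kernel t s N) f) \<longlonglongrightarrow> f t - f s"
proof (rule Lim_transform_eventually)
  have f: "continuous_on {0..\<beta>} f" using assms by (simp add: topspace_loop_top)
  show "(\<lambda>N. real N * (LINT \<tau>:{t..t + 1 / N}|lborel. f \<tau>) - real N * (LINT \<tau>:{s..s + 1 / N}|lborel. f \<tau>)) \<longlonglongrightarrow> f t - f s"
    by (intro tendsto_diff right_average_tendsto[OF f] assms)
  show "eventually (\<lambda>N. real N * (LINT \<tau>:{t..t + 1 / N}|lborel. f \<tau>) - real N * (LINT \<tau>:{s..s + 1 / N}|lborel. f \<tau>)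
     = L2_inner \<beta> (increment_kernel t s N) f) sequentially"
    using eventually_subinterval[OF assms(2,3)] eventually_subinterval[OF assms(4,5)]
    by eventually_elim (use loop_in_L2[OF assms(1)] in \<open>simp add: L2_inner_increment_kernel\<close>)
qed

text \<open>The factor \<open>8 / \<beta>\<close> comes from \<open>trig_basis_diff_sq_le\<close>,
  the exponent from \<open>sqrt q / q^2\<close> at the lower bound \<open>pi * k / \<beta>\<close>
  for the frequency. The term at \<open>k = 0\<close> is 0, and adding 1 makes the constant visibly
  positive.\<close>

definition increment_const :: "real \<Rightarrow> real" where
  "increment_const \<beta> = 8 / \<beta> * (\<Sum>k. (pi * real k / \<beta>) powr (- 3 / 2)) + 1"

lemma summable_increment_const:
  assumes "\<beta> > 0" shows "summable (\<lambda>k. (pi * real k / \<beta>) powr (- 3 / 2))"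
proof -
  have "summable (\<lambda>k. (pi / \<beta>) powr (- 3 / 2) * real k powr (- 3 / 2))"
    using summable_real_powr_iff[of "- 3 / 2"] by (intro summable_mult) auto
  moreover have "(pi / \<beta>) powr (- 3 / 2) * real k powr (- 3 / 2) = (pi * real k / \<beta>) powr (- 3 / 2)" for k
    using assms by (simp add: powr_mult[symmetric])
  ultimately show ?thesis by (simp only:)
qed

lemma increment_const_pos: "\<beta> > 0 \<Longrightarrow> increment_const \<beta> > 0"
  unfolding increment_const_def
  by (intro add_nonneg_pos mult_nonneg_nonneg suminf_nonneg summable_increment_const) auto

lemma sqrt_over_square_le:
  assumes "0 < x" "x \<le> q" shows "sqrt q / q\<^sup>2 \<le> x powr (- 3 / 2)"
proof -
  have "sqrt q / q\<^sup>2 = q powr (1 / 2 - 2)"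
    using assms by (subst powr_diff) (simp add: powr_half_sqrt)
  also have "\<dots> \<le> x powr (1 / 2 - 2)" using assms by (intro powr_mono2') auto
  finally show ?thesis by simp
qed

text \<open>After a shift, each trigonometric coefficient of the kernel is an average over
  \<open>x\<close> of differences between the times \<open>t + x\<close> and \<open>s + x\<close>.
  Their distance is \<open>\<bar>t - s\<bar>\<close> for every \<open>x\<close>, so the bound does
  not depend on \<open>N\<close>.\<close>

lemma increment_variance_le:
  assumes "\<beta> > 0" "m > 0" "N > 0" "{t..t + 1 / N} \<subseteq> {0..\<beta>}" "{s..s + 1 / N} \<subseteq> {0..\<beta>}"
  shows "L2_inner \<beta> (increment_kernel t s N) (loop_covariance \<beta> m (increment_kernel t s N))
    \<le> increment_const \<beta> * sqrt \<bar>t - s\<bar> / m"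
proof -
  let ?h = "increment_kernel t s N" and ?q = "\<lambda>k. freq \<beta> (int_decode k)"
  define D where "D = \<bar>t - s\<bar>"
  have a: "(L2_inner \<beta> (trig_basis \<beta> n) ?h)\<^sup>2 \<le> 8 / \<beta> * sqrt (\<bar>freq \<beta> n\<bar> * D)" for n
  proof -
    let ?e = "trig_basis \<beta> n" and ?B = "sqrt (8 / \<beta> * sqrt (\<bar>freq \<beta> n\<bar> * D))"
    have i: "set_integrable lborel {0..1 / N} (\<lambda>x. ?e (u + x))" for u
      by (intro borel_integrable_atLeastAtMost' continuous_on_compose2[OF trig_basis_continuous[of UNIV]] continuous_intros) auto
    have "L2_inner \<beta> ?e ?h = L2_inner \<beta> ?h ?e" by (simp add: L2_inner_def mult.commute)
    also have "\<dots> = real N * (LINT x:{0..1 / N}|lborel. ?e (t + x)) - real N * (LINT x:{0..1 / N}|lborel. ?e (s + x))"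
      unfolding L2_inner_increment_kernel[OF assms(4,5) trig_basis_L2] set_integral_shift ..
    also have "\<dots> = real N * (LINT x:{0..1 / N}|lborel. ?e (t + x) - ?e (s + x))"
      unfolding set_integral_diff(2)[OF i i] by (simp add: right_diff_distrib)
    finally have eq: "\<bar>L2_inner \<beta> ?e ?h\<bar> = real N * \<bar>LINT x:{0..1 / N}|lborel. ?e (t + x) - ?e (s + x)\<bar>"
      by (simp add: abs_mult)
    have "\<bar>LINT x:{0..1 / N}|lborel. ?e (t + x) - ?e (s + x)\<bar> \<le> ?B * (1 / N - 0)"
    proof (rule abs_set_integral_le)
      fix x
      have "\<bar>?e (t + x) - ?e (s + x)\<bar> = sqrt ((?e (t + x) - ?e (s + x))\<^sup>2)" by simp
      also have "\<dots> \<le> ?B"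
        using trig_basis_diff_sq_le[OF assms(1), of n "t + x" "s + x"] by (intro real_sqrt_le_mono) (simp add: D_def)
      finally show "\<bar>?e (t + x) - ?e (s + x)\<bar> \<le> ?B" .
    qed (use set_integral_diff(1)[OF i i] in auto)
    then have "real N * \<bar>LINT x:{0..1 / N}|lborel. ?e (t + x) - ?e (s + x)\<bar> \<le> real N * (?B * (1 / N - 0))"
      by (intro mult_left_mono) auto
    then have "\<bar>L2_inner \<beta> ?e ?h\<bar> \<le> ?B" using assms(3) unfolding eq by simp
    then have "\<bar>L2_inner \<beta> ?e ?h\<bar>\<^sup>2 \<le> ?B\<^sup>2" by (intro power_mono) auto
    then show ?thesis using assms(1) by (simp add: D_def)
  qed
  define c where "c k = (pi * real k / \<beta>) powr (- 3 / 2)" for k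
  have c: "summable c" unfolding c_def by (rule summable_increment_const[OF assms(1)])
  have le: "inverse (m * (?q k)\<^sup>2 + 1) * (L2_inner \<beta> (trig_basis \<beta> (int_decode k)) ?h)\<^sup>2
    \<le> 8 / (\<beta> * m) * sqrt D * c k" for k
  proof (cases "k = 0")
    \<comment> \<open>The constant mode has eigenvalue 1 whatever the mass; it does no harm because
      its coefficient vanishes for a difference of two averages.\<close>
    case True
    then show ?thesis using a[of 0] assms(2) by (simp add: freq_def c_def)
  next
    case False
    have q: "pi * real k / \<beta> \<le> \<bar>?q k\<bar>" "0 < pi * real k / \<beta>"
      using abs_freq_int_decode_ge[OF assms(1)] False assms(1) by auto
    then have "?q k \<noteq> 0" by auto
    have "inverse (m * (?q k)\<^sup>2 + 1) \<le> inverse (m * (?q k)\<^sup>2)"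
      using \<open>?q k \<noteq> 0\<close> assms(2) by (intro le_imp_inverse_le) auto
    then have "inverse (m * (?q k)\<^sup>2 + 1) * (L2_inner \<beta> (trig_basis \<beta> (int_decode k)) ?h)\<^sup>2
      \<le> inverse (m * (?q k)\<^sup>2) * (8 / \<beta> * sqrt (\<bar>?q k\<bar> * D))"
      using assms(2) by (intro mult_mono a) auto
    also have "\<dots> = 8 / (\<beta> * m) * sqrt D * (sqrt \<bar>?q k\<bar> / \<bar>?q k\<bar>\<^sup>2)"
      by (simp add: real_sqrt_mult field_simps)
    also have "\<dots> \<le> 8 / (\<beta> * m) * sqrt D * c k"
      unfolding c_def using assms q by (intro mult_left_mono sqrt_over_square_le) (auto simp: D_def)
    finally show ?thesis .
  qed
  have "L2_inner \<beta> ?h (loop_covariance \<beta> m ?h) \<le> (\<Sum>k. 8 / (\<beta> * m) * sqrt D * c k)"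
    unfolding covariance_quadratic_form(2)[OF assms(1,2) increment_kernel_L2]
    by (intro suminf_le le covariance_quadratic_form(1)[OF assms(1,2) increment_kernel_L2] summable_mult c)
  also have "\<dots> = (8 / \<beta> * suminf c) * sqrt D / m" unfolding suminf_mult[OF c] by simp
  also have "\<dots> \<le> increment_const \<beta> * sqrt D / m"
    using assms(2) unfolding increment_const_def c_def[symmetric]
    by (intro divide_right_mono mult_right_mono) (auto simp: D_def)
  finally show ?thesis by (simp add: D_def)
qed

section \<open>Gaussian laws of linear functionals of a loop\<close>

locale loop_gauss =
  fixes \<beta> m :: real and \<gamma> :: "(real \<Rightarrow> real) measure"
  assumes beta: "\<beta> > 0" and m: "m > 0" and gauss: "loop_gaussian \<beta> m \<gamma>"
begin

lemma sets_\<gamma>: "sets \<gamma> = sets (borel_of (loop_top \<beta>))"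
  using gauss by (simp add: loop_gaussian_def)

lemma space_\<gamma>: "space \<gamma> = loops \<beta>"
  using sets_eq_imp_space_eq[OF sets_\<gamma>] by simp

lemma measurable_\<gamma>: "f \<in> measurable (borel_of (loop_top \<beta>)) N \<Longrightarrow> f \<in> measurable \<gamma> N"
  using measurable_cong_sets[OF sets_\<gamma> refl] by blast

lemma inclusion_measurable: "(\<lambda>\<omega>. \<omega>) \<in> measurable \<gamma> (L2_borel \<beta>)"
  using beta by (intro measurable_\<gamma> loop_inclusion_measurable) simp

lemma L2_inner_measurable_\<gamma>: "h \<in> L2 \<beta> \<Longrightarrow> L2_inner \<beta> h \<in> borel_measurable \<gamma>"
  using measurable_compose[OF inclusion_measurable L2_inner_measurable] by simp

sublocale prob_space \<gamma>
proof
  have "prob_space (distr \<gamma> (L2_borel \<beta>) (\<lambda>\<omega>. \<omega>))"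
    using gauss by (simp add: loop_gaussian_def centered_gaussian_L2_def)
  then have "emeasure (distr \<gamma> (L2_borel \<beta>) (\<lambda>\<omega>. \<omega>)) (L2 \<beta>) = 1"
    using prob_space.emeasure_space_1 by (metis space_L2_borel space_distr)
  moreover have "L2 \<beta> \<in> sets (L2_borel \<beta>)" by (metis sets.top space_L2_borel)
  moreover have "(\<lambda>\<omega>. \<omega>) -` L2 \<beta> \<inter> space \<gamma> = space \<gamma>"
    by (auto simp: space_\<gamma> loop_in_L2)
  ultimately show "emeasure \<gamma> (space \<gamma>) = 1"
    by (simp add: emeasure_distr[OF inclusion_measurable])
qed

definition form :: "(real \<Rightarrow> real) \<Rightarrow> real" where
  "form h = L2_inner \<beta> h (loop_covariance \<beta> m h)"

lemma form_nonneg: "h \<in> L2 \<beta> \<Longrightarrow> form h \<ge> 0"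
  unfolding form_def covariance_quadratic_form(2)[OF beta m]
  by (rule suminf_nonneg[OF covariance_quadratic_form(1)[OF beta m]]) (use m in auto)

lemma form_cmult: "form (\<lambda>\<tau>. c * h \<tau>) = c\<^sup>2 * form h"
proof -
  have "loop_covariance \<beta> m (\<lambda>\<tau>. c * h \<tau>) = (\<lambda>\<tau>. c * loop_covariance \<beta> m h \<tau>)"
  proof
    fix \<tau>
    show "loop_covariance \<beta> m (\<lambda>\<tau>. c * h \<tau>) \<tau> = c * loop_covariance \<beta> m h \<tau>"
      unfolding loop_covariance_def L2_inner_cmult_right
      by (subst infsum_cmult_right'[symmetric]) (simp add: mult_ac)
  qed
  then show ?thesis
    by (simp add: form_def L2_inner_cmult_left L2_inner_cmult_right power2_eq_square mult.assoc)
qed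

text \<open>The characteristic functional at the multiple \<open>t\<close> of \<open>h\<close> is
  the characteristic function of the pairing at \<open>t\<close>, so uniqueness applies. Writing the
  normal law as a scaled standard one also covers the degenerate case of variance 0.\<close>

lemma law_L2_inner:
  assumes h: "h \<in> L2 \<beta>"
  shows "distr \<gamma> borel (L2_inner \<beta> h) = distr std_normal_distribution borel (\<lambda>x. sqrt (form h) * x)"
proof (rule Levy_uniqueness)
  interpret N: real_distribution std_normal_distribution by (rule real_dist_normal_dist)
  show "real_distribution (distr \<gamma> borel (L2_inner \<beta> h))"
    using L2_inner_measurable_\<gamma>[OF h] by (rule real_distribution_distr)
  show "real_distribution (distr std_normal_distribution borel (\<lambda>x. sqrt (form h) * x))"
    by (rule N.real_distribution_distr) simp
  show "char (distr \<gamma> borel (L2_inner \<beta> h)) = char (distr std_normal_distribution borel (\<lambda>x. sqrt (form h) * x))"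
  proof
    fix t
    have th: "(\<lambda>\<tau>. t * h \<tau>) \<in> L2 \<beta>" using h by (rule L2_cmult)
    have "char (distr \<gamma> borel (L2_inner \<beta> h)) t = (CLINT \<omega>|\<gamma>. iexp (t * L2_inner \<beta> h \<omega>))"
      unfolding char_def by (rule integral_distr[OF L2_inner_measurable_\<gamma>[OF h]]) simp
    also have "\<dots> = (CLINT \<omega>|\<gamma>. iexp (L2_inner \<beta> (\<lambda>\<tau>. t * h \<tau>) \<omega>))"
      by (simp add: L2_inner_cmult_left)
    also have "\<dots> = (CLINT \<omega>|distr \<gamma> (L2_borel \<beta>) (\<lambda>\<omega>. \<omega>). iexp (L2_inner \<beta> (\<lambda>\<tau>. t * h \<tau>) \<omega>))"
      by (rule integral_distr[OF inclusion_measurable, symmetric])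
        (use L2_inner_measurable[OF th] in measurable)
    also have "\<dots> = complex_of_real (exp (- form (\<lambda>\<tau>. t * h \<tau>) / 2))"
      using gauss th unfolding loop_gaussian_def centered_gaussian_L2_def form_def by blast
    also have "\<dots> = complex_of_real (exp (- (t * sqrt (form h))\<^sup>2 / 2))"
      using form_nonneg[OF h] by (simp add: form_cmult power_mult_distrib)
    also have "\<dots> = char std_normal_distribution (t * sqrt (form h))"
      by (simp add: char_std_normal_distribution)
    also have "\<dots> = char (distr std_normal_distribution borel (\<lambda>x. sqrt (form h) * x)) t"
      unfolding char_def by (subst integral_distr) (simp_all add: mult.assoc)
    finally show "char (distr \<gamma> borel (L2_inner \<beta> h)) t = char (distr std_normal_distribution borel (\<lambda>x. sqrt (form h) * x)) t" .
  qed
qed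

text \<open>Dividing by \<open>4 * S\<close> leaves at most half of the critical exponent of the
  standard normal law, and the resulting moment \<open>sqrt 2\<close> is rounded up to 2.\<close>

lemma nn_integral_exp_L2_inner_le_2:
  assumes h: "h \<in> L2 \<beta>" and S: "form h \<le> S" "S > 0"
  shows "(\<integral>\<^sup>+\<omega>. ennreal (exp ((L2_inner \<beta> h \<omega>)\<^sup>2 / (4 * S))) \<partial>\<gamma>) \<le> 2"
proof -
  have "(\<integral>\<^sup>+\<omega>. ennreal (exp ((L2_inner \<beta> h \<omega>)\<^sup>2 / (4 * S))) \<partial>\<gamma>) =
     (\<integral>\<^sup>+y. ennreal (exp (y\<^sup>2 / (4 * S))) \<partial>distr \<gamma> borel (L2_inner \<beta> h))"
    by (subst nn_integral_distr[OF L2_inner_measurable_\<gamma>[OF h]]) simp_all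
  also have "\<dots> = (\<integral>\<^sup>+x. ennreal (exp ((sqrt (form h) * x)\<^sup>2 / (4 * S))) \<partial>std_normal_distribution)"
    unfolding law_L2_inner[OF h] by (subst nn_integral_distr) simp_all
  also have "\<dots> \<le> (\<integral>\<^sup>+x. ennreal (exp (1 / 2 * x\<^sup>2 / 2)) \<partial>std_normal_distribution)"
  proof (intro nn_integral_mono ennreal_leI, unfold exp_le_cancel_iff)
    fix x :: real
    have "form h * x\<^sup>2 \<le> S * x\<^sup>2" using S by (intro mult_right_mono) auto
    then show "(sqrt (form h) * x)\<^sup>2 / (4 * S) \<le> 1 / 2 * x\<^sup>2 / 2"
      using S form_nonneg[OF h] by (simp add: power_mult_distrib field_simps)
  qed
  also have "\<dots> = ennreal (1 / sqrt (1 - 1 / 2))" by (rule nn_integral_exp_square_std_normal) simp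
  also have "\<dots> \<le> ennreal 2"
    by (intro ennreal_leI) (simp add: real_sqrt_divide real_le_lsqrt)
  finally show ?thesis by simp
qed

text \<open>An upper bound for the variance of the increment, not the variance itself.\<close>

definition increment_var :: "real \<Rightarrow> real \<Rightarrow> real" where
  "increment_var t s = increment_const \<beta> * sqrt \<bar>t - s\<bar> / m"

lemma increment_var_pos: "t \<noteq> s \<Longrightarrow> increment_var t s > 0"
  using increment_const_pos[OF beta] m by (simp add: increment_var_def)

lemma eval_measurable: "t \<in> {0..\<beta>} \<Longrightarrow> (\<lambda>\<omega>. \<omega> t) \<in> borel_measurable \<gamma>"
  by (intro measurable_\<gamma> continuous_map_imp_borel_measurable continuous_map_loop_eval)

text \<open>Fatou's lemma along the averaging kernels, whose exponential moments are at most 2 for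
  all large \<open>N\<close>. The times lie strictly below \<open>\<beta>\<close> so that the right
  averages fit, and differ so that the variance bound in the denominator is positive.\<close>

lemma nn_integral_exp_increment_le_2:
  assumes "0 \<le> t" "t < \<beta>" "0 \<le> s" "s < \<beta>" "t \<noteq> s"
  shows "(\<integral>\<^sup>+\<omega>. ennreal (exp ((\<omega> t - \<omega> s)\<^sup>2 / (4 * increment_var t s))) \<partial>\<gamma>) \<le> 2"
proof -
  let ?S = "increment_var t s"
  let ?g = "\<lambda>N \<omega>. ennreal (exp ((L2_inner \<beta> (increment_kernel t s N) \<omega>)\<^sup>2 / (4 * ?S)))"
  have [measurable]: "L2_inner \<beta> (increment_kernel t s N) \<in> borel_measurable \<gamma>" for N
    by (intro L2_inner_measurable_\<gamma> increment_kernel_L2)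
  have "(\<integral>\<^sup>+\<omega>. ennreal (exp ((\<omega> t - \<omega> s)\<^sup>2 / (4 * ?S))) \<partial>\<gamma>) = (\<integral>\<^sup>+\<omega>. liminf (\<lambda>N. ?g N \<omega>) \<partial>\<gamma>)"
  proof (rule nn_integral_cong)
    fix \<omega> assume "\<omega> \<in> space \<gamma>"
    then have "(\<lambda>N. L2_inner \<beta> (increment_kernel t s N) \<omega>) \<longlonglongrightarrow> \<omega> t - \<omega> s"
      using assms by (intro L2_inner_increment_kernel_tendsto) (auto simp: space_\<gamma>)
    then have "(\<lambda>N. ?g N \<omega>) \<longlonglongrightarrow> ennreal (exp ((\<omega> t - \<omega> s)\<^sup>2 / (4 * ?S)))"
      using increment_var_pos[OF assms(5)] by (intro tendsto_intros) auto
    then show "ennreal (exp ((\<omega> t - \<omega> s)\<^sup>2 / (4 * ?S))) = liminf (\<lambda>N. ?g N \<omega>)"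
      by (intro lim_imp_Liminf[symmetric]) auto
  qed
  also have "\<dots> \<le> liminf (\<lambda>N. \<integral>\<^sup>+\<omega>. ?g N \<omega> \<partial>\<gamma>)"
    by (rule nn_integral_liminf) measurable
  also have "\<dots> \<le> 2"
  proof (rule Liminf_le)
    have "eventually (\<lambda>N. N > 0) sequentially" by (rule eventually_gt_at_top)
    with eventually_subinterval[OF assms(1,2)] eventually_subinterval[OF assms(3,4)]
    show "eventually (\<lambda>N. (\<integral>\<^sup>+\<omega>. ?g N \<omega> \<partial>\<gamma>) \<le> 2) sequentially"
    proof eventually_elim
      case (elim N)
      then have "form (increment_kernel t s N) \<le> ?S"
        unfolding form_def increment_var_def by (intro increment_variance_le beta m)
      then show ?case
        by (rule nn_integral_exp_L2_inner_le_2[OF increment_kernel_L2 _ increment_var_pos[OF assms(5)]])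
    qed
  qed simp
  finally show ?thesis .
qed

end

section \<open>Fluctuations of a loop around its mean\<close>

text \<open>The budget of the chaining: the prefactor 1/16 is 1 minus the ratio 15/16, so that the
  allowed steps of all levels add up to at most \<open>\<delta>\<close>.\<close>

lemma sum_chain_steps_le: "(\<Sum>i\<le>n. \<delta> / 16 * (15 / 16) ^ i) \<le> \<delta>" if "\<delta> \<ge> 0" for \<delta> :: real
proof -
  have "(\<Sum>i\<le>n. \<delta> / 16 * (15 / 16) ^ i) = \<delta> * (1 - (15 / 16) ^ Suc n)"
    by (induction n) (simp_all add: field_simps)
  also have "\<dots> \<le> \<delta>" using that by (simp add: mult_left_le)
  finally show ?thesis .
qed

text \<open>A dyadic point of level \<open>n + 1\<close> either belongs to level \<open>n\<close> or
  is the right neighbour of such a point, so each level costs at most one step, from an even index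
  to the next odd one.\<close>

lemma dyadic_chaining:
  fixes f :: "real \<Rightarrow> real"
  assumes \<delta>: "\<delta> \<ge> 0"
    and step: "\<And>n j. 2 * j + 1 < (2::nat) ^ Suc n \<Longrightarrow>
      \<bar>f (real (2 * j + 1) * \<beta> / 2 ^ Suc n) - f (real (2 * j) * \<beta> / 2 ^ Suc n)\<bar> \<le> \<delta> / 16 * (15 / 16) ^ Suc n"
    and k: "k < 2 ^ n"
  shows "\<bar>f (real k * \<beta> / 2 ^ n) - f 0\<bar> \<le> \<delta>"
proof -
  have "\<bar>f (real k * \<beta> / 2 ^ n) - f 0\<bar> \<le> (\<Sum>i\<le>n. \<delta> / 16 * (15 / 16) ^ i)"
    using k
  proof (induction n arbitrary: k)
    case 0
    then show ?case using \<delta> by simp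
  next
    case (Suc n)
    define j where "j = k div 2"
    have "j < 2 ^ n" using Suc.prems by (simp add: j_def)
    have eq: "real (2 * j) * \<beta> / 2 ^ Suc n = real j * \<beta> / 2 ^ n" by simp
    have IH: "\<bar>f (real (2 * j) * \<beta> / 2 ^ Suc n) - f 0\<bar> \<le> (\<Sum>i\<le>n. \<delta> / 16 * (15 / 16) ^ i)"
      unfolding eq using Suc.IH[OF \<open>j < 2 ^ n\<close>] .
    have nn: "0 \<le> \<delta> / 16 * (15 / 16) ^ Suc n" using \<delta> by simp
    have "k = 2 * j \<or> k = 2 * j + 1" unfolding j_def by linarith
    then show ?case
    proof
      assume "k = 2 * j"
      then show ?thesis using IH nn by (simp only: sum.atMost_Suc)
    next
      assume k: "k = 2 * j + 1"
      have "\<bar>f (real k * \<beta> / 2 ^ Suc n) - f (real (2 * j) * \<beta> / 2 ^ Suc n)\<bar> \<le> \<delta> / 16 * (15 / 16) ^ Suc n"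
        using step[of j n] Suc.prems unfolding k by blast
      then show ?thesis using IH unfolding sum.atMost_Suc by linarith
    qed
  qed
  also have "\<dots> \<le> \<delta>" using sum_chain_steps_le[OF \<delta>] .
  finally show ?thesis .
qed

lemma floor_grid_le:
  assumes "0 \<le> t" "0 < x" shows "real (nat \<lfloor>t * x\<rfloor>) / x \<le> t"
proof -
  have "0 \<le> t * x" using assms by simp
  then have "real (nat \<lfloor>t * x\<rfloor>) \<le> t * x" by linarith
  then show ?thesis using assms by (simp add: divide_le_eq)
qed

lemma floor_grid_tendsto:
  assumes "0 \<le> t" "\<And>n. 0 < a n" "filterlim a at_top sequentially"
  shows "(\<lambda>n. real (nat \<lfloor>t * a n\<rfloor>) / a n) \<longlonglongrightarrow> t"
proof (rule tendsto_sandwich)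
  have "(\<lambda>n. t - 1 / a n) \<longlonglongrightarrow> t - 0"
    by (intro tendsto_diff tendsto_const tendsto_divide_0[OF tendsto_const] filterlim_at_top_imp_at_infinity assms)
  then show "(\<lambda>n. t - 1 / a n) \<longlonglongrightarrow> t" by simp
  have "t - 1 / a n \<le> real (nat \<lfloor>t * a n\<rfloor>) / a n" for n
  proof -
    have "t * a n - 1 \<le> real (nat \<lfloor>t * a n\<rfloor>)" by linarith
    then have "(t * a n - 1) / a n \<le> real (nat \<lfloor>t * a n\<rfloor>) / a n"
      using assms(2)[of n] by (intro divide_right_mono) auto
    then show ?thesis using assms(2)[of n] by (simp add: diff_divide_distrib)
  qed
  then show "eventually (\<lambda>n. t - 1 / a n \<le> real (nat \<lfloor>t * a n\<rfloor>) / a n) sequentially"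
    by (rule always_eventually[OF allI])
  show "eventually (\<lambda>n. real (nat \<lfloor>t * a n\<rfloor>) / a n \<le> t) sequentially"
    by (intro always_eventually allI floor_grid_le assms)
qed simp

lemma pow2_at_top: "filterlim (\<lambda>n. 2 ^ n :: real) at_top sequentially"
  using filterlim_realpow_sequentially_gt1[of "2::real"] by (simp add: filterlim_at_infinity_imp_filterlim_at_top)

text \<open>Dyadic approximation from below together with continuity. The dyadic points stay below
  \<open>\<beta>\<close>; the endpoint itself is covered by periodicity.\<close>

lemma loop_bound_of_dyadic:
  assumes f: "f \<in> loops \<beta>" and "\<beta> > 0"
    and dy: "\<And>n k. k < (2::nat) ^ n \<Longrightarrow> \<bar>f (real k * \<beta> / 2 ^ n) - f 0\<bar> \<le> \<delta>"
    and t: "t \<in> {0..\<beta>}"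
  shows "\<bar>f t - f 0\<bar> \<le> \<delta>"
proof (cases "t = \<beta>")
  case True
  then show ?thesis using f dy[of 0 0] by (simp add: topspace_loop_top)
next
  case False
  let ?k = "\<lambda>n::nat. nat \<lfloor>t / \<beta> * 2 ^ n\<rfloor>"
  define u where "u n = real (?k n) * \<beta> / 2 ^ n" for n :: nat
  have c: "continuous_on {0..\<beta>} f" using f by (simp add: topspace_loop_top)
  have fl: "real (?k n) / 2 ^ n \<le> t / \<beta>" for n using t by (intro floor_grid_le) auto
  have "(\<lambda>n. \<beta> * (real (?k n) / 2 ^ n)) \<longlonglongrightarrow> \<beta> * (t / \<beta>)"
    using t by (intro tendsto_mult_left floor_grid_tendsto pow2_at_top) auto
  then have "u \<longlonglongrightarrow> t" using assms(2) by (simp add: u_def[abs_def] mult.commute)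
  moreover have "u n \<in> {0..\<beta>}" for n
  proof -
    have "\<beta> * (real (?k n) / 2 ^ n) \<le> \<beta> * (t / \<beta>)" using assms(2) by (intro mult_left_mono fl) auto
    then show ?thesis using t assms(2) by (auto simp: u_def mult.commute)
  qed
  ultimately have "(\<lambda>n. f (u n)) \<longlonglongrightarrow> f t"
    using continuous_on_tendsto_compose[OF c _ t, of u sequentially] by (auto intro!: always_eventually)
  then have "(\<lambda>n. \<bar>f (u n) - f 0\<bar>) \<longlonglongrightarrow> \<bar>f t - f 0\<bar>" by (intro tendsto_intros)
  moreover have "\<bar>f (u n) - f 0\<bar> \<le> \<delta>" for n
    unfolding u_def
  proof (rule dy)
    have "t / \<beta> < 1" using t False assms(2) by simp
    then have "real (?k n) / 2 ^ n < 1" using fl[of n] by linarith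
    then have "real (?k n) < real (2 ^ n)" by (simp add: divide_less_eq)
    then show "?k n < 2 ^ n" by (rule of_nat_less_imp_less)
  qed
  ultimately show ?thesis by (intro LIMSEQ_le_const2) auto
qed

text \<open>Written as a pairing with a constant so that the Gaussian law of \<open>L2_inner\<close>
  applies directly.\<close>

definition loop_mean :: "real \<Rightarrow> (real \<Rightarrow> real) \<Rightarrow> real" where
  "loop_mean \<beta> = L2_inner \<beta> (\<lambda>_. 1 / \<beta>)"

lemma loop_mean_eq: "loop_mean \<beta> f = (LINT \<tau>:{0..\<beta>}|lborel. f \<tau>) / \<beta>"
  by (simp add: loop_mean_def L2_inner_def)

definition loop_sq :: "real \<Rightarrow> (real \<Rightarrow> real) \<Rightarrow> real" where
  "loop_sq \<beta> f = (LINT \<tau>:{0..\<beta>}|lborel. (f \<tau>)\<^sup>2)"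

lemma loop_sq_nonneg: "loop_sq \<beta> f \<ge> 0"
  by (simp add: loop_sq_def set_lebesgue_integral_def)

text \<open>The parallel axis identity. It yields the two comparisons of \<open>loop_sq\<close> with
  the average, and later the measurability of the fluctuation integral.\<close>

lemma loop_sq_shift:
  assumes f: "f \<in> loops \<beta>" and "\<beta> > 0"
  shows "(LINT \<tau>:{0..\<beta>}|lborel. (f \<tau> - c)\<^sup>2) = loop_sq \<beta> f - 2 * c * \<beta> * loop_mean \<beta> f + c\<^sup>2 * \<beta>"
proof -
  have i: "set_integrable lborel {0..\<beta>} (\<lambda>\<tau>. (f \<tau>)\<^sup>2)" "set_integrable lborel {0..\<beta>} (\<lambda>\<tau>. 2 * c * f \<tau>)"
     "set_integrable lborel {0..\<beta>} (\<lambda>\<tau>. c\<^sup>2)"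
    using f by (auto simp: topspace_loop_top intro!: borel_integrable_atLeastAtMost' continuous_intros)
  have eq: "(f \<tau> - c)\<^sup>2 = (f \<tau>)\<^sup>2 - 2 * c * f \<tau> + c\<^sup>2" for \<tau>
    by (simp add: power2_diff)
  have "(LINT \<tau>:{0..\<beta>}|lborel. (f \<tau> - c)\<^sup>2) = (LINT \<tau>:{0..\<beta>}|lborel. (f \<tau>)\<^sup>2) - (LINT \<tau>:{0..\<beta>}|lborel. 2 * c * f \<tau>)
     + (LINT \<tau>:{0..\<beta>}|lborel. c\<^sup>2)"
    unfolding eq
    by (subst set_integral_add(2)[OF set_integral_diff(1)[OF i(1,2)] i(3)], subst set_integral_diff(2)[OF i(1,2)]) simp
  also have "(LINT \<tau>:{0..\<beta>}|lborel. 2 * c * f \<tau>) = 2 * c * \<beta> * loop_mean \<beta> f"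
    using assms(2) by (simp add: loop_mean_eq)
  also have "(LINT \<tau>:{0..\<beta>}|lborel. c\<^sup>2) = c\<^sup>2 * \<beta>"
    using assms(2) by (simp add: set_lebesgue_integral_def)
  finally show ?thesis by (simp add: loop_sq_def)
qed

text \<open>The two sides differ by \<open>\<beta> * (loop_mean \<beta> f - c)^2\<close>. The centre
  \<open>c\<close> is left free because it will be the value at time 0, from which the increments
  are measured.\<close>

lemma loop_sq_le:
  assumes "f \<in> loops \<beta>" "\<beta> > 0"
  shows "loop_sq \<beta> f \<le> \<beta> * (loop_mean \<beta> f)\<^sup>2 + (LINT \<tau>:{0..\<beta>}|lborel. (f \<tau> - c)\<^sup>2)"
proof -
  have "0 \<le> \<beta> * (loop_mean \<beta> f - c)\<^sup>2" using assms(2) by simp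
  then show ?thesis unfolding loop_sq_shift[OF assms] by (simp add: power2_diff algebra_simps)
qed

lemma loop_mean_sq_le:
  assumes "f \<in> loops \<beta>" "\<beta> > 0"
  shows "\<beta> * (loop_mean \<beta> f)\<^sup>2 \<le> loop_sq \<beta> f"
proof -
  have "0 \<le> (LINT \<tau>:{0..\<beta>}|lborel. (f \<tau> - loop_mean \<beta> f)\<^sup>2)" by (simp add: set_lebesgue_integral_def)
  then show ?thesis unfolding loop_sq_shift[OF assms] by (simp add: power2_eq_square algebra_simps)
qed

text \<open>Jensen's inequality for the uniform distribution on the interval. It moves the
  exponential inside the time integral, after which each single time can be treated by the increment
  bound.\<close>

lemma exp_set_integral_le:
  assumes f: "continuous_on {0..\<beta>} f" and "\<beta> > 0"
  shows "ennreal (exp (LINT \<tau>:{0..\<beta>}|lborel. f \<tau>)) \<le>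
    (\<integral>\<^sup>+\<tau>. ennreal (1 / \<beta> * exp (\<beta> * f \<tau>)) * indicator {0..\<beta>} \<tau> \<partial>lborel)"
proof -
  let ?y = "LINT \<tau>:{0..\<beta>}|lborel. f \<tau>"
  have i: "set_integrable lborel {0..\<beta>} f" "set_integrable lborel {0..\<beta>} (\<lambda>\<tau>. 1 / \<beta> * exp (\<beta> * f \<tau>))"
     "set_integrable lborel {0..\<beta>} (\<lambda>_. 1 / \<beta> * exp ?y * (1 - ?y))" "set_integrable lborel {0..\<beta>} (\<lambda>\<tau>. exp ?y * f \<tau>)"
    using f assms(2) by (auto intro!: borel_integrable_atLeastAtMost' continuous_intros)
  \<comment> \<open>This is the tangent of the exponential at \<open>?y\<close>, divided by
    \<open>\<beta>\<close>; its integral over the interval is exactly \<open>exp ?y\<close>.\<close>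
  have tangent: "1 / \<beta> * exp ?y * (1 - ?y) + exp ?y * f \<tau> \<le> 1 / \<beta> * exp (\<beta> * f \<tau>)" for \<tau>
  proof -
    have "1 + (\<beta> * f \<tau> - ?y) \<le> exp (\<beta> * f \<tau> - ?y)" by (rule exp_ge_add_one_self)
    then have "1 / \<beta> * (exp ?y * (1 + (\<beta> * f \<tau> - ?y))) \<le> 1 / \<beta> * (exp ?y * exp (\<beta> * f \<tau> - ?y))"
      using assms(2) by (intro mult_left_mono) auto
    moreover have "exp ?y * exp (\<beta> * f \<tau> - ?y) = exp (\<beta> * f \<tau>)" by (simp add: exp_add[symmetric])
    ultimately show ?thesis using assms(2) by (simp add: field_simps)
  qed
  have "exp ?y = (LINT \<tau>:{0..\<beta>}|lborel. 1 / \<beta> * exp ?y * (1 - ?y)) + (LINT \<tau>:{0..\<beta>}|lborel. exp ?y * f \<tau>)"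
  proof -
    have "(LINT \<tau>:{0..\<beta>}|lborel. c) = \<beta> * c" for c :: real
      using assms(2) by (simp add: set_lebesgue_integral_def)
    then show ?thesis using assms(2) by (simp add: algebra_simps diff_divide_distrib)
  qed
  also have "\<dots> = (LINT \<tau>:{0..\<beta>}|lborel. 1 / \<beta> * exp ?y * (1 - ?y) + exp ?y * f \<tau>)"
    by (rule set_integral_add(2)[OF i(3,4), symmetric])
  also have "\<dots> \<le> (LINT \<tau>:{0..\<beta>}|lborel. 1 / \<beta> * exp (\<beta> * f \<tau>))"
    by (rule set_integral_mono[OF set_integral_add(1)[OF i(3,4)] i(2)]) (rule tangent)
  finally have "ennreal (exp ?y) \<le> ennreal (\<integral>\<tau>. indicat_real {0..\<beta>} \<tau> *\<^sub>R (1 / \<beta> * exp (\<beta> * f \<tau>)) \<partial>lborel)"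
    unfolding set_lebesgue_integral_def[of _ _ "\<lambda>\<tau>. 1 / \<beta> * exp (\<beta> * f \<tau>)"] by (rule ennreal_leI)
  also have "\<dots> = (\<integral>\<^sup>+\<tau>. ennreal (indicat_real {0..\<beta>} \<tau> *\<^sub>R (1 / \<beta> * exp (\<beta> * f \<tau>))) \<partial>lborel)"
    using i(2) assms(2) unfolding set_integrable_def by (intro nn_integral_eq_integral[symmetric]) auto
  also have "\<dots> = (\<integral>\<^sup>+\<tau>. ennreal (1 / \<beta> * exp (\<beta> * f \<tau>)) * indicator {0..\<beta>} \<tau> \<partial>lborel)"
    by (intro nn_integral_cong) (auto simp: indicator_def)
  finally show ?thesis .
qed

lemma distr_std_normal_scale:
  assumes "\<beta> > 0"
  shows "distr std_normal_distribution borel (\<lambda>x. sqrt (1 / \<beta>) * x) =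
     density lborel (\<lambda>x. ennreal (sqrt (\<beta> / (2 * pi)) * exp (- \<beta> * x\<^sup>2 / 2)))"
proof -
  interpret N: prob_space std_normal_distribution by (rule prob_space_normal_density) simp
  have "distributed std_normal_distribution lborel (\<lambda>x. x) std_normal_density"
    by (simp add: distributed_def distr_id2)
  then have "distributed std_normal_distribution lborel (\<lambda>x. 0 + sqrt (1 / \<beta>) * x) (normal_density (0 + sqrt (1 / \<beta>) * 0) (\<bar>sqrt (1 / \<beta>)\<bar> * 1))"
    using assms by (intro N.normal_density_affine) auto
  then have "distr std_normal_distribution lborel (\<lambda>x. sqrt (1 / \<beta>) * x) = density lborel (normal_density 0 (sqrt (1 / \<beta>)))"
    using assms by (simp add: distributed_def)
  moreover have "normal_density 0 (sqrt (1 / \<beta>)) x = sqrt (\<beta> / (2 * pi)) * exp (- \<beta> * x\<^sup>2 / 2)" for x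
    using assms by (simp add: normal_density_def real_sqrt_divide real_sqrt_mult power_divide)
  moreover have "distr std_normal_distribution lborel (\<lambda>x. sqrt (1 / \<beta>) * x) = distr std_normal_distribution borel (\<lambda>x. sqrt (1 / \<beta>) * x)"
    by (rule distr_cong) auto
  ultimately show ?thesis by simp
qed

lemma emeasure_ge_exp_moment:
  assumes [measurable]: "u \<in> borel_measurable M"
    and B: "(\<integral>\<^sup>+x. ennreal (exp (u x)) \<partial>M) \<le> ennreal B" "B \<ge> 0"
  shows "emeasure M {x \<in> space M. z \<le> u x} \<le> ennreal (exp (- z) * B)"
proof -
  have "z \<le> u x \<longleftrightarrow> 1 \<le> ennreal (exp (- z)) * ennreal (exp (u x))" for x
    by (simp add: ennreal_mult'[symmetric] exp_add[symmetric])
  then have "emeasure M {x \<in> space M. z \<le> u x} \<le> ennreal (exp (- z)) * (\<integral>\<^sup>+x. ennreal (exp (u x)) * indicator (space M) x \<partial>M)"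
    by (simp only:) (rule nn_integral_Markov_inequality, measurable)
  also have "(\<integral>\<^sup>+x. ennreal (exp (u x)) * indicator (space M) x \<partial>M) = (\<integral>\<^sup>+x. ennreal (exp (u x)) \<partial>M)"
    by (rule nn_integral_cong) simp
  also have "ennreal (exp (- z)) * \<dots> \<le> ennreal (exp (- z)) * ennreal B" by (intro mult_left_mono B) simp
  also have "\<dots> = ennreal (exp (- z) * B)" using B(2) by (intro ennreal_mult[symmetric]) auto
  finally show ?thesis .
qed

section \<open>Tails of increments, rough loops, moments of average and fluctuation\<close>

context loop_gauss
begin

text \<open>The exponential tail is weakened to a fourth power. Since the variance bound scales like
  the square root of the time difference, its fourth power scales like the square, enough to sum
  over the \<open>2^n\<close> steps of every dyadic level.\<close>

lemma emeasure_increment_ge: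
  assumes "0 \<le> t" "t < \<beta>" "0 \<le> s" "s < \<beta>" "t \<noteq> s" "x > 0"
  shows "emeasure \<gamma> {\<omega> \<in> space \<gamma>. x \<le> \<bar>\<omega> t - \<omega> s\<bar>} \<le> ennreal (512 * (4 * increment_var t s / x\<^sup>2) ^ 4)"
proof -
  let ?S = "increment_var t s"
  have S: "?S > 0" by (rule increment_var_pos[OF assms(5)])
  have [measurable]: "(\<lambda>\<omega>. \<omega> t) \<in> borel_measurable \<gamma>" "(\<lambda>\<omega>. \<omega> s) \<in> borel_measurable \<gamma>"
    using assms by (auto intro: eval_measurable)
  define z where "z = x\<^sup>2 / (4 * ?S)"
  have z: "z > 0" using S assms(6) by (simp add: z_def)
  have "{\<omega> \<in> space \<gamma>. x \<le> \<bar>\<omega> t - \<omega> s\<bar>} \<subseteq> {\<omega> \<in> space \<gamma>. z \<le> (\<omega> t - \<omega> s)\<^sup>2 / (4 * ?S)}"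
  proof safe
    fix \<omega> assume "x \<le> \<bar>\<omega> t - \<omega> s\<bar>"
    then have "x\<^sup>2 \<le> (\<omega> t - \<omega> s)\<^sup>2" using assms(6) by (simp add: abs_le_square_iff[symmetric])
    then show "z \<le> (\<omega> t - \<omega> s)\<^sup>2 / (4 * ?S)" using S unfolding z_def by (intro divide_right_mono) auto
  qed
  then have "emeasure \<gamma> {\<omega> \<in> space \<gamma>. x \<le> \<bar>\<omega> t - \<omega> s\<bar>} \<le> emeasure \<gamma> {\<omega> \<in> space \<gamma>. z \<le> (\<omega> t - \<omega> s)\<^sup>2 / (4 * ?S)}"
    by (intro emeasure_mono) measurable
  also have "\<dots> \<le> ennreal (exp (- z) * 2)"
    using nn_integral_exp_increment_le_2[OF assms(1-5)] by (intro emeasure_ge_exp_moment) simp_all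
  also have "\<dots> \<le> ennreal (512 * (4 * ?S / x\<^sup>2) ^ 4)"
  proof (rule ennreal_leI)
    \<comment> \<open>The fourth power of this gives \<open>exp (- z) \<le> 256 / z^4\<close>, and
      the moment bound 2 doubles the constant to 512.\<close>
    have "z / 4 \<le> exp (z / 4)" using exp_ge_add_one_self[of "z / 4"] by linarith
    then have "(z / 4) ^ 4 \<le> exp (z / 4) ^ 4" using z by (intro power_mono) auto
    then have "z ^ 4 \<le> 256 * exp z" by (simp add: power_divide exp_of_nat_mult[symmetric])
    then have "exp (- z) \<le> 256 / z ^ 4" using z by (simp add: exp_minus field_simps)
    moreover have "4 * ?S / x\<^sup>2 = 1 / z" by (simp add: z_def)
    ultimately show "exp (- z) * 2 \<le> 512 * (4 * ?S / x\<^sup>2) ^ 4" by (simp add: power_one_over)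
  qed
  finally show ?thesis .
qed

text \<open>The event that one chaining step of level \<open>n + 1\<close> uses up its
  allowance.\<close>

definition rough_step :: "real \<Rightarrow> nat \<Rightarrow> nat \<Rightarrow> (real \<Rightarrow> real) set" where
  "rough_step \<delta> n j = {\<omega> \<in> space \<gamma>. \<delta> / 16 * (15 / 16) ^ Suc n \<le>
     \<bar>\<omega> (real (2 * j + 1) * \<beta> / 2 ^ Suc n) - \<omega> (real (2 * j) * \<beta> / 2 ^ Suc n)\<bar>}"

definition rough :: "real \<Rightarrow> (real \<Rightarrow> real) set" where
  "rough \<delta> = (\<Union>n. \<Union>j\<in>{..<2 ^ n}. rough_step \<delta> n j)"

lemma dyadic_point_less:
  assumes "j < 2 ^ n"
  shows "real (2 * j + 1) * \<beta> / 2 ^ Suc n < \<beta>" "real (2 * j) * \<beta> / 2 ^ Suc n < \<beta>"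
proof -
  have "2 * j + 1 < 2 ^ Suc n" using assms by simp
  then have "real (2 * j + 1) < 2 ^ Suc n" using of_nat_less_iff[of "2 * j + 1" "2 ^ Suc n", where 'a = real] by simp
  then have *: "real (2 * j + 1) * \<beta> < 2 ^ Suc n * \<beta>" using beta by (intro mult_strict_right_mono)
  then show "real (2 * j + 1) * \<beta> / 2 ^ Suc n < \<beta>" by (simp add: divide_less_eq mult.commute)
  have "real (2 * j) * \<beta> \<le> real (2 * j + 1) * \<beta>" using beta by (intro mult_right_mono) auto
  then have "real (2 * j) * \<beta> < 2 ^ Suc n * \<beta>" using * by linarith
  then show "real (2 * j) * \<beta> / 2 ^ Suc n < \<beta>" by (simp add: divide_less_eq mult.commute)
qed

lemma rough_step_measurable:
  assumes "j < 2 ^ n" shows "rough_step \<delta> n j \<in> sets \<gamma>"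
proof -
  have [measurable]: "(\<lambda>\<omega>. \<omega> (real (2 * j + 1) * \<beta> / 2 ^ Suc n)) \<in> borel_measurable \<gamma>"
    "(\<lambda>\<omega>. \<omega> (real (2 * j) * \<beta> / 2 ^ Suc n)) \<in> borel_measurable \<gamma>"
    using dyadic_point_less[OF assms] beta by (auto intro!: eval_measurable)
  show ?thesis unfolding rough_step_def by measurable
qed

lemma rough_measurable: "rough \<delta> \<in> sets \<gamma>"
  unfolding rough_def
  by (rule sets.countable_UN, rule image_subsetI, intro sets.finite_UN rough_step_measurable) simp_all

lemma not_rough_imp:
  assumes "\<omega> \<in> space \<gamma> - rough \<delta>" "\<delta> \<ge> 0" "t \<in> {0..\<beta>}"
  shows "\<bar>\<omega> t - \<omega> 0\<bar> \<le> \<delta>"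
proof (rule loop_bound_of_dyadic[OF _ beta _ assms(3)])
  show "\<omega> \<in> loops \<beta>" using assms(1) by (simp add: space_\<gamma>)
  fix n k assume k: "k < (2::nat) ^ n"
  show "\<bar>\<omega> (real k * \<beta> / 2 ^ n) - \<omega> 0\<bar> \<le> \<delta>"
  proof (rule dyadic_chaining[OF assms(2) _ k])
    fix n j assume "2 * j + 1 < (2::nat) ^ Suc n"
    then have "j < 2 ^ n" by simp
    then have "\<omega> \<notin> rough_step \<delta> n j" using assms(1) unfolding rough_def by blast
    then show "\<bar>\<omega> (real (2 * j + 1) * \<beta> / 2 ^ Suc n) - \<omega> (real (2 * j) * \<beta> / 2 ^ Suc n)\<bar> \<le> \<delta> / 16 * (15 / 16) ^ Suc n"
      using assms(1) by (simp add: rough_step_def)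
  qed
qed

end

text \<open>The ratio is below 1 because the thresholds decrease by 15/16, whose eighth power exceeds 1/2.\<close>

definition chain_const :: "real \<Rightarrow> real \<Rightarrow> real" where
  "chain_const \<beta> \<delta> = 131072 * increment_const \<beta> ^ 4 * \<beta>\<^sup>2 * (16 / \<delta>) ^ 8 * (\<Sum>n. (1 / (2 * (15 / 16) ^ 8)) ^ Suc n)"

lemma summable_chain_const: "summable (\<lambda>n. (1 / (2 * (15 / 16) ^ 8)) ^ Suc n :: real)"
  by (intro summable_ignore_initial_segment[of _ 1, simplified] summable_geometric) (simp add: power_divide)

lemma chain_const_nonneg:
  assumes "\<beta> > 0" "\<delta> > 0" shows "chain_const \<beta> \<delta> \<ge> 0"
proof -
  have "0 \<le> (\<Sum>n. (1 / (2 * (15 / 16) ^ 8)) ^ Suc n :: real)"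
    by (rule suminf_nonneg[OF summable_chain_const]) (rule zero_le_power, simp)
  then show ?thesis
    unfolding chain_const_def using assms increment_const_pos[OF assms(1)] by (intro mult_nonneg_nonneg) auto
qed

context loop_gauss
begin

text \<open>Union bound. The squared step length \<open>\<beta> / 2^(n+1)\<close> supplies two
  factors \<open>1 / 2^(n+1)\<close>: one pays for the \<open>2^n\<close> steps of the level, the
  other, against the eighth power of the shrinking threshold, forms the geometric ratio
  \<open>?r\<close>. The power \<open>m^4\<close> is that of the variance bound.\<close>

lemma emeasure_rough_le:
  assumes "\<delta> > 0"
  shows "emeasure \<gamma> (rough \<delta>) \<le> ennreal (chain_const \<beta> \<delta> / m ^ 4)"
proof -
  let ?r = "1 / (2 * (15 / 16) ^ 8) :: real"
  define K where "K = 131072 * increment_const \<beta> ^ 4 * \<beta>\<^sup>2 * (16 / \<delta>) ^ 8 / m ^ 4"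
  have "K \<ge> 0" using assms increment_const_pos[OF beta] by (simp add: K_def)
  have r0: "0 \<le> ?r" by simp
  have nn: "0 \<le> K * ?r ^ Suc n" for n
    by (rule mult_nonneg_nonneg[OF \<open>K \<ge> 0\<close> zero_le_power[OF r0]])
  note sr = summable_chain_const
  have A: "emeasure \<gamma> (rough_step \<delta> n j) \<le> ennreal (K * ?r ^ Suc n / 2 ^ Suc n)" if j: "j < 2 ^ n" for n j
  proof -
    let ?t = "real (2 * j + 1) * \<beta> / 2 ^ Suc n" and ?s = "real (2 * j) * \<beta> / 2 ^ Suc n" and ?x = "\<delta> / 16 * (15 / 16) ^ Suc n"
    have d: "?t - ?s = \<beta> / 2 ^ Suc n" by (simp add: field_simps)
    then have "?t \<noteq> ?s" using beta by (metis divide_eq_0_iff eq_iff_diff_eq_0 less_irrefl power_not_zero zero_neq_numeral)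
    moreover have "0 \<le> ?t" "0 \<le> ?s" using beta by simp_all
    ultimately have "emeasure \<gamma> (rough_step \<delta> n j) \<le> ennreal (512 * (4 * increment_var ?t ?s / ?x\<^sup>2) ^ 4)"
      unfolding rough_step_def using dyadic_point_less[OF j] assms by (intro emeasure_increment_ge) auto
    also have "512 * (4 * increment_var ?t ?s / ?x\<^sup>2) ^ 4 = K * ?r ^ Suc n / 2 ^ Suc n"
    proof -
      define M where "M = Suc n"
      have sq: "sqrt \<bar>?t - ?s\<bar> ^ 4 = (\<beta> / 2 ^ M)\<^sup>2"
      proof -
        have "sqrt \<bar>?t - ?s\<bar> ^ 4 = (sqrt \<bar>?t - ?s\<bar> ^ 2) ^ 2" by (simp only: power_mult[symmetric]) simp
        then show ?thesis unfolding d M_def using beta by simp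
      qed
      \<comment> \<open>The constant 131072 is 512 times the fourth power of 4.\<close>
      have 1: "512 * (4 * (C * q / m) / x\<^sup>2) ^ 4 = 131072 * C ^ 4 * q ^ 4 / m ^ 4 / x ^ 8" for C q x :: real
        by (simp add: power_mult_distrib power_divide power_mult[symmetric])
      have 2: "(a * b ^ M) ^ 8 = a ^ 8 * (b ^ 8) ^ M" for a b :: real
        by (simp only: power_mult_distrib power_mult[symmetric] mult.commute[of M])
      have 3: "A * (\<beta> / 2 ^ M)\<^sup>2 / m ^ 4 / (d ^ 8 * R ^ M) = A * \<beta>\<^sup>2 * (1 / d) ^ 8 / m ^ 4 * (1 / (2 * R)) ^ M / 2 ^ M"
        for A d R :: real
        by (simp add: power_divide power_mult_distrib power2_eq_square[of "2 ^ M"])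
      have "512 * (4 * increment_var ?t ?s / ?x\<^sup>2) ^ 4
        = 131072 * increment_const \<beta> ^ 4 * (\<beta> / 2 ^ M)\<^sup>2 / m ^ 4 / ((\<delta> / 16) ^ 8 * ((15 / 16) ^ 8) ^ M)"
        unfolding increment_var_def 1 sq unfolding M_def[symmetric] 2 ..
      also have "\<dots> = K * ?r ^ M / 2 ^ M"
        unfolding 3 K_def by simp
      finally show ?thesis by (simp only: M_def)
    qed
    finally show ?thesis .
  qed
  have "emeasure \<gamma> (rough \<delta>) \<le> (\<Sum>n. emeasure \<gamma> (\<Union>j\<in>{..<2 ^ n}. rough_step \<delta> n j))"
    unfolding rough_def
    by (intro emeasure_subadditive_countably image_subsetI sets.finite_UN rough_step_measurable) simp_all
  also have "\<dots> \<le> (\<Sum>n. ennreal (K * ?r ^ Suc n))"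
  proof (intro suminf_le summableI)
    fix n
    have "emeasure \<gamma> (\<Union>j\<in>{..<2 ^ n}. rough_step \<delta> n j) \<le> (\<Sum>j\<in>{..<2 ^ n}. emeasure \<gamma> (rough_step \<delta> n j))"
      by (intro emeasure_subadditive_finite image_subsetI rough_step_measurable) simp_all
    also have "\<dots> \<le> (\<Sum>j\<in>{..<2 ^ n :: nat}. ennreal (K * ?r ^ Suc n / 2 ^ Suc n))"
      by (intro sum_mono A) simp
    also have "\<dots> = ennreal (2 ^ n * (K * ?r ^ Suc n / 2 ^ Suc n))"
      using \<open>K \<ge> 0\<close> by (subst sum_ennreal) (simp_all del: power_Suc)
    also have "\<dots> \<le> ennreal (K * ?r ^ Suc n)"
    proof (rule ennreal_leI)
      have "2 ^ n * (y / 2 ^ Suc n) \<le> y" if "y \<ge> 0" for y :: real using that by simp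
      then show "2 ^ n * (K * ?r ^ Suc n / 2 ^ Suc n) \<le> K * ?r ^ Suc n" using nn .
    qed
    finally show "emeasure \<gamma> (\<Union>j\<in>{..<2 ^ n}. rough_step \<delta> n j) \<le> ennreal (K * ?r ^ Suc n)" .
  qed
  also have "\<dots> = ennreal (\<Sum>n. K * ?r ^ Suc n)"
    by (rule suminf_ennreal2[OF nn summable_mult[OF sr]])
  also have "(\<Sum>n. K * ?r ^ Suc n) = chain_const \<beta> \<delta> / m ^ 4"
    unfolding suminf_mult[OF sr] unfolding K_def chain_const_def times_divide_eq_left ..
  finally show ?thesis .
qed

lemma form_const: "form (\<lambda>_. 1 / \<beta>) = 1 / \<beta>"
proof -
  have L: "(\<lambda>_. 1 / \<beta>) \<in> L2 \<beta>" by (intro continuous_imp_L2 continuous_intros)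
  have a: "L2_inner \<beta> (trig_basis \<beta> n) (\<lambda>_. 1 / \<beta>) = 1 / \<beta> * L2_inner \<beta> (trig_basis \<beta> n) (\<lambda>_. 1)" for n
    using L2_inner_cmult_right[of \<beta> "trig_basis \<beta> n" "1 / \<beta>" "\<lambda>_. 1"] by simp
  have "L2_inner \<beta> (trig_basis \<beta> 0) (\<lambda>_. 1) = sqrt \<beta>"
    using beta by (simp add: L2_inner_def trig_basis_def set_lebesgue_integral_def real_div_sqrt)
  then have a0: "(L2_inner \<beta> (trig_basis \<beta> 0) (\<lambda>_. 1 / \<beta>))\<^sup>2 = 1 / \<beta>"
    unfolding a using beta by (simp add: power_divide power2_eq_square[of \<beta>])
  have "int_decode k \<noteq> 0" if "k \<noteq> 0" for k
    using that inj_int_decode[THEN injD, of k 0] by auto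
  then have "L2_inner \<beta> (trig_basis \<beta> (int_decode k)) (\<lambda>_. 1 / \<beta>) = 0" if "k \<notin> {0}" for k
    using that trig_basis_integral_eq_0[OF beta] unfolding a by simp
  then show ?thesis
    unfolding form_def covariance_quadratic_form(2)[OF beta m L]
    by (subst suminf_finite[of "{0}"]) (simp_all add: a0 freq_def)
qed

lemma loop_mean_measurable: "loop_mean \<beta> \<in> borel_measurable \<gamma>"
  unfolding loop_mean_def by (intro L2_inner_measurable_\<gamma> continuous_imp_L2 continuous_intros)

lemma law_loop_mean:
  "distr \<gamma> borel (loop_mean \<beta>) = density lborel (\<lambda>x. ennreal (sqrt (\<beta> / (2 * pi)) * exp (- \<beta> * x\<^sup>2 / 2)))"
proof -
  have L: "(\<lambda>_. 1 / \<beta>) \<in> L2 \<beta>" by (intro continuous_imp_L2 continuous_intros)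
  show ?thesis
    unfolding loop_mean_def law_L2_inner[OF L] form_const by (rule distr_std_normal_scale[OF beta])
qed

lemma nn_integral_exp_mean_sq:
  assumes "a < 1"
  shows "(\<integral>\<^sup>+\<omega>. ennreal (exp (a / 2 * (\<beta> * (loop_mean \<beta> \<omega>)\<^sup>2))) \<partial>\<gamma>) = ennreal (1 / sqrt (1 - a))"
proof -
  have "(\<integral>\<^sup>+\<omega>. ennreal (exp (a / 2 * (\<beta> * (loop_mean \<beta> \<omega>)\<^sup>2))) \<partial>\<gamma>) =
     (\<integral>\<^sup>+y. ennreal (exp (a / 2 * (\<beta> * y\<^sup>2))) \<partial>distr \<gamma> borel (loop_mean \<beta>))"
    by (subst nn_integral_distr[OF loop_mean_measurable]) simp_all
  also have "\<dots> = (\<integral>\<^sup>+x. ennreal (exp (a / 2 * (\<beta> * (sqrt (1 / \<beta>) * x)\<^sup>2))) \<partial>std_normal_distribution)"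
    unfolding law_loop_mean distr_std_normal_scale[OF beta, symmetric] by (subst nn_integral_distr) simp_all
  also have "\<dots> = (\<integral>\<^sup>+x. ennreal (exp (a * x\<^sup>2 / 2)) \<partial>std_normal_distribution)"
    using beta by (simp add: power_mult_distrib)
  also have "\<dots> = ennreal (1 / sqrt (1 - a))" by (rule nn_integral_exp_square_std_normal[OF assms])
  finally show ?thesis .
qed

text \<open>Joint measurability, required for exchanging time and expectation: the time is rounded
  down to a grid, where evaluation is measurable index by index, and continuity of the loop gives
  the limit. Clamping extends evaluation to all real times, over which \<open>lborel\<close>
  ranges.\<close>

lemma joint_eval_measurable:
  "(\<lambda>(\<omega>, \<tau>). \<omega> (max 0 (min \<beta> \<tau>))) \<in> borel_measurable (\<gamma> \<Otimes>\<^sub>M lborel)"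
proof (rule borel_measurable_LIMSEQ_real)
  let ?c = "\<lambda>\<tau>::real. max 0 (min \<beta> \<tau>)"
  let ?k = "\<lambda>N (\<tau>::real). nat \<lfloor>?c \<tau> * real (Suc N)\<rfloor>"
  \<comment> \<open>The \<open>min\<close> is inactive at the index that actually occurs, but
    measurability is asked for every index \<open>i\<close>, including those whose grid point lies
    beyond \<open>\<beta>\<close>.\<close>
  show "(\<lambda>x. case x of (\<omega>, \<tau>) \<Rightarrow> \<omega> (min \<beta> (real (?k N \<tau>) / Suc N))) \<in> borel_measurable (\<gamma> \<Otimes>\<^sub>M lborel)" for N
  proof -
    have "(\<lambda>x. fst x (min \<beta> (real i / Suc N))) \<in> borel_measurable (\<gamma> \<Otimes>\<^sub>M lborel)" for i
      using beta by (intro measurable_compose[OF measurable_fst eval_measurable]) auto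
    moreover have "(\<lambda>x. ?k N (snd x)) \<in> measurable (\<gamma> \<Otimes>\<^sub>M lborel) (count_space UNIV)"
      by measurable
    ultimately have "(\<lambda>x. fst x (min \<beta> (real (?k N (snd x)) / Suc N))) \<in> borel_measurable (\<gamma> \<Otimes>\<^sub>M lborel)"
      by (rule measurable_compose_countable)
    then show ?thesis by (simp only: case_prod_beta)
  qed
  fix x :: "(real \<Rightarrow> real) \<times> real" assume "x \<in> space (\<gamma> \<Otimes>\<^sub>M lborel)"
  then obtain \<omega> \<tau> where x: "x = (\<omega>, \<tau>)" "\<omega> \<in> loops \<beta>" by (auto simp: space_pair_measure space_\<gamma>)
  have c: "continuous_on {0..\<beta>} \<omega>" using x by (simp add: topspace_loop_top)
  have t: "0 \<le> ?c \<tau>" "?c \<tau> \<le> \<beta>" using beta by auto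
  have up: "real (?k N \<tau>) / Suc N \<le> ?c \<tau>" for N using t by (intro floor_grid_le) auto
  have "(\<lambda>N. real (?k N \<tau>) / Suc N) \<longlonglongrightarrow> ?c \<tau>"
    using t by (intro floor_grid_tendsto filterlim_compose[OF filterlim_real_sequentially filterlim_Suc]) auto
  moreover have "real (?k N \<tau>) / Suc N \<in> {0..\<beta>}" for N using order_trans[OF up t(2)] by simp
  ultimately have "(\<lambda>N. \<omega> (real (?k N \<tau>) / Suc N)) \<longlonglongrightarrow> \<omega> (?c \<tau>)"
    using t by (intro continuous_on_tendsto_compose[OF c]) (simp_all add: always_eventually)
  moreover have "min \<beta> (real (?k N \<tau>) / Suc N) = real (?k N \<tau>) / Suc N" for N
    using up[of N] t by (intro min_absorb2) linarith
  ultimately show "(\<lambda>N. case x of (\<omega>, \<tau>) \<Rightarrow> \<omega> (min \<beta> (real (?k N \<tau>) / Suc N))) \<longlonglongrightarrow> (case x of (\<omega>, \<tau>) \<Rightarrow> \<omega> (?c \<tau>))"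
    by (simp only: x prod.case)
qed

text \<open>Jensen and Fubini reduce the claim to a single time \<open>\<tau>\<close>, where
  \<open>small\<close> makes \<open>\<beta> * \<kappa>\<close> at most
  \<open>1 / (4 * increment_var \<tau> 0)\<close>. Thus every coefficient \<open>\<kappa>\<close> is
  affordable once the mass is large.\<close>

lemma nn_integral_exp_fluctuation_le_2:
  assumes \<kappa>: "\<kappa> \<ge> 0" and small: "4 * \<kappa> * \<beta> * increment_const \<beta> * sqrt \<beta> \<le> m"
  shows "(\<integral>\<^sup>+\<omega>. ennreal (exp (\<kappa> * (LINT \<tau>:{0..\<beta>}|lborel. (\<omega> \<tau> - \<omega> 0)\<^sup>2))) \<partial>\<gamma>) \<le> 2"
proof -
  let ?w = "\<lambda>\<omega>. ennreal (exp (\<kappa> * (LINT \<tau>:{0..\<beta>}|lborel. (\<omega> \<tau> - \<omega> 0)\<^sup>2)))"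
  interpret P: pair_sigma_finite \<gamma> lborel ..
  let ?c = "\<lambda>\<tau>::real. max 0 (min \<beta> \<tau>)"
  let ?f = "\<lambda>(\<omega>, \<tau>). ennreal (1 / \<beta> * exp (\<beta> * (\<kappa> * (\<omega> (?c \<tau>) - \<omega> 0)\<^sup>2))) * indicator {0..\<beta>} \<tau>"
  have f: "?f \<in> borel_measurable (\<gamma> \<Otimes>\<^sub>M lborel)"
  proof -
    have [measurable]: "(\<lambda>x. fst x (?c (snd x))) \<in> borel_measurable (\<gamma> \<Otimes>\<^sub>M lborel)"
      using joint_eval_measurable unfolding case_prod_beta .
    have [measurable]: "(\<lambda>x. fst x 0) \<in> borel_measurable (\<gamma> \<Otimes>\<^sub>M lborel)"
      using beta by (intro measurable_compose[OF measurable_fst eval_measurable]) auto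
    show ?thesis unfolding case_prod_beta by measurable
  qed
  have "(\<integral>\<^sup>+\<omega>. ?w \<omega> \<partial>\<gamma>) \<le> (\<integral>\<^sup>+\<omega>. (\<integral>\<^sup>+\<tau>. ?f (\<omega>, \<tau>) \<partial>lborel) \<partial>\<gamma>)"
  proof (rule nn_integral_mono)
    fix \<omega> assume "\<omega> \<in> space \<gamma>"
    then have "continuous_on {0..\<beta>} (\<lambda>\<tau>. \<kappa> * (\<omega> \<tau> - \<omega> 0)\<^sup>2)"
      by (auto simp: space_\<gamma> topspace_loop_top intro!: continuous_intros)
    from exp_set_integral_le[OF this beta]
    have "?w \<omega>
      \<le> (\<integral>\<^sup>+\<tau>. ennreal (1 / \<beta> * exp (\<beta> * (\<kappa> * (\<omega> \<tau> - \<omega> 0)\<^sup>2))) * indicator {0..\<beta>} \<tau> \<partial>lborel)" by simp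
    also have "\<dots> = (\<integral>\<^sup>+\<tau>. ?f (\<omega>, \<tau>) \<partial>lborel)"
      by (intro nn_integral_cong) (auto simp: indicator_def)
    finally show "?w \<omega> \<le> (\<integral>\<^sup>+\<tau>. ?f (\<omega>, \<tau>) \<partial>lborel)" .
  qed
  also have "\<dots> = (\<integral>\<^sup>+\<tau>. (\<integral>\<^sup>+\<omega>. ?f (\<omega>, \<tau>) \<partial>\<gamma>) \<partial>lborel)" by (rule P.Fubini[OF f, symmetric])
  also have "\<dots> \<le> (\<integral>\<^sup>+\<tau>. ennreal (2 / \<beta>) * indicator {0..\<beta>} \<tau> \<partial>lborel)"
  proof (rule nn_integral_mono)
    fix \<tau> :: real
    let ?I = "\<integral>\<^sup>+\<omega>. ennreal (exp (\<beta> * (\<kappa> * (\<omega> \<tau> - \<omega> 0)\<^sup>2))) \<partial>\<gamma>"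
    have "?I \<le> 2" if \<tau>: "\<tau> \<in> {0..\<beta>}"
    proof (cases "\<tau> = 0 \<or> \<tau> = \<beta>")
      \<comment> \<open>At both endpoints the increment from time 0 vanishes, at
        \<open>\<beta>\<close> by periodicity; the increment bound covers only the times strictly
        between.\<close>
      case True
      then have "?I = (\<integral>\<^sup>+\<omega>. 1 \<partial>\<gamma>)"
        by (intro nn_integral_cong) (auto simp: space_\<gamma> topspace_loop_top)
      then show ?thesis by (simp add: emeasure_space_1)
    next
      case False
      then have t: "0 < \<tau>" "\<tau> < \<beta>" using \<tau> by auto
      have S: "increment_var \<tau> 0 > 0" using t by (intro increment_var_pos) simp
      have "4 * increment_var \<tau> 0 * (\<beta> * \<kappa>) \<le> 1"
      proof -
        have "increment_var \<tau> 0 \<le> increment_const \<beta> * sqrt \<beta> / m"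
          unfolding increment_var_def using t m increment_const_pos[OF beta]
          by (intro divide_right_mono mult_left_mono) auto
        then have "4 * increment_var \<tau> 0 * (\<beta> * \<kappa>) \<le> 4 * (increment_const \<beta> * sqrt \<beta> / m) * (\<beta> * \<kappa>)"
          using beta \<kappa> by (intro mult_right_mono mult_left_mono) auto
        also have "\<dots> = (4 * \<kappa> * \<beta> * increment_const \<beta> * sqrt \<beta>) / m" by simp
        also have "\<dots> \<le> 1" using small m by simp
        finally show ?thesis .
      qed
      then have bl: "\<beta> * \<kappa> \<le> 1 / (4 * increment_var \<tau> 0)" using S by (simp add: field_simps)
      have "?I
        \<le> (\<integral>\<^sup>+\<omega>. ennreal (exp ((\<omega> \<tau> - \<omega> 0)\<^sup>2 / (4 * increment_var \<tau> 0))) \<partial>\<gamma>)"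
      proof (intro nn_integral_mono ennreal_leI, unfold exp_le_cancel_iff)
        fix \<omega> :: "real \<Rightarrow> real"
        show "\<beta> * (\<kappa> * (\<omega> \<tau> - \<omega> 0)\<^sup>2) \<le> (\<omega> \<tau> - \<omega> 0)\<^sup>2 / (4 * increment_var \<tau> 0)"
          using mult_right_mono[OF bl, of "(\<omega> \<tau> - \<omega> 0)\<^sup>2"] by (simp add: mult.assoc)
      qed
      also have "\<dots> \<le> 2" using t by (intro nn_integral_exp_increment_le_2) auto
      finally show ?thesis .
    qed
    then have "ennreal (1 / \<beta>) * ?I \<le> ennreal (1 / \<beta>) * 2"
      if "\<tau> \<in> {0..\<beta>}" using that by (intro mult_left_mono) auto
    moreover have "ennreal (1 / \<beta>) * 2 = ennreal (2 / \<beta>)" using beta ennreal_mult[of "1 / \<beta>" 2] by simp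
    moreover have "(\<integral>\<^sup>+\<omega>. ?f (\<omega>, \<tau>) \<partial>\<gamma>) = ennreal (1 / \<beta>) * ?I"
      if \<tau>: "\<tau> \<in> {0..\<beta>}"
    proof -
      have [measurable]: "(\<lambda>\<omega>. \<omega> \<tau>) \<in> borel_measurable \<gamma>" "(\<lambda>\<omega>. \<omega> 0) \<in> borel_measurable \<gamma>"
        using \<tau> beta by (auto intro!: eval_measurable)
      have "(\<integral>\<^sup>+\<omega>. ?f (\<omega>, \<tau>) \<partial>\<gamma>) = (\<integral>\<^sup>+\<omega>. ennreal (1 / \<beta>) * ennreal (exp (\<beta> * (\<kappa> * (\<omega> \<tau> - \<omega> 0)\<^sup>2))) \<partial>\<gamma>)"
        using \<tau> beta by (intro nn_integral_cong) (simp add: ennreal_mult[symmetric])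
      then show ?thesis by (simp add: nn_integral_cmult)
    qed
    ultimately show "(\<integral>\<^sup>+\<omega>. ?f (\<omega>, \<tau>) \<partial>\<gamma>) \<le> ennreal (2 / \<beta>) * indicator {0..\<beta>} \<tau>"
      by (cases "\<tau> \<in> {0..\<beta>}") auto
  qed
  also have "\<dots> = 2"
    using beta by (simp add: nn_integral_cmult ennreal_mult[symmetric])
  finally show ?thesis .
qed

end

section \<open>The periodic energy\<close>

lemma finite_box_of: "finite (box_of k0 k1)"
proof -
  have "box_of k0 k1 \<subseteq> vec_lambda ` (PiE UNIV (\<lambda>l. {k0 $ l..k1 $ l}))"
  proof
    fix k assume "k \<in> box_of k0 k1"
    then have "vec_nth k \<in> PiE UNIV (\<lambda>l. {k0 $ l..k1 $ l})" by (auto simp: box_of_def)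
    then show "k \<in> vec_lambda ` (PiE UNIV (\<lambda>l. {k0 $ l..k1 $ l}))"
      by (metis (no_types, lifting) imageI vec_nth_inverse)
  qed
  then show ?thesis by (rule finite_subset) (intro finite_imageI finite_PiE, auto)
qed

lemma per_dist_commute: "per_dist k0 k1 j k = per_dist k0 k1 k j"
  by (simp add: per_dist_def abs_minus_commute)

text \<open>Reducing the displacement modulo the side lengths sends \<open>k\<close> to the lattice point at its
  periodic distance from \<open>j\<close>, and distinct points of the box to distinct points.\<close>

lemma sum_abs_per_dist_le:
  fixes k0 k1 j :: "int ^ 'd"
  assumes J: "((\<lambda>k :: int ^ 'd. \<bar>J (lattice_dist j k)\<bar>) has_sum c) UNIV" and j: "j \<in> box_of k0 k1"
  shows "(\<Sum>k\<in>box_of k0 k1. \<bar>J (per_dist k0 k1 j k)\<bar>) \<le> (c :: real)"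
proof -
  define N where "N l = k1 $ l - k0 $ l + 1" for l
  define red where "red l (d::int) = (if \<bar>d\<bar> \<le> N l - \<bar>d\<bar> then d else if d > 0 then d - N l else d + N l)" for l d
  define \<phi> where "\<phi> k = (\<chi> l. j $ l + red l (k $ l - j $ l))" for k
  have box: "\<bar>k $ l - j $ l\<bar> < N l" if "k \<in> box_of k0 k1" for k l
  proof -
    have "k0 $ l \<le> k $ l" "k $ l \<le> k1 $ l" "k0 $ l \<le> j $ l" "j $ l \<le> k1 $ l"
      using that j by (auto simp: box_of_def)
    then show ?thesis by (simp add: N_def)
  qed
  have "(j $ l - \<phi> k $ l)\<^sup>2 = (min \<bar>j $ l - k $ l\<bar> (k1 $ l - k0 $ l + 1 - \<bar>j $ l - k $ l\<bar>))\<^sup>2"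
    if "k \<in> box_of k0 k1" for k l
  proof -
    have "\<bar>j $ l - \<phi> k $ l\<bar> = \<bar>min \<bar>j $ l - k $ l\<bar> (k1 $ l - k0 $ l + 1 - \<bar>j $ l - k $ l\<bar>)\<bar>"
      using box[OF that, of l] unfolding \<phi>_def red_def N_def[symmetric] vec_lambda_beta min_def
      by (simp add: abs_if split: if_splits)
    then show ?thesis by (metis power2_abs)
  qed
  then have "of_int ((j $ l - \<phi> k $ l)\<^sup>2) = (of_int ((min \<bar>j $ l - k $ l\<bar> (k1 $ l - k0 $ l + 1 - \<bar>j $ l - k $ l\<bar>))\<^sup>2) :: real)"
    if "k \<in> box_of k0 k1" for k l using that by presburger
  then have dist: "lattice_dist j (\<phi> k) = per_dist k0 k1 j k" if "k \<in> box_of k0 k1" for k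
    using that unfolding lattice_dist_def per_dist_def of_int_power by simp
  have "inj_on \<phi> (box_of k0 k1)"
  proof (rule inj_onI)
    fix k k' assume k: "k \<in> box_of k0 k1" "k' \<in> box_of k0 k1" and eq: "\<phi> k = \<phi> k'"
    have "k $ l = k' $ l" for l
    proof -
      have "red l (k $ l - j $ l) = red l (k' $ l - j $ l)" using eq by (simp add: \<phi>_def vec_eq_iff)
      \<comment> \<open>Equal reductions make the displacements congruent modulo the side length;
        two points of the box are closer than that, so the displacements agree.\<close>
      moreover have "\<bar>k $ l - k' $ l\<bar> < N l"
        using k by (simp add: N_def box_of_def) (smt (verit))
      ultimately show ?thesis using box[OF k(1), of l] box[OF k(2), of l]
        unfolding red_def by (simp split: if_splits)
    qed
    then show "k = k'" by (simp add: vec_eq_iff)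
  qed
  then have "(\<Sum>k\<in>box_of k0 k1. \<bar>J (per_dist k0 k1 j k)\<bar>) = (\<Sum>k\<in>\<phi> ` box_of k0 k1. \<bar>J (lattice_dist j k)\<bar>)"
    by (subst sum.reindex) (simp_all add: dist)
  also have "\<dots> \<le> c" using J by (rule finite_sum_le_has_sum) (auto simp: finite_box_of)
  finally show ?thesis .
qed

section \<open>Configurations: continuity and lower bound of the energy\<close>

lemma topspace_config_top: "topspace (config_top \<beta> \<Lambda>) = (\<Pi>\<^sub>E j\<in>\<Lambda>. loops \<beta>)"
  by (simp add: config_top_def)

lemma continuous_map_config_component:
  "j \<in> \<Lambda> \<Longrightarrow> continuous_map (config_top \<beta> \<Lambda>) (loop_top \<beta>) (\<lambda>\<omega>. \<omega> j)"
  unfolding config_top_def by (rule continuous_map_product_projection)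

lemma continuous_map_config_integral:
  fixes \<Phi> :: "real \<Rightarrow> real \<Rightarrow> real"
  assumes "continuous_on UNIV (\<lambda>(x, y). \<Phi> x y)" "\<beta> > 0" "j \<in> \<Lambda>" "k \<in> \<Lambda>"
  shows "continuous_map (config_top \<beta> \<Lambda>) euclideanreal (\<lambda>\<omega>. LINT \<tau>:{0..\<beta>}|lborel. \<Phi> (\<omega> j \<tau>) (\<omega> k \<tau>))"
proof -
  have "continuous_map (config_top \<beta> \<Lambda>) (prod_topology (loop_top \<beta>) (loop_top \<beta>)) (\<lambda>\<omega>. (\<omega> j, \<omega> k))"
    using assms by (intro continuous_map_pairedI continuous_map_config_component)
  from continuous_map_compose[OF this continuous_map_loop_integral[OF assms(1,2)]]
  show ?thesis by (simp add: o_def)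
qed

lemma continuous_map_per_energy:
  fixes k0 k1 :: "int ^ 'd"
  assumes "continuous_on UNIV U" "\<beta> > 0"
  shows "continuous_map (config_top \<beta> (box_of k0 k1)) euclideanreal (per_energy U J \<beta> k0 k1)"
proof -
  have "continuous_on UNIV (\<lambda>(x, y). U x :: real)" for y
    using assms(1) unfolding case_prod_beta
    by (intro continuous_on_compose2[OF assms(1)] continuous_intros) auto
  moreover have "continuous_on UNIV (\<lambda>(x, y). x * y :: real)"
    unfolding case_prod_beta by (intro continuous_intros)
  ultimately show ?thesis
    unfolding per_energy_def[abs_def]
    by (intro continuous_map_add continuous_map_sum continuous_map_real_mult continuous_map_const[THEN iffD2] finite_box_of
        continuous_map_config_integral[of "\<lambda>x y. U x"] continuous_map_config_integral[of "\<lambda>x y. x * y"] assms(2)) auto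
qed

text \<open>Each interaction integral is at most half the sum of the two squares. By symmetry of
  \<open>per_dist\<close> both halves give the same double sum, and the row sums of the absolute
  couplings are at most \<open>c\<close>. The resulting coefficient \<open>c' - c\<close> may be
  negative.\<close>

lemma per_energy_ge:
  fixes k0 k1 :: "int ^ 'd" and b c c' \<beta> :: real
  assumes J: "\<And>j :: int ^ 'd. ((\<lambda>k. \<bar>J (lattice_dist j k)\<bar>) has_sum c) UNIV"
    and U: "continuous_on UNIV U" "\<And>x. U x \<ge> 1 / 2 * c' * x\<^sup>2 + b" and "\<beta> > 0"
    and \<omega>: "\<omega> \<in> topspace (config_top \<beta> (box_of k0 k1))"
  shows "per_energy U J \<beta> k0 k1 \<omega> \<ge>
    1 / 2 * (c' - c) * (\<Sum>j\<in>box_of k0 k1. loop_sq \<beta> (\<omega> j)) + card (box_of k0 k1) * (b * \<beta>)"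
proof -
  let ?B = "box_of k0 k1" and ?Q = "\<lambda>j. loop_sq \<beta> (\<omega> j)"
  have loop: "\<omega> j \<in> loops \<beta>" if "j \<in> ?B" for j
    using \<omega> that by (auto simp: topspace_config_top)
  note Q = loop_sq_nonneg[of \<beta>]
  have site: "(LINT \<tau>:{0..\<beta>}|lborel. U (\<omega> j \<tau>)) \<ge> 1 / 2 * c' * ?Q j + b * \<beta>" if j: "j \<in> ?B" for j
  proof -
    have c: "continuous_on {0..\<beta>} (\<omega> j)" using loop[OF j] by (simp add: topspace_loop_top)
    have i: "set_integrable lborel {0..\<beta>} (\<lambda>\<tau>. 1 / 2 * c' * (\<omega> j \<tau>)\<^sup>2)" "set_integrable lborel {0..\<beta>} (\<lambda>\<tau>. b)"
      "set_integrable lborel {0..\<beta>} (\<lambda>\<tau>. U (\<omega> j \<tau>))"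
      using c by (auto intro!: borel_integrable_atLeastAtMost' continuous_intros continuous_on_compose2[OF U(1)])
    have "1 / 2 * c' * ?Q j + b * \<beta> = (LINT \<tau>:{0..\<beta>}|lborel. 1 / 2 * c' * (\<omega> j \<tau>)\<^sup>2) + (LINT \<tau>:{0..\<beta>}|lborel. b)"
      using \<open>\<beta> > 0\<close> by (simp add: loop_sq_def set_lebesgue_integral_def[of _ _ "\<lambda>_. b"])
    also have "\<dots> = (LINT \<tau>:{0..\<beta>}|lborel. 1 / 2 * c' * (\<omega> j \<tau>)\<^sup>2 + b)"
      by (rule set_integral_add(2)[OF i(1,2), symmetric])
    also have "\<dots> \<le> (LINT \<tau>:{0..\<beta>}|lborel. U (\<omega> j \<tau>))"
      by (rule set_integral_mono[OF set_integral_add(1)[OF i(1,2)] i(3)]) (rule U(2))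
    finally show ?thesis .
  qed
  let ?L = "\<lambda>j k. LINT \<tau>:{0..\<beta>}|lborel. \<omega> j \<tau> * \<omega> k \<tau>"
  have pair: "\<bar>?L j k\<bar> \<le> 1 / 2 * ?Q j + 1 / 2 * ?Q k" if "j \<in> ?B" "k \<in> ?B" for j k
    using abs_L2_inner_le[OF loop_in_L2[OF loop[OF that(1)]] loop_in_L2[OF loop[OF that(2)]], of 1]
    by (simp add: L2_inner_def loop_sq_def power2_eq_square)
  let ?J = "\<lambda>j k. \<bar>J (per_dist k0 k1 j k)\<bar>"
  have "- (\<Sum>j\<in>?B. \<Sum>k\<in>?B. J (per_dist k0 k1 j k) * ?L j k)
     \<le> (\<Sum>j\<in>?B. \<Sum>k\<in>?B. ?J j k * (1 / 2 * ?Q j + 1 / 2 * ?Q k))"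
    unfolding sum_negf[symmetric]
  proof (intro sum_mono)
    fix j k assume jk: "j \<in> ?B" "k \<in> ?B"
    have "- (J (per_dist k0 k1 j k) * ?L j k)
      \<le> ?J j k * \<bar>?L j k\<bar>"
      unfolding abs_mult[symmetric] by linarith
    also have "\<dots> \<le> ?J j k * (1 / 2 * ?Q j + 1 / 2 * ?Q k)"
      by (intro mult_left_mono pair jk) simp
    finally show "- (J (per_dist k0 k1 j k) * ?L j k) \<le> \<dots>" .
  qed
  also have "\<dots> = (\<Sum>j\<in>?B. \<Sum>k\<in>?B. ?J j k * (1 / 2 * ?Q j)) + (\<Sum>j\<in>?B. \<Sum>k\<in>?B. ?J j k * (1 / 2 * ?Q k))"
    by (simp only: distrib_left sum.distrib)
  also have "(\<Sum>j\<in>?B. \<Sum>k\<in>?B. ?J j k * (1 / 2 * ?Q k)) = (\<Sum>j\<in>?B. \<Sum>k\<in>?B. ?J j k * (1 / 2 * ?Q j))"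
    by (subst sum.swap) (simp only: per_dist_commute)
  also have "(\<Sum>j\<in>?B. \<Sum>k\<in>?B. ?J j k * (1 / 2 * ?Q j)) \<le> (\<Sum>j\<in>?B. c * (1 / 2 * ?Q j))"
  proof (rule sum_mono)
    fix j assume j: "j \<in> ?B"
    have "(\<Sum>k\<in>?B. ?J j k * (1 / 2 * ?Q j)) = (\<Sum>k\<in>?B. ?J j k) * (1 / 2 * ?Q j)"
      by (simp only: sum_distrib_right)
    also have "\<dots> \<le> c * (1 / 2 * ?Q j)"
      using Q by (intro mult_right_mono sum_abs_per_dist_le[OF J j]) simp
    finally show "(\<Sum>k\<in>?B. ?J j k * (1 / 2 * ?Q j)) \<le> c * (1 / 2 * ?Q j)" .
  qed
  finally have inter: "- (\<Sum>j\<in>?B. \<Sum>k\<in>?B. J (per_dist k0 k1 j k) * ?L j k)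
     \<le> c * (\<Sum>j\<in>?B. ?Q j)"
    by (simp add: sum_distrib_left)
  have "(\<Sum>j\<in>?B. LINT \<tau>:{0..\<beta>}|lborel. U (\<omega> j \<tau>)) \<ge> (\<Sum>j\<in>?B. 1 / 2 * c' * ?Q j + b * \<beta>)"
    by (intro sum_mono site)
  also have "(\<Sum>j\<in>?B. 1 / 2 * c' * ?Q j + b * \<beta>) = 1 / 2 * c' * (\<Sum>j\<in>?B. ?Q j) + card ?B * (b * \<beta>)"
    by (simp add: sum.distrib sum_distrib_left)
  finally have "(\<Sum>j\<in>?B. LINT \<tau>:{0..\<beta>}|lborel. U (\<omega> j \<tau>)) \<ge> 1 / 2 * c' * (\<Sum>j\<in>?B. ?Q j) + card ?B * (b * \<beta>)" .
  moreover have "1 / 2 * (c' - c) * (\<Sum>j\<in>?B. ?Q j) = 1 / 2 * c' * (\<Sum>j\<in>?B. ?Q j) - 1 / 2 * (c * (\<Sum>j\<in>?B. ?Q j))"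
    by (simp add: field_simps)
  ultimately show ?thesis using inter unfolding per_energy_def by linarith
qed

definition const_config :: "real \<Rightarrow> 'k set \<Rightarrow> ('k \<Rightarrow> real) \<Rightarrow> 'k \<Rightarrow> real \<Rightarrow> real" where
  "const_config \<beta> \<Lambda> x = (\<lambda>j\<in>\<Lambda>. \<lambda>\<tau>\<in>{0..\<beta>}. x j)"

lemma const_config_in: "\<beta> \<ge> 0 \<Longrightarrow> const_config \<beta> \<Lambda> x \<in> topspace (config_top \<beta> \<Lambda>)"
  by (auto simp: const_config_def topspace_config_top const_loop_in_loop_top)

lemma loop_dist_const_le:
  "\<beta> \<ge> 0 \<Longrightarrow> loop_dist \<beta> (\<lambda>\<tau>\<in>{0..\<beta>}. x) (\<lambda>\<tau>\<in>{0..\<beta>}. y) \<le> \<bar>x - y\<bar>"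
  by (subst loop_dist_le_iff) (auto simp: const_loop_in_loop_top)

text \<open>A Lebesgue number argument. The constant configurations with values in
  \<open>[-R, R]\<close> are parametrized by a compact cube; finitely many of its points control
  \<open>g\<close>, on all configurations close to a constant one and not only on the
  constants.\<close>

lemma uniform_continuity_near_constants:
  fixes g :: "('k \<Rightarrow> real \<Rightarrow> real) \<Rightarrow> real"
  assumes g: "continuous_map (config_top \<beta> \<Lambda>) euclideanreal g" and \<Lambda>: "finite \<Lambda>"
    and "\<beta> \<ge> 0" "e > 0"
  obtains d where "d > 0"
    "\<And>\<omega> x. \<omega> \<in> topspace (config_top \<beta> \<Lambda>) \<Longrightarrow> (\<And>j. j \<in> \<Lambda> \<Longrightarrow> \<bar>x j\<bar> \<le> R) \<Longrightarrow>
      (\<And>j. j \<in> \<Lambda> \<Longrightarrow> loop_dist \<beta> (\<omega> j) (\<lambda>\<tau>\<in>{0..\<beta>}. x j) < d) \<Longrightarrow>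
      \<bar>g \<omega> - g (const_config \<beta> \<Lambda> x)\<bar> < e"
proof -
  let ?X = "topspace (config_top \<beta> \<Lambda>)" and ?d = "loop_dist \<beta>"
  let ?E = "product_topology (\<lambda>_. euclideanreal) \<Lambda>"
  let ?K = "\<Pi>\<^sub>E j\<in>\<Lambda>. {- R..R}"
  \<comment> \<open>The radius is doubled so that half of it pays for the distance from the given
    constant to a centre of the cover, and the other half for the distance from the configuration to
    the given constant.\<close>
  have local: "\<exists>d>0. \<forall>\<omega>\<in>?X. (\<forall>j\<in>\<Lambda>. ?d (\<omega> j) (\<lambda>\<tau>\<in>{0..\<beta>}. x j) < 2 * d) \<longrightarrow>
      \<bar>g \<omega> - g (const_config \<beta> \<Lambda> x)\<bar> < e / 2" for x :: "'k \<Rightarrow> real"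
  proof -
    let ?c = "const_config \<beta> \<Lambda> x"
    define U where "U = {\<omega> \<in> ?X. g \<omega> \<in> ball (g ?c) (e / 2)}"
    have "openin (config_top \<beta> \<Lambda>) U"
      unfolding U_def using g by (rule openin_continuous_map_preimage) simp
    then have "openin (product_topology (\<lambda>_. loop_top \<beta>) \<Lambda>) U" by (simp only: config_top_def)
    moreover have "?c \<in> U" using const_config_in[OF assms(3)] assms(4) by (simp add: U_def)
    ultimately have "\<exists>W. (\<forall>j\<in>\<Lambda>. openin (loop_top \<beta>) (W j)) \<and> ?c \<in> Pi\<^sub>E \<Lambda> W \<and> Pi\<^sub>E \<Lambda> W \<subseteq> U"
      unfolding openin_product_topology_alt by meson
    then obtain W where W: "\<And>j. j \<in> \<Lambda> \<Longrightarrow> openin (loop_top \<beta>) (W j)" "?c \<in> Pi\<^sub>E \<Lambda> W" "Pi\<^sub>E \<Lambda> W \<subseteq> U"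
      by blast
    have "\<exists>r>0. \<forall>f\<in>loops \<beta>. ?d (\<lambda>\<tau>\<in>{0..\<beta>}. x j) f < r \<longrightarrow> f \<in> W j" if "j \<in> \<Lambda>" for j
    proof -
      have "(\<lambda>\<tau>\<in>{0..\<beta>}. x j) \<in> W j" using W(2) that by (auto simp: const_config_def PiE_iff)
      then show ?thesis using W(1)[OF that] unfolding openin_loop_top_iff by blast
    qed
    then obtain r where r: "\<And>j. j \<in> \<Lambda> \<Longrightarrow> r j > 0"
      "\<And>j f. j \<in> \<Lambda> \<Longrightarrow> f \<in> loops \<beta> \<Longrightarrow> ?d (\<lambda>\<tau>\<in>{0..\<beta>}. x j) f < r j \<Longrightarrow> f \<in> W j" by metis
    define d where "d = Min (insert 1 (r ` \<Lambda>)) / 2"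
    have "d > 0" unfolding d_def using \<Lambda> r(1) by (auto simp: Min_gr_iff)
    have d: "2 * d \<le> r j" if "j \<in> \<Lambda>" for j unfolding d_def using \<Lambda> that by auto
    have "\<bar>g \<omega> - g ?c\<bar> < e / 2" if \<omega>: "\<omega> \<in> ?X" "\<forall>j\<in>\<Lambda>. ?d (\<omega> j) (\<lambda>\<tau>\<in>{0..\<beta>}. x j) < 2 * d" for \<omega>
    proof -
      have "\<omega> j \<in> W j" if j: "j \<in> \<Lambda>" for j
      proof (rule r(2)[OF j])
        show "\<omega> j \<in> loops \<beta>" using \<omega>(1) j by (auto simp: topspace_config_top)
        have "?d (\<omega> j) (\<lambda>\<tau>\<in>{0..\<beta>}. x j) < r j" using \<omega>(2) j d[OF j] by fastforce
        then show "?d (\<lambda>\<tau>\<in>{0..\<beta>}. x j) (\<omega> j) < r j" by (simp only: loop_dist_commute)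
      qed
      then have "\<omega> \<in> Pi\<^sub>E \<Lambda> W" using \<omega>(1) by (auto simp: topspace_config_top PiE_iff)
      then have "\<omega> \<in> U" using W(3) by blast
      then show ?thesis by (simp add: U_def dist_real_def abs_minus_commute)
    qed
    then show ?thesis using \<open>d > 0\<close> by blast
  qed
  then obtain D where D: "\<And>x. D x > 0"
    "\<And>x \<omega>. \<omega> \<in> ?X \<Longrightarrow> (\<And>j. j \<in> \<Lambda> \<Longrightarrow> ?d (\<omega> j) (\<lambda>\<tau>\<in>{0..\<beta>}. x j) < 2 * D x) \<Longrightarrow> \<bar>g \<omega> - g (const_config \<beta> \<Lambda> x)\<bar> < e / 2"
    by metis
  define V where "V x = (\<Pi>\<^sub>E j\<in>\<Lambda>. ball (x j) (D x))" for x
  have Vo: "openin ?E (V x)" for x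
    unfolding V_def using \<Lambda> by (subst openin_PiE) auto
  have "compactin ?E ?K" by (subst compactin_PiE) auto
  moreover have "?K \<subseteq> \<Union> (V ` ?K)"
  proof
    fix x assume "x \<in> ?K"
    moreover have "x \<in> V x" using \<open>x \<in> ?K\<close> D(1)[of x] by (auto simp: V_def PiE_iff)
    ultimately show "x \<in> \<Union> (V ` ?K)" by blast
  qed
  moreover have "\<forall>W\<in>V ` ?K. openin ?E W" using Vo by blast
  ultimately obtain \<F> where "finite \<F>" "\<F> \<subseteq> V ` ?K" "?K \<subseteq> \<Union>\<F>"
    unfolding compactin_def by metis
  then obtain S where S: "finite S" "?K \<subseteq> \<Union> (V ` S)"
    using finite_subset_image[of \<F> V ?K] by metis
  define d where "d = Min (insert 1 (D ` S))"
  have "d > 0" unfolding d_def using S(1) D(1) by (auto simp: Min_gr_iff)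
  have "\<bar>g \<omega> - g (const_config \<beta> \<Lambda> y)\<bar> < e"
    if \<omega>: "\<omega> \<in> ?X" and y: "\<And>j. j \<in> \<Lambda> \<Longrightarrow> \<bar>y j\<bar> \<le> R"
      and near: "\<And>j. j \<in> \<Lambda> \<Longrightarrow> ?d (\<omega> j) (\<lambda>\<tau>\<in>{0..\<beta>}. y j) < d" for \<omega> y
  proof -
    have "restrict y \<Lambda> \<in> ?K" using y by (force simp: abs_le_iff)
    then obtain x where x: "x \<in> S" "restrict y \<Lambda> \<in> V x" using S(2) by blast
    have xy: "\<bar>y j - x j\<bar> < D x" if "j \<in> \<Lambda>" for j
      using x(2) that by (auto simp: V_def PiE_iff dist_real_def abs_minus_commute)
    have "d \<le> D x" unfolding d_def using S(1) x(1) by auto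
    have loop: "\<omega> j \<in> loops \<beta>" if "j \<in> \<Lambda>" for j
      using \<omega> that by (auto simp: topspace_config_top)
    have 1: "\<bar>g \<omega> - g (const_config \<beta> \<Lambda> x)\<bar> < e / 2"
    proof (rule D(2)[OF \<omega>])
      fix j assume j: "j \<in> \<Lambda>"
      have "?d (\<omega> j) (\<lambda>\<tau>\<in>{0..\<beta>}. x j) \<le> ?d (\<omega> j) (\<lambda>\<tau>\<in>{0..\<beta>}. y j) + ?d (\<lambda>\<tau>\<in>{0..\<beta>}. y j) (\<lambda>\<tau>\<in>{0..\<beta>}. x j)"
        by (intro loop_dist_triangle loop j const_loop_in_loop_top assms)
      then show "?d (\<omega> j) (\<lambda>\<tau>\<in>{0..\<beta>}. x j) < 2 * D x"
        using near[OF j] xy[OF j] loop_dist_const_le[OF assms(3), of "y j" "x j"] \<open>d \<le> D x\<close> by linarith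
    qed
    have 2: "\<bar>g (const_config \<beta> \<Lambda> y) - g (const_config \<beta> \<Lambda> x)\<bar> < e / 2"
    proof (rule D(2)[OF const_config_in[OF assms(3)]])
      fix j assume j: "j \<in> \<Lambda>"
      then show "?d (const_config \<beta> \<Lambda> y j) (\<lambda>\<tau>\<in>{0..\<beta>}. x j) < 2 * D x"
        using xy[OF j] loop_dist_const_le[OF assms(3), of "y j" "x j"] D(1)[of x] by (simp add: const_config_def)
    qed
    show ?thesis using 1 2 by linarith
  qed
  then show ?thesis using that \<open>d > 0\<close> by blast
qed

section \<open>Convergence of unnormalized integrals\<close>

lemma continuous_map_loop_sq:
  assumes "\<beta> > 0" shows "continuous_map (loop_top \<beta>) euclideanreal (loop_sq \<beta>)"
proof -
  have "continuous_on UNIV (\<lambda>(x, y). x\<^sup>2 :: real)" for y :: real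
    unfolding case_prod_beta by (intro continuous_intros)
  from continuous_map_compose[OF continuous_map_pairedI[OF continuous_map_id continuous_map_id] continuous_map_loop_integral[OF this assms]]
  show ?thesis by (simp add: o_def loop_sq_def[abs_def])
qed

text \<open>The sum is the convex combination of \<open>p * x\<close> and
  \<open>p / (p - 1) * y\<close> with weights \<open>1 / p\<close> and \<open>(p - 1) / p\<close>.
  Exponentiated, it splits the moment of a sum into separate moments with conjugate exponents, in
  the role of Hoelder's inequality.\<close>

lemma conjugate_max_le:
  fixes x y p :: real
  assumes "p > 1" shows "x + y \<le> max (p * x) (p / (p - 1) * y)"
proof -
  let ?M = "max (p * x) (p / (p - 1) * y)"
  have "x \<le> ?M / p" using assms by (simp add: le_divide_eq mult.commute)
  moreover have "y \<le> ?M * (p - 1) / p"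
  proof -
    have "y * p = p / (p - 1) * y * (p - 1)" using assms by simp
    also have "\<dots> \<le> ?M * (p - 1)" using assms by (intro mult_right_mono) auto
    finally show ?thesis using assms by (simp add: le_divide_eq)
  qed
  moreover have "?M / p + ?M * (p - 1) / p = ?M" using assms by (simp add: field_simps)
  ultimately show ?thesis by linarith
qed

context loop_gauss
begin

lemma loop_sq_measurable: "loop_sq \<beta> \<in> borel_measurable \<gamma>"
  by (intro measurable_\<gamma> continuous_map_imp_borel_measurable continuous_map_loop_sq beta)

text \<open>The average, whose variance does not shrink, receives the exponent \<open>p\<close>,
  which may be close to 1; the fluctuation receives the conjugate exponent, possibly huge, and
  \<open>large\<close> is the mass at which it can bear that.\<close>

lemma nn_integral_exp_loop_sq_le:
  assumes "a \<ge> 0" "p > 1" "p * a < 1" and large: "2 * (p / (p - 1)) * a * \<beta> * increment_const \<beta> * sqrt \<beta> \<le> m"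
  shows "(\<integral>\<^sup>+\<omega>. ennreal (exp (a / 2 * loop_sq \<beta> \<omega>)) \<partial>\<gamma>) \<le> ennreal (1 / sqrt (1 - p * a) + 2)"
proof -
  let ?q = "p / (p - 1)"
  let ?D = "\<lambda>\<omega>. LINT \<tau>:{0..\<beta>}|lborel. (\<omega> \<tau> - \<omega> 0)\<^sup>2"
  let ?u = "\<lambda>\<omega>. exp (p * a / 2 * (\<beta> * (loop_mean \<beta> \<omega>)\<^sup>2))" and ?v = "\<lambda>\<omega>. exp (?q * a / 2 * ?D \<omega>)"
  have [measurable]: "loop_mean \<beta> \<in> borel_measurable \<gamma>" by (rule loop_mean_measurable)
  have D_eq: "?D \<omega> = loop_sq \<beta> \<omega> - 2 * \<omega> 0 * \<beta> * loop_mean \<beta> \<omega> + (\<omega> 0)\<^sup>2 * \<beta>" if "\<omega> \<in> space \<gamma>" for \<omega>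
    using loop_sq_shift[OF _ beta] that by (simp add: space_\<gamma>)
  have [measurable]: "?D \<in> borel_measurable \<gamma>"
  proof (subst measurable_cong[OF D_eq])
    have [measurable]: "(\<lambda>\<omega>. \<omega> 0) \<in> borel_measurable \<gamma>" "loop_sq \<beta> \<in> borel_measurable \<gamma>"
      using beta by (auto intro: eval_measurable loop_sq_measurable)
    show "(\<lambda>\<omega>. loop_sq \<beta> \<omega> - 2 * \<omega> 0 * \<beta> * loop_mean \<beta> \<omega> + (\<omega> 0)\<^sup>2 * \<beta>) \<in> borel_measurable \<gamma>"
      by measurable
  qed
  have "(\<integral>\<^sup>+\<omega>. ennreal (exp (a / 2 * loop_sq \<beta> \<omega>)) \<partial>\<gamma>) \<le>
     (\<integral>\<^sup>+\<omega>. ennreal (?u \<omega>) + ennreal (?v \<omega>) \<partial>\<gamma>)"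
  proof (rule nn_integral_mono)
    fix \<omega> assume "\<omega> \<in> space \<gamma>"
    then have "loop_sq \<beta> \<omega> \<le> \<beta> * (loop_mean \<beta> \<omega>)\<^sup>2 + ?D \<omega>"
      by (intro loop_sq_le beta) (simp add: space_\<gamma>)
    then have "a / 2 * loop_sq \<beta> \<omega> \<le> a / 2 * (\<beta> * (loop_mean \<beta> \<omega>)\<^sup>2) + a / 2 * ?D \<omega>"
      unfolding distrib_left[symmetric] using assms(1) by (intro mult_left_mono) auto
    also have "\<dots> \<le> max (p * (a / 2 * (\<beta> * (loop_mean \<beta> \<omega>)\<^sup>2))) (?q * (a / 2 * ?D \<omega>))"
      by (rule conjugate_max_le[OF assms(2)])
    finally have "exp (a / 2 * loop_sq \<beta> \<omega>) \<le> exp (max (p * (a / 2 * (\<beta> * (loop_mean \<beta> \<omega>)\<^sup>2))) (?q * (a / 2 * ?D \<omega>)))"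
      by simp
    also have "\<dots> \<le> ?u \<omega> + ?v \<omega>"
      by (simp add: max_def mult.assoc add_increasing add_increasing2)
    finally have "ennreal (exp (a / 2 * loop_sq \<beta> \<omega>)) \<le> ennreal (?u \<omega> + ?v \<omega>)"
      by (rule ennreal_leI)
    then show "ennreal (exp (a / 2 * loop_sq \<beta> \<omega>)) \<le> ennreal (?u \<omega>) + ennreal (?v \<omega>)"
      by (simp add: ennreal_plus[symmetric] del: ennreal_plus)
  qed
  also have "\<dots> = (\<integral>\<^sup>+\<omega>. ennreal (?u \<omega>) \<partial>\<gamma>) + (\<integral>\<^sup>+\<omega>. ennreal (?v \<omega>) \<partial>\<gamma>)"
    by (rule nn_integral_add) measurable
  also have "\<dots> \<le> ennreal (1 / sqrt (1 - p * a)) + 2"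
  proof (rule add_mono)
    show "(\<integral>\<^sup>+\<omega>. ennreal (?u \<omega>) \<partial>\<gamma>) \<le> ennreal (1 / sqrt (1 - p * a))"
      by (rule eq_refl[OF nn_integral_exp_mean_sq[OF assms(3)]])
    have "4 * (?q * a / 2) * \<beta> * increment_const \<beta> * sqrt \<beta> \<le> m"
    proof -
      have "4 * (q * a / 2) = 2 * q * a" for q by simp
      then show ?thesis using large by (simp only:)
    qed
    moreover have "0 \<le> ?q * a / 2" using assms by simp
    ultimately show "(\<integral>\<^sup>+\<omega>. ennreal (?v \<omega>) \<partial>\<gamma>) \<le> 2"
      by (intro nn_integral_exp_fluctuation_le_2)
  qed
  also have "\<dots> = ennreal (1 / sqrt (1 - p * a) + 2)"
    using assms(3) by (subst ennreal_plus) auto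
  finally show ?thesis .
qed

text \<open>Exponential Markov inequality at half the critical exponent, followed by
  \<open>exp (- z) \<le> 1 / z\<close> with \<open>z = \<beta> * R^2 / 4\<close>; the moment is
  rounded up to 2. The bound is uniform in the mass.\<close>

lemma emeasure_loop_mean_gt:
  assumes "R > 0"
  shows "emeasure \<gamma> {\<omega> \<in> space \<gamma>. R < \<bar>loop_mean \<beta> \<omega>\<bar>} \<le> ennreal (8 / (\<beta> * R\<^sup>2))"
proof -
  have [measurable]: "loop_mean \<beta> \<in> borel_measurable \<gamma>" by (rule loop_mean_measurable)
  define z where "z = \<beta> * R\<^sup>2 / 4"
  have "z > 0" using beta assms by (simp add: z_def)
  let ?u = "\<lambda>\<omega>. 1 / 2 / 2 * (\<beta> * (loop_mean \<beta> \<omega>)\<^sup>2)"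
  have "{\<omega> \<in> space \<gamma>. R < \<bar>loop_mean \<beta> \<omega>\<bar>} \<subseteq> {\<omega> \<in> space \<gamma>. z \<le> ?u \<omega>}"
  proof safe
    fix \<omega> assume "R < \<bar>loop_mean \<beta> \<omega>\<bar>"
    then have "R\<^sup>2 \<le> (loop_mean \<beta> \<omega>)\<^sup>2" using assms by (simp add: abs_le_square_iff[symmetric])
    then have "\<beta> * R\<^sup>2 \<le> \<beta> * (loop_mean \<beta> \<omega>)\<^sup>2" using beta by (intro mult_left_mono) auto
    then show "z \<le> ?u \<omega>" by (simp add: z_def)
  qed
  then have "emeasure \<gamma> {\<omega> \<in> space \<gamma>. R < \<bar>loop_mean \<beta> \<omega>\<bar>} \<le> emeasure \<gamma> {\<omega> \<in> space \<gamma>. z \<le> ?u \<omega>}"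
    by (intro emeasure_mono) measurable
  also have "\<dots> \<le> ennreal (exp (- z) * (1 / sqrt (1 - 1 / 2)))"
    using nn_integral_exp_mean_sq[of "1 / 2"] by (intro emeasure_ge_exp_moment) simp_all
  also have "\<dots> \<le> ennreal (8 / (\<beta> * R\<^sup>2))"
  proof (rule ennreal_leI)
    have "1 / sqrt (1 - 1 / 2) \<le> (2 :: real)" by (simp add: real_sqrt_divide real_le_lsqrt)
    moreover have "exp (- z) \<le> 1 / z"
    proof -
      have "z \<le> exp z" using exp_ge_add_one_self[of z] by linarith
      then show ?thesis using \<open>z > 0\<close> by (simp add: exp_minus field_simps)
    qed
    ultimately have "exp (- z) * (1 / sqrt (1 - 1 / 2)) \<le> 1 / z * 2"
      using \<open>z > 0\<close> by (intro mult_mono) auto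
    then show "exp (- z) * (1 / sqrt (1 - 1 / 2)) \<le> 8 / (\<beta> * R\<^sup>2)" by (simp add: z_def)
  qed
  finally show ?thesis .
qed

text \<open>The value at time 0 is within \<open>\<delta>\<close> of every value of the loop, hence
  also of their average; this accounts for the factor 2.\<close>

lemma loop_dist_mean_le:
  assumes "\<omega> \<in> space \<gamma> - rough \<delta>" "\<delta> \<ge> 0"
  shows "loop_dist \<beta> \<omega> (\<lambda>\<tau>\<in>{0..\<beta>}. loop_mean \<beta> \<omega>) \<le> 2 * \<delta>"
proof -
  have \<omega>: "\<omega> \<in> loops \<beta>" using assms(1) by (simp add: space_\<gamma>)
  have near: "\<bar>\<omega> t - \<omega> 0\<bar> \<le> \<delta>" if "t \<in> {0..\<beta>}" for t by (rule not_rough_imp[OF assms that])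
  have i: "set_integrable lborel {0..\<beta>} \<omega>" "set_integrable lborel {0..\<beta>} (\<lambda>_. \<omega> 0)"
    using \<omega> by (auto simp: topspace_loop_top intro!: borel_integrable_atLeastAtMost')
  have "\<bar>LINT t:{0..\<beta>}|lborel. \<omega> t - \<omega> 0\<bar> \<le> \<delta> * (\<beta> - 0)"
    by (intro abs_set_integral_le set_integral_diff(1)[OF i] near) (use beta in auto)
  moreover have "(LINT t:{0..\<beta>}|lborel. \<omega> t - \<omega> 0) = \<beta> * (loop_mean \<beta> \<omega> - \<omega> 0)"
    unfolding set_integral_diff(2)[OF i] using beta
    by (simp add: loop_mean_eq set_lebesgue_integral_def[of _ _ "\<lambda>_. \<omega> 0"] right_diff_distrib)
  ultimately have "\<beta> * \<bar>loop_mean \<beta> \<omega> - \<omega> 0\<bar> \<le> \<beta> * \<delta>" using beta by (simp add: abs_mult mult.commute)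
  then have "\<bar>loop_mean \<beta> \<omega> - \<omega> 0\<bar> \<le> \<delta>" using beta by simp
  then have "\<bar>\<omega> t - loop_mean \<beta> \<omega>\<bar> \<le> 2 * \<delta>" if "t \<in> {0..\<beta>}" for t using near[OF that] by linarith
  then show ?thesis using beta by (subst loop_dist_le_iff[OF _ \<omega> const_loop_in_loop_top]) auto
qed

end

section \<open>Product measures and the flattening coupling\<close>

locale config_gauss = loop_gauss \<beta> m \<gamma> for \<beta> m \<gamma> +
  fixes \<Lambda> :: "'k set"
  assumes finite_\<Lambda>: "finite \<Lambda>"
begin

definition G :: "('k \<Rightarrow> real \<Rightarrow> real) measure" where
  "G = (\<Pi>\<^sub>M j\<in>\<Lambda>. \<gamma>)"

lemma sets_G: "sets G = sets (borel_of (config_top \<beta> \<Lambda>))"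
  unfolding G_def config_top_def sets_borel_of_product_topology[OF finite_\<Lambda> second_countable_loop_top]
  by (rule sets_PiM_cong) (simp_all add: sets_\<gamma>)

lemma space_G: "space G = topspace (config_top \<beta> \<Lambda>)"
  using sets_eq_imp_space_eq[OF sets_G] by simp

sublocale G: prob_space G
  unfolding G_def by (intro prob_space_PiM prob_space_axioms)

lemma continuous_measurable_G:
  fixes f :: "('k \<Rightarrow> real \<Rightarrow> real) \<Rightarrow> real"
  shows "continuous_map (config_top \<beta> \<Lambda>) euclideanreal f \<Longrightarrow> f \<in> borel_measurable G"
  using continuous_map_imp_borel_measurable measurable_cong_sets[OF sets_G refl] by blast

lemma component_measurable: "j \<in> \<Lambda> \<Longrightarrow> (\<lambda>\<omega>. \<omega> j) \<in> measurable G \<gamma>"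
  unfolding G_def by (rule measurable_component_singleton)

lemma emeasure_G_component:
  assumes "j \<in> \<Lambda>" "B \<in> sets \<gamma>"
  shows "emeasure G {\<omega> \<in> space G. \<omega> j \<in> B} = emeasure \<gamma> B"
proof -
  have "emeasure \<gamma> B = emeasure (distr G \<gamma> (\<lambda>\<omega>. \<omega> j)) B"
    unfolding G_def using assms(1) prob_space_axioms by (subst distr_PiM_component) auto
  also have "\<dots> = emeasure G ((\<lambda>\<omega>. \<omega> j) -` B \<inter> space G)"
    by (rule emeasure_distr[OF component_measurable[OF assms(1)] assms(2)])
  also have "(\<lambda>\<omega>. \<omega> j) -` B \<inter> space G = {\<omega> \<in> space G. \<omega> j \<in> B}" by auto
  finally show ?thesis ..
qed

definition total_sq :: "('k \<Rightarrow> real \<Rightarrow> real) \<Rightarrow> real" where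
  "total_sq \<omega> = (\<Sum>j\<in>\<Lambda>. loop_sq \<beta> (\<omega> j))"

lemma total_sq_nonneg: "total_sq \<omega> \<ge> 0"
  unfolding total_sq_def by (intro sum_nonneg loop_sq_nonneg)

lemma total_sq_measurable: "total_sq \<in> borel_measurable G"
  unfolding total_sq_def[abs_def]
  by (intro borel_measurable_sum measurable_compose[OF component_measurable loop_sq_measurable])

lemma nn_integral_exp_total_sq_le:
  assumes "a \<ge> 0" "p > 1" "p * a < 1" "2 * (p / (p - 1)) * a * \<beta> * increment_const \<beta> * sqrt \<beta> \<le> m"
  shows "(\<integral>\<^sup>+\<omega>. ennreal (exp (a / 2 * total_sq \<omega>)) \<partial>G) \<le> ennreal ((1 / sqrt (1 - p * a) + 2) ^ card \<Lambda>)"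
proof -
  interpret P: product_prob_space "\<lambda>_. \<gamma>"
    by (rule product_prob_spaceI) (rule prob_space_axioms)
  have "(\<integral>\<^sup>+\<omega>. ennreal (exp (a / 2 * total_sq \<omega>)) \<partial>G) = (\<integral>\<^sup>+\<omega>. (\<Prod>j\<in>\<Lambda>. ennreal (exp (a / 2 * loop_sq \<beta> (\<omega> j)))) \<partial>G)"
    by (simp add: total_sq_def sum_distrib_left exp_sum finite_\<Lambda> prod_ennreal)
  also have "\<dots> = (\<Prod>j\<in>\<Lambda>. \<integral>\<^sup>+\<omega>. ennreal (exp (a / 2 * loop_sq \<beta> \<omega>)) \<partial>\<gamma>)"
    unfolding G_def using loop_sq_measurable by (intro P.product_nn_integral_prod finite_\<Lambda>) measurable
  also have "\<dots> \<le> (\<Prod>j\<in>\<Lambda>. ennreal (1 / sqrt (1 - p * a) + 2))"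
    by (intro prod_mono_ennreal nn_integral_exp_loop_sq_le assms)
  also have "\<dots> = ennreal ((1 / sqrt (1 - p * a) + 2) ^ card \<Lambda>)"
  proof -
    have "0 \<le> 1 / sqrt (1 - p * a) + 2" using assms(3) by simp
    then show ?thesis by (simp only: prod_constant ennreal_power)
  qed
  finally show ?thesis .
qed

definition flatten :: "('k \<Rightarrow> real \<Rightarrow> real) \<Rightarrow> 'k \<Rightarrow> real \<Rightarrow> real" where
  "flatten \<omega> = const_config \<beta> \<Lambda> (\<lambda>j. loop_mean \<beta> (\<omega> j))"

text \<open>The factors \<open>N j\<close> are kept general because both the plain Borel space and
  the law of the averages occur in this place.\<close>

lemma const_config_measurable:
  assumes "\<And>j. j \<in> \<Lambda> \<Longrightarrow> sets (N j) = sets borel"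
  shows "const_config \<beta> \<Lambda> \<in> measurable (PiM \<Lambda> N) (\<Pi>\<^sub>M j\<in>\<Lambda>. borel_of (loop_top \<beta>))"
  unfolding const_config_def[abs_def]
proof (rule measurable_restrict)
  fix j assume j: "j \<in> \<Lambda>"
  have "(\<lambda>x. x j) \<in> measurable (PiM \<Lambda> N) (N j)" using j by (rule measurable_component_singleton)
  then have "(\<lambda>x. x j) \<in> borel_measurable (PiM \<Lambda> N)" using measurable_cong_sets[OF refl assms[OF j]] by blast
  moreover have "(\<lambda>x. \<lambda>\<tau>\<in>{0..\<beta>}. x) \<in> measurable borel (borel_of (loop_top \<beta>))"
    using continuous_map_imp_measurable_borel_of[OF continuous_map_const_loop, of \<beta>] beta
    by (simp add: borel_of_euclidean)
  ultimately show "(\<lambda>x. \<lambda>\<tau>\<in>{0..\<beta>}. x j) \<in> measurable (PiM \<Lambda> N) (borel_of (loop_top \<beta>))"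
    by (rule measurable_compose)
qed

lemma flatten_measurable: "flatten \<in> measurable G (\<Pi>\<^sub>M j\<in>\<Lambda>. borel_of (loop_top \<beta>))"
proof -
  have "(\<lambda>\<omega>. \<lambda>j\<in>\<Lambda>. loop_mean \<beta> (\<omega> j)) \<in> measurable G (\<Pi>\<^sub>M j\<in>\<Lambda>. borel)"
    by (intro measurable_restrict measurable_compose[OF component_measurable loop_mean_measurable])
  from measurable_compose[OF this const_config_measurable]
  show ?thesis by (simp add: flatten_def[abs_def] const_config_def cong: restrict_cong)
qed

text \<open>The law of the loop averages does not depend on the mass, so flattening couples every
  \<open>\<gamma>\<close> with the same reference measure.\<close>

lemma qc_reference_eq: "qc_reference \<beta> \<Lambda> = distr G (\<Pi>\<^sub>M j\<in>\<Lambda>. borel_of (loop_top \<beta>)) flatten"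
proof -
  let ?N = "\<Pi>\<^sub>M j\<in>\<Lambda>. borel_of (loop_top \<beta>)" and ?D = "distr \<gamma> borel (loop_mean \<beta>)"
  have D: "prob_space ?D" by (rule prob_space_distr[OF loop_mean_measurable])
  have mm: "loop_mean \<beta> \<in> measurable \<gamma> ?D" using loop_mean_measurable by simp
  have "distr \<gamma> ?D (loop_mean \<beta>) = ?D" by (rule distr_cong) auto
  then have chi: "chi_measure \<beta> \<Lambda> = distr G (\<Pi>\<^sub>M j\<in>\<Lambda>. ?D) (compose \<Lambda> (loop_mean \<beta>))"
    unfolding chi_measure_def G_def law_loop_mean[symmetric]
    by (subst distr_PiM_finite_prob_space'[OF finite_\<Lambda> prob_space_axioms D mm]) simp_all
  have cm: "compose \<Lambda> (loop_mean \<beta>) \<in> measurable G (\<Pi>\<^sub>M j\<in>\<Lambda>. ?D)"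
    unfolding compose_def by (intro measurable_restrict measurable_compose[OF component_measurable mm])
  have "qc_reference \<beta> \<Lambda> = distr (distr G (\<Pi>\<^sub>M j\<in>\<Lambda>. ?D) (compose \<Lambda> (loop_mean \<beta>))) ?N (const_config \<beta> \<Lambda>)"
    unfolding qc_reference_def chi const_config_def ..
  also have "\<dots> = distr G ?N (const_config \<beta> \<Lambda> \<circ> compose \<Lambda> (loop_mean \<beta>))"
    by (rule distr_distr[OF const_config_measurable cm]) simp
  also have "const_config \<beta> \<Lambda> \<circ> compose \<Lambda> (loop_mean \<beta>) = flatten"
    by (auto simp: flatten_def const_config_def compose_def fun_eq_iff)
  finally show ?thesis .
qed

lemma flatten_in: "flatten \<omega> \<in> topspace (config_top \<beta> \<Lambda>)"
  unfolding flatten_def using beta by (intro const_config_in) simp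

text \<open>Jensen for the square, site by site. It lets the exponential bound at
  \<open>\<omega>\<close> dominate the flattened configuration as well.\<close>

lemma total_sq_flatten_le:
  assumes "\<omega> \<in> space G" shows "total_sq (flatten \<omega>) \<le> total_sq \<omega>"
  unfolding total_sq_def
proof (rule sum_mono)
  fix j assume j: "j \<in> \<Lambda>"
  then have "\<omega> j \<in> loops \<beta>" using assms by (auto simp: space_G topspace_config_top)
  then have "\<beta> * (loop_mean \<beta> (\<omega> j))\<^sup>2 \<le> loop_sq \<beta> (\<omega> j)" using beta by (rule loop_mean_sq_le)
  moreover have "loop_sq \<beta> (flatten \<omega> j) = \<beta> * (loop_mean \<beta> (\<omega> j))\<^sup>2"
  proof -
    have "loop_sq \<beta> (flatten \<omega> j) = (LINT \<tau>:{0..\<beta>}|lborel. (loop_mean \<beta> (\<omega> j))\<^sup>2)"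
      unfolding loop_sq_def set_lebesgue_integral_def
      by (rule Bochner_Integration.integral_cong) (use j in \<open>auto simp: flatten_def const_config_def indicator_def\<close>)
    then show ?thesis using beta by (simp add: set_lebesgue_integral_def)
  qed
  ultimately show "loop_sq \<beta> (flatten \<omega> j) \<le> loop_sq \<beta> (\<omega> j)" by simp
qed

text \<open>Bounded averages place the flattened configuration in the compact family of constants,
  and smoothness places the original near it; together they permit the uniform modulus of
  continuity.\<close>

definition typical :: "real \<Rightarrow> real \<Rightarrow> ('k \<Rightarrow> real \<Rightarrow> real) set" where
  "typical R \<delta> = {\<omega> \<in> space G. \<forall>j\<in>\<Lambda>. \<bar>loop_mean \<beta> (\<omega> j)\<bar> \<le> R \<and> \<omega> j \<notin> rough \<delta>}"

lemma atypical_eq: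
  "space G - typical R \<delta> = (\<Union>j\<in>\<Lambda>. {\<omega> \<in> space G. \<omega> j \<in> {f \<in> space \<gamma>. R < \<bar>loop_mean \<beta> f\<bar>} \<union> rough \<delta>})"
proof -
  have "\<omega> j \<in> space \<gamma>" if "\<omega> \<in> space G" "j \<in> \<Lambda>" for \<omega> j
    using that by (auto simp: space_G space_\<gamma> topspace_config_top)
  then show ?thesis by (auto simp: typical_def not_le)
qed

lemma atypical_site_measurable: "{f \<in> space \<gamma>. R < \<bar>loop_mean \<beta> f\<bar>} \<union> rough \<delta> \<in> sets \<gamma>"
proof -
  have [measurable]: "loop_mean \<beta> \<in> borel_measurable \<gamma>" "rough \<delta> \<in> sets \<gamma>"
    by (rule loop_mean_measurable, rule rough_measurable)
  show ?thesis by measurable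
qed

lemma component_vimage_measurable:
  assumes "j \<in> \<Lambda>" "B \<in> sets \<gamma>" shows "{\<omega> \<in> space G. \<omega> j \<in> B} \<in> sets G"
  using measurable_sets[OF component_measurable[OF assms(1)] assms(2)]
  by (simp add: vimage_def Int_def conj_commute)

lemma atypical_measurable: "space G - typical R \<delta> \<in> sets G"
  unfolding atypical_eq
  by (intro sets.finite_UN finite_\<Lambda> component_vimage_measurable atypical_site_measurable)

lemma measure_atypical_le:
  assumes "R > 0" "\<delta> > 0"
  shows "measure G (space G - typical R \<delta>) \<le> card \<Lambda> * (8 / (\<beta> * R\<^sup>2) + chain_const \<beta> \<delta> / m ^ 4)"
proof -
  let ?B = "{f \<in> space \<gamma>. R < \<bar>loop_mean \<beta> f\<bar>}" and ?p = "8 / (\<beta> * R\<^sup>2) + chain_const \<beta> \<delta> / m ^ 4"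
  have nn: "0 \<le> 8 / (\<beta> * R\<^sup>2)" using beta by simp
  have nn2: "0 \<le> chain_const \<beta> \<delta> / m ^ 4"
    using chain_const_nonneg[OF beta assms(2)] m by simp
  have [measurable]: "loop_mean \<beta> \<in> borel_measurable \<gamma>" "rough \<delta> \<in> sets \<gamma>"
    by (rule loop_mean_measurable, rule rough_measurable)
  have "emeasure \<gamma> (?B \<union> rough \<delta>) \<le> emeasure \<gamma> ?B + emeasure \<gamma> (rough \<delta>)"
    by (rule emeasure_subadditive) measurable
  also have "\<dots> \<le> ennreal (8 / (\<beta> * R\<^sup>2)) + ennreal (chain_const \<beta> \<delta> / m ^ 4)"
    by (intro add_mono emeasure_loop_mean_gt emeasure_rough_le assms)
  also have "\<dots> = ennreal ?p" by (rule ennreal_plus[symmetric, OF nn nn2])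
  finally have site: "emeasure \<gamma> (?B \<union> rough \<delta>) \<le> ennreal ?p" .
  have "emeasure G (space G - typical R \<delta>) \<le> (\<Sum>j\<in>\<Lambda>. emeasure G {\<omega> \<in> space G. \<omega> j \<in> ?B \<union> rough \<delta>})"
    unfolding atypical_eq
    by (intro emeasure_subadditive_finite finite_\<Lambda> image_subsetI component_vimage_measurable atypical_site_measurable)
  also have "\<dots> \<le> (\<Sum>j\<in>\<Lambda>. ennreal ?p)"
  proof (rule sum_mono)
    fix j assume "j \<in> \<Lambda>"
    then show "emeasure G {\<omega> \<in> space G. \<omega> j \<in> ?B \<union> rough \<delta>} \<le> ennreal ?p"
      using site by (subst emeasure_G_component[OF _ atypical_site_measurable])
  qed
  also have "\<dots> = ennreal (\<Sum>j\<in>\<Lambda>. ?p)" by (rule sum_ennreal) (rule add_nonneg_nonneg[OF nn nn2])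
  finally have "emeasure G (space G - typical R \<delta>) \<le> ennreal (card \<Lambda> * ?p)" by simp
  then show ?thesis
    unfolding G.emeasure_eq_measure
    by (subst (asm) ennreal_le_iff) (intro mult_nonneg_nonneg add_nonneg_nonneg nn nn2 of_nat_0_le_iff)
qed

text \<open>On atypical configurations \<open>exp h \<le> exp \<mu> + exp ((1 - s) * \<mu>) * exp (s * h)\<close> trades the exponential
  moment of order \<open>s > 1\<close> for smallness.\<close>

lemma integral_flatten_diff_le:
  fixes g :: "('k \<Rightarrow> real \<Rightarrow> real) \<Rightarrow> real"
  assumes g: "continuous_map (config_top \<beta> \<Lambda>) euclideanreal g"
    and bound: "\<And>\<omega>. \<omega> \<in> topspace (config_top \<beta> \<Lambda>) \<Longrightarrow> \<bar>g \<omega>\<bar> \<le> C * exp (a / 2 * total_sq \<omega>)"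
    and a: "a \<ge> 0" and s: "s > 1" and "C \<ge> 0" "K \<ge> 0"
    and moment: "(\<integral>\<^sup>+\<omega>. ennreal (exp (s * a / 2 * total_sq \<omega>)) \<partial>G) \<le> ennreal K"
    and near: "\<And>\<omega>. \<omega> \<in> typical R \<delta> \<Longrightarrow> \<bar>g \<omega> - g (flatten \<omega>)\<bar> \<le> e" and "e \<ge> 0"
  shows "integrable G g" "integrable (qc_reference \<beta> \<Lambda>) g"
    "\<bar>(\<integral>\<omega>. g \<omega> \<partial>G) - (\<integral>\<omega>. g \<omega> \<partial>qc_reference \<beta> \<Lambda>)\<bar> \<le>
      e + 2 * C * (exp \<mu> * measure G (space G - typical R \<delta>) + exp ((1 - s) * \<mu>) * K)"
proof -
  let ?H = "\<lambda>\<omega>. exp (a / 2 * total_sq \<omega>)" and ?Hs = "\<lambda>\<omega>. exp (s * a / 2 * total_sq \<omega>)"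
  have [measurable]: "total_sq \<in> borel_measurable G" by (rule total_sq_measurable)
  have gm [measurable]: "g \<in> borel_measurable G" by (rule continuous_measurable_G[OF g])
  have gN: "g \<in> borel_measurable (\<Pi>\<^sub>M j\<in>\<Lambda>. borel_of (loop_top \<beta>))"
    using continuous_map_imp_borel_measurable[OF g]
      measurable_cong_sets[OF sets_borel_of_product_topology[OF finite_\<Lambda> second_countable_loop_top] refl]
    unfolding config_top_def by blast
  have gf [measurable]: "(\<lambda>\<omega>. g (flatten \<omega>)) \<in> borel_measurable G"
    by (rule measurable_compose[OF flatten_measurable gN])
  have iHs: "integrable G ?Hs"
    by (rule integrableI_bounded) (use moment in \<open>auto intro: le_less_trans\<close>)
  have IHs: "(\<integral>\<omega>. ?Hs \<omega> \<partial>G) \<le> K"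
    using moment \<open>K \<ge> 0\<close> by (subst (asm) nn_integral_eq_integral[OF iHs]) auto
  have HHs: "?H \<omega> \<le> ?Hs \<omega>" for \<omega>
  proof -
    have "1 * (a / 2 * total_sq \<omega>) \<le> s * (a / 2 * total_sq \<omega>)"
      using s a total_sq_nonneg[of \<omega>] by (intro mult_right_mono) auto
    then show ?thesis by (simp add: mult.assoc)
  qed
  have iH: "integrable G ?H"
  proof (rule Bochner_Integration.integrable_bound[OF iHs])
    show "AE \<omega> in G. norm (?H \<omega>) \<le> norm (?Hs \<omega>)" by (rule AE_I2) (simp only: real_norm_def abs_exp_cancel HHs)
  qed measurable
  have bg: "\<bar>g \<omega>\<bar> \<le> C * ?H \<omega>" if "\<omega> \<in> space G" for \<omega> using bound that by (simp add: space_G)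
  have bgf: "\<bar>g (flatten \<omega>)\<bar> \<le> C * ?H \<omega>" if "\<omega> \<in> space G" for \<omega>
  proof -
    have "\<bar>g (flatten \<omega>)\<bar> \<le> C * ?H (flatten \<omega>)" using bound flatten_in by blast
    also have "a / 2 * total_sq (flatten \<omega>) \<le> a / 2 * total_sq \<omega>"
      using a total_sq_flatten_le[OF that] by (intro mult_left_mono) auto
    then have "C * ?H (flatten \<omega>) \<le> C * ?H \<omega>" using \<open>C \<ge> 0\<close> by (intro mult_left_mono) auto
    finally show ?thesis .
  qed
  have iCH: "integrable G (\<lambda>\<omega>. C * ?H \<omega>)" using iH by simp
  show ig: "integrable G g"
    by (rule Bochner_Integration.integrable_bound[OF iCH gm])
       (use bg \<open>C \<ge> 0\<close> in \<open>auto simp: abs_mult intro!: AE_I2\<close>)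
  have igf: "integrable G (\<lambda>\<omega>. g (flatten \<omega>))"
    by (rule Bochner_Integration.integrable_bound[OF iCH gf])
       (use bgf \<open>C \<ge> 0\<close> in \<open>auto simp: abs_mult intro!: AE_I2\<close>)
  show "integrable (qc_reference \<beta> \<Lambda>) g"
    unfolding qc_reference_eq integrable_distr_eq[OF flatten_measurable gN] by (rule igf)
  have qc: "(\<integral>\<omega>. g \<omega> \<partial>qc_reference \<beta> \<Lambda>) = (\<integral>\<omega>. g (flatten \<omega>) \<partial>G)"
    unfolding qc_reference_eq by (rule integral_distr[OF flatten_measurable gN])
  let ?A = "space G - typical R \<delta>"
  \<comment> \<open>The factor 2 accounts for \<open>g\<close> and its flattened version, each at
    most \<open>C * ?H \<omega>\<close>. The truncated part carries the indicator of the atypical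
    set; the part with \<open>?Hs\<close> is already small through its prefactor.\<close>
  let ?b = "\<lambda>\<omega>. e + 2 * C * (exp \<mu> * indicat_real ?A \<omega> + exp ((1 - s) * \<mu>) * ?Hs \<omega>)"
  have iA: "integrable G (indicat_real ?A)"
    using atypical_measurable G.emeasure_finite by (intro integrable_real_indicator) (auto simp: less_top[symmetric])
  have pt: "\<bar>g \<omega> - g (flatten \<omega>)\<bar> \<le> ?b \<omega>" if \<omega>: "\<omega> \<in> space G" for \<omega>
  proof (cases "\<omega> \<in> typical R \<delta>")
    case True
    then have "\<bar>g \<omega> - g (flatten \<omega>)\<bar> \<le> e" by (rule near)
    also have "e \<le> ?b \<omega>" using \<open>C \<ge> 0\<close> by simp
    finally show ?thesis .
  next
    case False
    have "?H \<omega> \<le> exp \<mu> + exp ((1 - s) * \<mu>) * ?Hs \<omega>"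
    proof (cases "a / 2 * total_sq \<omega> \<le> \<mu>")
      case True
      then show ?thesis by (simp add: add_increasing2)
    next
      case False
      then have "0 \<le> (s - 1) * (a / 2 * total_sq \<omega> - \<mu>)" using s by simp
      then have "a / 2 * total_sq \<omega> \<le> (1 - s) * \<mu> + s * a / 2 * total_sq \<omega>"
        by (simp add: algebra_simps diff_divide_distrib)
      then have "?H \<omega> \<le> exp ((1 - s) * \<mu>) * ?Hs \<omega>" unfolding exp_add[symmetric] by simp
      then show ?thesis by (simp add: add_increasing)
    qed
    then have "2 * C * ?H \<omega> \<le> 2 * C * (exp \<mu> + exp ((1 - s) * \<mu>) * ?Hs \<omega>)"
      using \<open>C \<ge> 0\<close> by (intro mult_left_mono) auto
    moreover have "indicat_real ?A \<omega> = 1" using False \<omega> by simp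
    ultimately show ?thesis using bg[OF \<omega>] bgf[OF \<omega>] \<open>e \<ge> 0\<close> by simp
  qed
  have ib: "integrable G ?b" using iA iHs by simp
  have "\<bar>(\<integral>\<omega>. g \<omega> \<partial>G) - (\<integral>\<omega>. g (flatten \<omega>) \<partial>G)\<bar> = \<bar>\<integral>\<omega>. g \<omega> - g (flatten \<omega>) \<partial>G\<bar>"
    using ig igf by simp
  also have "\<dots> \<le> (\<integral>\<omega>. \<bar>g \<omega> - g (flatten \<omega>)\<bar> \<partial>G)" by (rule integral_abs_bound)
  also have "\<dots> \<le> (\<integral>\<omega>. ?b \<omega> \<partial>G)"
    using ig igf ib pt by (intro integral_mono) auto
  also have "\<dots> = e + 2 * C * (exp \<mu> * measure G ?A + exp ((1 - s) * \<mu>) * (\<integral>\<omega>. ?Hs \<omega> \<partial>G))"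
    using iA iHs atypical_measurable by (simp add: G.prob_space Int_absorb1 sets.sets_into_space)
  also have "\<dots> \<le> e + 2 * C * (exp \<mu> * measure G ?A + exp ((1 - s) * \<mu>) * K)"
    using IHs \<open>C \<ge> 0\<close> by (intro add_left_mono mult_left_mono) auto
  finally show "\<bar>(\<integral>\<omega>. g \<omega> \<partial>G) - (\<integral>\<omega>. g \<omega> \<partial>qc_reference \<beta> \<Lambda>)\<bar> \<le>
      e + 2 * C * (exp \<mu> * measure G (space G - typical R \<delta>) + exp ((1 - s) * \<mu>) * K)"
    unfolding qc .
qed

end

text \<open>Both integrals live on the same space by the coupling, so for each mass their difference
  is at most the quantitative bound \<open>est\<close>. Only one of its terms depends on the mass,
  and all the other parameters are fixed before the mass grows.\<close>

lemma tendsto_integral_qc_reference: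
  fixes g :: "('k \<Rightarrow> real \<Rightarrow> real) \<Rightarrow> real"
  assumes "\<beta> > 0" and \<Lambda>: "finite \<Lambda>" and \<gamma>: "\<And>m. m > 0 \<Longrightarrow> loop_gaussian \<beta> m (\<gamma> m)"
    and g: "continuous_map (config_top \<beta> \<Lambda>) euclideanreal g"
    and bound: "\<And>\<omega>. \<omega> \<in> topspace (config_top \<beta> \<Lambda>) \<Longrightarrow> \<bar>g \<omega>\<bar> \<le> C * exp (a / 2 * (\<Sum>j\<in>\<Lambda>. loop_sq \<beta> (\<omega> j)))"
    and a: "0 \<le> a" "a < 1" and C: "C \<ge> 0"
  shows "eventually (\<lambda>m. integrable (\<Pi>\<^sub>M j\<in>\<Lambda>. \<gamma> m) g) at_top"
    and "integrable (qc_reference \<beta> \<Lambda>) g"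
    and "((\<lambda>m. \<integral>\<omega>. g \<omega> \<partial>(\<Pi>\<^sub>M j\<in>\<Lambda>. \<gamma> m)) \<longlongrightarrow> (\<integral>\<omega>. g \<omega> \<partial>qc_reference \<beta> \<Lambda>)) at_top"
proof -
  \<comment> \<open>One number serves as the order of the moment giving uniform integrability and as
    the exponent spent on the average; both together must satisfy
    \<open>s * (s * a) < 1\<close>.\<close>
  define s where "s = 1 + (1 - a) / 4"
  have s: "s > 1" using a by (simp add: s_def)
  have sa: "s * (s * a) < 1"
  proof -
    define \<eta> where "\<eta> = (1 - a) / 4"
    have \<eta>: "0 < \<eta>" "\<eta> \<le> 1" "a = 1 - 4 * \<eta>" using a by (simp_all add: \<eta>_def field_simps)
    have "s * (s * a) = 1 - 2 * \<eta> - 7 * \<eta>\<^sup>2 - 4 * \<eta> ^ 3"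
      unfolding s_def \<eta>_def[symmetric] \<eta>(3) by (simp add: algebra_simps power2_eq_square power3_eq_cube)
    moreover have "0 \<le> \<eta>\<^sup>2" "0 \<le> \<eta> ^ 3" using \<eta> by simp_all
    ultimately show ?thesis using \<eta> by linarith
  qed
  define K where "K = (1 / sqrt (1 - s * (s * a)) + 2) ^ card \<Lambda>"
  have K: "K \<ge> 0" using sa by (simp add: K_def)
  \<comment> \<open>The mass threshold of the exponential moment bound with \<open>p = s\<close> and
    exponent \<open>s * a\<close>; the 1 keeps the mass positive.\<close>
  define m0 where "m0 = max 1 (2 * (s / (s - 1)) * (s * a) * \<beta> * increment_const \<beta> * sqrt \<beta>)"
  have cg: "config_gauss \<beta> m (\<gamma> m) \<Lambda>" if "m \<ge> m0" for m
    using that assms(1) \<Lambda> \<gamma>[of m] by unfold_locales (auto simp: m0_def)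
  have moment: "(\<integral>\<^sup>+\<omega>. ennreal (exp (s * a / 2 * config_gauss.total_sq \<beta> \<Lambda> \<omega>)) \<partial>config_gauss.G (\<gamma> m) \<Lambda>) \<le> ennreal K"
    if "m \<ge> m0" for m
    unfolding K_def using that s a sa
    by (intro config_gauss.nn_integral_exp_total_sq_le[OF cg[OF that]]) (auto simp: m0_def)
  have bound': "\<bar>g \<omega>\<bar> \<le> C * exp (a / 2 * config_gauss.total_sq \<beta> \<Lambda> \<omega>)"
    if "m \<ge> m0" "\<omega> \<in> topspace (config_top \<beta> \<Lambda>)" for m \<omega>
    using bound[OF that(2)] by (simp only: config_gauss.total_sq_def[OF cg[OF that(1)]])
  define modulus where "modulus d R e \<longleftrightarrow> (\<forall>\<omega>\<in>topspace (config_top \<beta> \<Lambda>). \<forall>x. (\<forall>j\<in>\<Lambda>. \<bar>x j\<bar> \<le> R) \<longrightarrow>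
        (\<forall>j\<in>\<Lambda>. loop_dist \<beta> (\<omega> j) (\<lambda>\<tau>\<in>{0..\<beta>}. x j) < d) \<longrightarrow>
        \<bar>g \<omega> - g (const_config \<beta> \<Lambda> x)\<bar> < e)" for d R e
  have near: "\<bar>g \<omega> - g (config_gauss.flatten \<beta> \<Lambda> \<omega>)\<bar> \<le> e"
    if mge: "m \<ge> m0" and "0 < d"
      and d: "modulus d R e"
      and \<omega>: "\<omega> \<in> config_gauss.typical \<beta> (\<gamma> m) \<Lambda> R (d / 3)"
    for m d R e \<omega>
  proof -
    interpret config_gauss \<beta> m "\<gamma> m" \<Lambda> by (rule cg[OF mge])
    have sp: "\<omega> \<in> space G" using \<omega> by (simp add: typical_def)
    have "\<bar>g \<omega> - g (const_config \<beta> \<Lambda> (\<lambda>j. loop_mean \<beta> (\<omega> j)))\<bar> < e"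
    proof (rule d[unfolded modulus_def, rule_format])
      fix j assume j: "j \<in> \<Lambda>"
      show "\<bar>loop_mean \<beta> (\<omega> j)\<bar> \<le> R" using \<omega> j by (simp add: typical_def)
      have "\<omega> j \<in> space (\<gamma> m) - rough (d / 3)"
        using \<omega> j sp by (auto simp: typical_def space_G topspace_config_top space_\<gamma>)
      \<comment> \<open>The distance is at most \<open>2 * (d / 3)\<close>; taking a third gives the
        strict inequality that \<open>modulus\<close> asks for.\<close>
      from loop_dist_mean_le[OF this] show "loop_dist \<beta> (\<omega> j) (\<lambda>\<tau>\<in>{0..\<beta>}. loop_mean \<beta> (\<omega> j)) < d"
        using \<open>0 < d\<close> by simp
    qed (use sp space_G in simp)
    then show ?thesis by (simp add: flatten_def)
  qed
  have est: "integrable (\<Pi>\<^sub>M j\<in>\<Lambda>. \<gamma> m) g" "integrable (qc_reference \<beta> \<Lambda>) g"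
    "\<bar>(\<integral>\<omega>. g \<omega> \<partial>(\<Pi>\<^sub>M j\<in>\<Lambda>. \<gamma> m)) - (\<integral>\<omega>. g \<omega> \<partial>qc_reference \<beta> \<Lambda>)\<bar> \<le>
      e + 2 * C * (exp \<mu> * (card \<Lambda> * (8 / (\<beta> * R\<^sup>2) + chain_const \<beta> (d / 3) / m ^ 4)) + exp ((1 - s) * \<mu>) * K)"
    if mge: "m \<ge> m0" and d: "0 < d" "modulus d R e"
      and "e > 0" "R > 0"
    for m d R e \<mu>
  proof -
    interpret config_gauss \<beta> m "\<gamma> m" \<Lambda> by (rule cg[OF mge])
    have small: "\<bar>g \<omega> - g (flatten \<omega>)\<bar> \<le> e" if "\<omega> \<in> typical R (d / 3)" for \<omega>
      by (rule near[OF mge d that])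
    note * = integral_flatten_diff_le[OF g _ a(1) s C K moment[OF mge] _ less_imp_le[OF \<open>e > 0\<close>], where R = R and \<delta> = "d / 3"]
    have "integrable G g" by (rule *(1)) (erule bound'[OF mge], erule small)
    then show "integrable (\<Pi>\<^sub>M j\<in>\<Lambda>. \<gamma> m) g" by (simp add: G_def)
    show "integrable (qc_reference \<beta> \<Lambda>) g" by (rule *(2)) (erule bound'[OF mge], erule small)
    have "\<bar>(\<integral>\<omega>. g \<omega> \<partial>G) - (\<integral>\<omega>. g \<omega> \<partial>qc_reference \<beta> \<Lambda>)\<bar> \<le>
      e + 2 * C * (exp \<mu> * measure G (space G - typical R (d / 3)) + exp ((1 - s) * \<mu>) * K)"
      by (rule *(3)) (erule bound'[OF mge], erule small)
    also have "\<dots> \<le> e + 2 * C * (exp \<mu> * (card \<Lambda> * (8 / (\<beta> * R\<^sup>2) + chain_const \<beta> (d / 3) / m ^ 4)) + exp ((1 - s) * \<mu>) * K)"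
      using C d(1) \<open>R > 0\<close> by (intro add_left_mono mult_left_mono add_right_mono measure_atypical_le) auto
    finally show "\<bar>(\<integral>\<omega>. g \<omega> \<partial>(\<Pi>\<^sub>M j\<in>\<Lambda>. \<gamma> m)) - (\<integral>\<omega>. g \<omega> \<partial>qc_reference \<beta> \<Lambda>)\<bar> \<le>
      e + 2 * C * (exp \<mu> * (card \<Lambda> * (8 / (\<beta> * R\<^sup>2) + chain_const \<beta> (d / 3) / m ^ 4)) + exp ((1 - s) * \<mu>) * K)"
      by (simp add: G_def)
  qed
  have ex_modulus: "\<exists>d>0. modulus d R e" if "e > 0" for R e
    unfolding modulus_def
    by (rule uniform_continuity_near_constants[OF g \<Lambda> less_imp_le[OF assms(1)] that, of R]) blast
  \<comment> \<open>For integrability any instance of the estimate will do, here with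
    \<open>R\<close> and \<open>e\<close> equal to 1.\<close>
  obtain d1 where d1: "d1 > 0" "modulus d1 1 1" using ex_modulus[of 1 1] by auto
  have "integrable (\<Pi>\<^sub>M j\<in>\<Lambda>. \<gamma> m) g" if "m \<ge> m0" for m
    by (rule est(1)[OF that d1]) simp_all
  then show "eventually (\<lambda>m. integrable (\<Pi>\<^sub>M j\<in>\<Lambda>. \<gamma> m) g) at_top"
    by (auto simp: eventually_at_top_linorder)
  show "integrable (qc_reference \<beta> \<Lambda>) g"
    by (rule est(2)[OF order_refl d1]) simp_all
  show "((\<lambda>m. \<integral>\<omega>. g \<omega> \<partial>(\<Pi>\<^sub>M j\<in>\<Lambda>. \<gamma> m)) \<longlongrightarrow> (\<integral>\<omega>. g \<omega> \<partial>qc_reference \<beta> \<Lambda>)) at_top"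
  proof (rule tendstoI)
    fix e :: real assume e: "e > 0"
    \<comment> \<open>With \<open>exp (- y) \<le> 1 / y\<close> this brings the tail term below
      \<open>e / 4\<close>; the added 1 covers \<open>C * K = 0\<close>.\<close>
    define y where "y = (8 * C * K + 1) / e"
    define \<mu> where "\<mu> = y / (s - 1)"
    define A where "A = 2 * C * exp \<mu> * card \<Lambda>"
    \<comment> \<open>Chosen after \<open>\<mu>\<close>, since \<open>A\<close> contains the factor
      \<open>exp \<mu>\<close>: the term for large averages becomes
      \<open>8 * A * e / (32 * A + 1)\<close>, which is below \<open>e / 4\<close>.\<close>
    define R where "R = sqrt ((32 * A + 1) / (\<beta> * e))"
    have "A \<ge> 0" using C by (simp add: A_def)
    have "y > 0" using C K e by (simp add: y_def add_nonneg_pos)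
    have "(1 - s) * \<mu> = - y" using s by (simp add: \<mu>_def field_simps)
    moreover have "exp (- y) \<le> 1 / y"
    proof -
      have "y \<le> exp y" using exp_ge_add_one_self[of y] by linarith
      then show ?thesis using \<open>y > 0\<close> by (simp add: exp_minus field_simps)
    qed
    ultimately have "2 * C * (exp ((1 - s) * \<mu>) * K) \<le> 2 * C * (1 / y * K)"
      using C K by (intro mult_left_mono mult_right_mono) auto
    also have "\<dots> < e / 4"
    proof -
      have "0 \<le> C * K" using C K by simp
      then have "8 * C * K * e < e * (8 * C * K + 1)" using e by (simp add: algebra_simps)
      moreover have "0 < 8 * C * K + 1" using \<open>0 \<le> C * K\<close> by linarith
      ultimately show ?thesis using e unfolding y_def by (simp add: field_simps)
    qed
    finally have t1: "2 * C * (exp ((1 - s) * \<mu>) * K) < e / 4" .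
    have "R > 0" using \<open>A \<ge> 0\<close> assms(1) e by (simp add: R_def add_nonneg_pos)
    have R2: "\<beta> * R\<^sup>2 = (32 * A + 1) / e" using \<open>A \<ge> 0\<close> assms(1) e by (simp add: R_def)
    have "A * (8 / (\<beta> * R\<^sup>2)) = 8 * A * e / (32 * A + 1)" unfolding R2 by simp
    also have "\<dots> < e / 4"
    proof -
      have "8 * A * e * 4 < e * (32 * A + 1)" using e by (simp add: algebra_simps)
      then show ?thesis using \<open>A \<ge> 0\<close> by (simp add: divide_less_eq less_divide_eq add_nonneg_pos)
    qed
    finally have t2: "A * (8 / (\<beta> * R\<^sup>2)) < e / 4" .
    have "e / 4 > 0" using e by simp
    from ex_modulus[OF this, of R] obtain d where d: "d > 0" "modulus d R (e / 4)" by auto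
    have "((\<lambda>m. A * chain_const \<beta> (d / 3) / m ^ 4) \<longlongrightarrow> 0) at_top"
      by (intro tendsto_divide_0[OF tendsto_const] filterlim_at_top_imp_at_infinity filterlim_pow_at_top filterlim_ident) simp
    then have "eventually (\<lambda>m. A * chain_const \<beta> (d / 3) / m ^ 4 < e / 4) at_top"
      using \<open>e / 4 > 0\<close> by (rule order_tendstoD)
    moreover have "eventually (\<lambda>m. m \<ge> m0) at_top" by (rule eventually_ge_at_top)
    ultimately show "eventually (\<lambda>m. dist (\<integral>\<omega>. g \<omega> \<partial>(\<Pi>\<^sub>M j\<in>\<Lambda>. \<gamma> m)) (\<integral>\<omega>. g \<omega> \<partial>qc_reference \<beta> \<Lambda>) < e) at_top"
    proof eventually_elim
      case (elim m)
      have "\<bar>(\<integral>\<omega>. g \<omega> \<partial>(\<Pi>\<^sub>M j\<in>\<Lambda>. \<gamma> m)) - (\<integral>\<omega>. g \<omega> \<partial>qc_reference \<beta> \<Lambda>)\<bar> \<le>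
        e / 4 + 2 * C * (exp \<mu> * (card \<Lambda> * (8 / (\<beta> * R\<^sup>2) + chain_const \<beta> (d / 3) / m ^ 4)) + exp ((1 - s) * \<mu>) * K)"
        by (rule est(3)[OF elim(2) d \<open>e / 4 > 0\<close> \<open>R > 0\<close>])
      also have "\<dots> = e / 4 + A * (8 / (\<beta> * R\<^sup>2)) + A * chain_const \<beta> (d / 3) / m ^ 4 + 2 * C * (exp ((1 - s) * \<mu>) * K)"
        unfolding A_def by (simp add: distrib_left)
      finally show ?case using t1 t2 elim(1) e unfolding dist_real_def by linarith
    qed
  qed
qed

section \<open>Normalization and the limit of the Gibbs measures\<close>

lemma sets_gibbs: "sets (gibbs E M) = sets M"
  by (simp add: gibbs_def)

text \<open>\<open>gibbs\<close> divides by an extended nonnegative integral. Integrability makes it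
  finite, and positivity of the exponential makes it nonzero, so expectations become quotients of
  ordinary integrals.\<close>

lemma gibbs_normalized:
  assumes "prob_space M" and E: "E \<in> borel_measurable M" and i: "integrable M (\<lambda>\<omega>. exp (- E \<omega>))"
  shows gibbs_partition_pos: "(\<integral>\<omega>. exp (- E \<omega>) \<partial>M) > 0"
    and prob_space_gibbs: "prob_space (gibbs E M)"
    and integral_gibbs: "F \<in> borel_measurable M \<Longrightarrow>
      (\<integral>\<omega>. F \<omega> \<partial>gibbs E M) = (\<integral>\<omega>. F \<omega> * exp (- E \<omega>) \<partial>M) / (\<integral>\<omega>. exp (- E \<omega>) \<partial>M)"
proof -
  interpret prob_space M by fact
  let ?z = "\<integral>\<omega>. exp (- E \<omega>) \<partial>M"
  have Z: "(\<integral>\<^sup>+\<omega>. ennreal (exp (- E \<omega>)) \<partial>M) = ennreal ?z"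
    using i by (intro nn_integral_eq_integral) auto
  show pos: "?z > 0"
  proof (rule ccontr)
    assume "\<not> ?z > 0"
    then have "(\<integral>\<^sup>+\<omega>. ennreal (exp (- E \<omega>)) \<partial>M) = 0" unfolding Z by (simp add: ennreal_neg)
    then have "AE \<omega> in M. ennreal (exp (- E \<omega>)) = 0" using E by (subst (asm) nn_integral_0_iff_AE) auto
    then have "AE \<omega> in M. False" by (simp add: ennreal_eq_0_iff not_le)
    then show False by simp
  qed
  have dens: "ennreal (exp (- E \<omega>)) / (\<integral>\<^sup>+\<omega>'. ennreal (exp (- E \<omega>')) \<partial>M) = ennreal (exp (- E \<omega>) / ?z)" for \<omega>
    unfolding Z using pos by (simp add: divide_ennreal)
  have g: "gibbs E M = density M (\<lambda>\<omega>. ennreal (exp (- E \<omega>) / ?z))" by (simp only: gibbs_def dens)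
  have me: "(\<lambda>\<omega>. exp (- E \<omega>) / ?z) \<in> borel_measurable M" using E by measurable
  show "prob_space (gibbs E M)"
  proof
    have "emeasure (gibbs E M) (space (gibbs E M)) = (\<integral>\<^sup>+\<omega>. ennreal (exp (- E \<omega>) / ?z) \<partial>M)"
      unfolding g using me by (subst emeasure_density) (auto intro!: nn_integral_cong)
    also have "\<dots> = ennreal (\<integral>\<omega>. exp (- E \<omega>) / ?z \<partial>M)"
      using i pos by (intro nn_integral_eq_integral) auto
    also have "\<dots> = 1" using pos by simp
    finally show "emeasure (gibbs E M) (space (gibbs E M)) = 1" .
  qed
  assume F: "F \<in> borel_measurable M"
  have "(\<integral>\<omega>. F \<omega> \<partial>gibbs E M) = (\<integral>\<omega>. (exp (- E \<omega>) / ?z) *\<^sub>R F \<omega> \<partial>M)"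
    unfolding g by (rule integral_density[OF F me]) (use pos in auto)
  also have "\<dots> = (\<integral>\<omega>. F \<omega> * exp (- E \<omega>) / ?z \<partial>M)" by (simp add: mult.commute)
  also have "\<dots> = (\<integral>\<omega>. F \<omega> * exp (- E \<omega>) \<partial>M) / ?z" by simp
  finally show "(\<integral>\<omega>. F \<omega> \<partial>gibbs E M) = (\<integral>\<omega>. F \<omega> * exp (- E \<omega>) \<partial>M) / ?z" .
qed

theorem theorem4p1:
  fixes J U :: "real \<Rightarrow> real" and r c c' b \<beta> :: real
    and k0 k1 :: "int ^ 'd"
    and \<gamma> :: "real \<Rightarrow> (real \<Rightarrow> real) measure"
  assumes "r > 0" and "\<And>t. t > r \<Longrightarrow> J t = 0"
    and "\<And>j :: int ^ 'd. ((\<lambda>k. \<bar>J (lattice_dist j k)\<bar>) has_sum c) UNIV"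
    and "continuous_on UNIV U"
    and "c' > max (c - 1) 0" and "\<And>x. U x \<ge> 1 / 2 * c' * x\<^sup>2 + b"
    and "\<beta> > 0"
    and "\<And>l. k0 $ l < k1 $ l"
    and "\<And>m. m > 0 \<Longrightarrow> loop_gaussian \<beta> m (\<gamma> m)"
  shows "weakly_converges (config_top \<beta> (box_of k0 k1))
           (\<lambda>m. nu_per U J \<beta> k0 k1 (\<gamma> m)) (nu_qcp U J \<beta> k0 k1) at_top"
proof -
  let ?\<Lambda> = "box_of k0 k1" and ?X = "config_top \<beta> (box_of k0 k1)" and ?E = "per_energy U J \<beta> k0 k1"
  let ?Q = "qc_reference \<beta> (box_of k0 k1)" and ?G = "\<lambda>m. \<Pi>\<^sub>M j\<in>box_of k0 k1. \<gamma> m"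
  have cg: "config_gauss \<beta> m (\<gamma> m) ?\<Lambda>" if "m > 0" for m
    using that assms(7,9) finite_box_of by unfold_locales auto
  \<comment> \<open>The quasi-classical reference is the flattened image of the Gaussian product at
    any mass; mass 1 is picked to see that it is a probability measure.\<close>
  interpret one: config_gauss \<beta> 1 "\<gamma> 1" ?\<Lambda> by (rule cg) simp
  have sets_Q: "sets ?Q = sets (borel_of ?X)"
    unfolding qc_reference_def config_top_def
    by (simp add: sets_borel_of_product_topology[OF finite_box_of second_countable_loop_top])
  have prob_Q: "prob_space ?Q"
    unfolding one.qc_reference_eq by (rule one.G.prob_space_distr[OF one.flatten_measurable])
  have sets_G: "sets (?G m) = sets (borel_of ?X)" "prob_space (?G m)" if "m > 0" for m
  proof -
    interpret config_gauss \<beta> m "\<gamma> m" ?\<Lambda> by (rule cg[OF that])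
    show "sets (?G m) = sets (borel_of ?X)" using sets_G by (simp add: G_def)
    show "prob_space (?G m)" using G.prob_space_axioms by (simp add: G_def)
  qed
  have E: "continuous_map ?X euclideanreal ?E" by (rule continuous_map_per_energy[OF assms(4,7)])
  \<comment> \<open>The hypothesis on \<open>c'\<close> gives \<open>a < 1\<close>; the maximum with
    0 provides the nonnegative exponent that the moment bounds ask for when
    \<open>c' > c\<close>.\<close>
  define a where "a = max 0 (c - c')"
  have a: "0 \<le> a" "a < 1" using assms(5) by (auto simp: a_def)
  define C where "C = exp (- (card ?\<Lambda> * (b * \<beta>)))"
  have weight: "exp (- ?E \<omega>) \<le> C * exp (a / 2 * (\<Sum>j\<in>?\<Lambda>. loop_sq \<beta> (\<omega> j)))" if "\<omega> \<in> topspace ?X" for \<omega>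
  proof -
    let ?S = "\<Sum>j\<in>?\<Lambda>. loop_sq \<beta> (\<omega> j)"
    have "?S \<ge> 0" by (intro sum_nonneg loop_sq_nonneg)
    moreover have "(c - c') / 2 \<le> a / 2" by (intro divide_right_mono) (simp_all add: a_def)
    ultimately have "(c - c') / 2 * ?S \<le> a / 2 * ?S" by (intro mult_right_mono)
    moreover have "1 / 2 * (c' - c) * ?S = - ((c - c') / 2 * ?S)" by (simp add: field_simps)
    ultimately have "- ?E \<omega> \<le> - (card ?\<Lambda> * (b * \<beta>)) + a / 2 * ?S"
      using per_energy_ge[OF assms(3,4,6,7) that] by linarith
    then show ?thesis unfolding C_def exp_add[symmetric] by simp
  qed
  have meas: "F \<in> borel_measurable ?Q" "m > 0 \<Longrightarrow> F \<in> borel_measurable (?G m)"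
    if "continuous_map ?X euclideanreal F" for F m
    using continuous_map_imp_borel_measurable[OF that] measurable_cong_sets[OF sets_Q refl]
      measurable_cong_sets[OF sets_G(1) refl, of m] by blast+
  have lim: "eventually (\<lambda>m. integrable (?G m) (\<lambda>\<omega>. F \<omega> * exp (- ?E \<omega>))) at_top"
    "integrable ?Q (\<lambda>\<omega>. F \<omega> * exp (- ?E \<omega>))"
    "((\<lambda>m. \<integral>\<omega>. F \<omega> * exp (- ?E \<omega>) \<partial>?G m) \<longlongrightarrow> (\<integral>\<omega>. F \<omega> * exp (- ?E \<omega>) \<partial>?Q)) at_top"
    if F: "continuous_map ?X euclideanreal F" "bounded (F ` topspace ?X)" for F
  proof -
    obtain B where B: "B > 0" "\<And>\<omega>. \<omega> \<in> topspace ?X \<Longrightarrow> \<bar>F \<omega>\<bar> \<le> B"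
      using F(2) unfolding bounded_pos by auto
    have "continuous_map ?X euclideanreal (\<lambda>\<omega>. exp (- ?E \<omega>))"
      using continuous_map_compose[OF E, of euclideanreal "\<lambda>x. exp (- x)"]
      by (simp add: o_def continuous_intros)
    then have g: "continuous_map ?X euclideanreal (\<lambda>\<omega>. F \<omega> * exp (- ?E \<omega>))"
      by (rule continuous_map_real_mult[OF F(1)])
    have bound: "\<bar>F \<omega> * exp (- ?E \<omega>)\<bar> \<le> B * C * exp (a / 2 * (\<Sum>j\<in>?\<Lambda>. loop_sq \<beta> (\<omega> j)))"
      if "\<omega> \<in> topspace ?X" for \<omega>
      using mult_mono[OF B(2)[OF that] weight[OF that]] B(1) by (simp add: abs_mult mult.assoc)
    have "0 \<le> B * C" using B(1) by (simp add: C_def)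
    note * = tendsto_integral_qc_reference[OF assms(7) finite_box_of _ g _ a this, of \<gamma>]
    show "eventually (\<lambda>m. integrable (?G m) (\<lambda>\<omega>. F \<omega> * exp (- ?E \<omega>))) at_top"
      by (rule *(1)) (erule assms(9), erule bound)
    show "integrable ?Q (\<lambda>\<omega>. F \<omega> * exp (- ?E \<omega>))" by (rule *(2)) (erule assms(9), erule bound)
    show "((\<lambda>m. \<integral>\<omega>. F \<omega> * exp (- ?E \<omega>) \<partial>?G m) \<longlongrightarrow> (\<integral>\<omega>. F \<omega> * exp (- ?E \<omega>) \<partial>?Q)) at_top"
      by (rule *(3)) (erule assms(9), erule bound)
  qed
  have bounded1: "bounded ((\<lambda>_. 1 :: real) ` topspace ?X)" by (rule finite_imp_bounded) (simp add: image_constant_conv)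
  \<comment> \<open>The constant test function gives convergence of the partition functions, so the
    normalized integrals converge as quotients with a positive limit in the denominator.\<close>
  note lim1 = lim[of "\<lambda>_. 1", OF _ bounded1, simplified]
  have pos: "eventually (\<lambda>m::real. m > 0) at_top" by (rule eventually_gt_at_top)
  note gibbs_Q = gibbs_normalized[OF prob_Q meas(1)[OF E] lim1(2)]
  show ?thesis
    unfolding weakly_converges_def nu_per_def nu_qcp_def
  proof (intro conjI allI impI)
    show "eventually (\<lambda>m. prob_space (gibbs ?E (?G m)) \<and> sets (gibbs ?E (?G m)) = sets (borel_of ?X)) at_top"
      using lim1(1) pos
    proof eventually_elim
      case (elim m)
      then show ?case
        using prob_space_gibbs[OF sets_G(2) meas(2)[OF E]] sets_G(1) by (simp add: sets_gibbs)
    qed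
    show "prob_space (gibbs ?E ?Q)" by (rule gibbs_Q(2))
    show "sets (gibbs ?E ?Q) = sets (borel_of ?X)" by (simp add: sets_gibbs sets_Q)
    fix F :: "(int ^ 'd \<Rightarrow> real \<Rightarrow> real) \<Rightarrow> real"
    assume F: "continuous_map ?X euclideanreal F \<and> bounded (F ` topspace ?X)"
    have "((\<lambda>m. (\<integral>\<omega>. F \<omega> * exp (- ?E \<omega>) \<partial>?G m) / (\<integral>\<omega>. exp (- ?E \<omega>) \<partial>?G m)) \<longlongrightarrow>
       (\<integral>\<omega>. F \<omega> * exp (- ?E \<omega>) \<partial>?Q) / (\<integral>\<omega>. exp (- ?E \<omega>) \<partial>?Q)) at_top"
      using F gibbs_Q(1) by (intro tendsto_divide lim(3) lim1(3)) auto
    moreover have "eventually (\<lambda>m. (\<integral>\<omega>. F \<omega> * exp (- ?E \<omega>) \<partial>?G m) / (\<integral>\<omega>. exp (- ?E \<omega>) \<partial>?G m)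
       = (\<integral>\<omega>. F \<omega> \<partial>gibbs ?E (?G m))) at_top"
      using lim1(1) pos
    proof eventually_elim
      case (elim m)
      then show ?case
        using integral_gibbs[OF sets_G(2) meas(2)[OF E] _ meas(2)] F by simp
    qed
    ultimately have "((\<lambda>m. \<integral>\<omega>. F \<omega> \<partial>gibbs ?E (?G m)) \<longlongrightarrow>
       (\<integral>\<omega>. F \<omega> * exp (- ?E \<omega>) \<partial>?Q) / (\<integral>\<omega>. exp (- ?E \<omega>) \<partial>?Q)) at_top"
      by (rule Lim_transform_eventually)
    then show "((\<lambda>m. \<integral>\<omega>. F \<omega> \<partial>gibbs ?E (?G m)) \<longlongrightarrow> (\<integral>\<omega>. F \<omega> \<partial>gibbs ?E ?Q)) at_top"
      using F by (simp only: gibbs_Q(3)[OF meas(1)])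
  qed
qed

end
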